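(* Let $\mathcal G$ be an infinite connected subgraph of $\mathbb B$ with natural weights. There exist constants $c_1,c_2>0$ such that the following holds. Let $x,y\in\mathcal G$ and $t>0$ be such that $N:=\lfloor\sqrt{d(x,y)^3/t}\rfloor\ge8$, and suppose the event $F_*\big(x,y,d(x,y)N^{-1},\frac18N;\,d(x,y)^3t^{-2/3},N\big)$ holds. Then $$q_t(x,y)\le c_1t^{-2/3}\exp(-c_2N).$$
   Context: $\mathbb B$ is the rooted tree in which every vertex has $n_0\ge2$ children; $\gamma(x,y)$ is the unique geodesic path from $x$ to $y$, and $z$ is a middle point of $\gamma(x,y)$ if $z\in\gamma(x,y)$ and $|d(x,z)-\frac12d(x,y)|\le\frac12$. On $\mathcal G$ (a fixed, deterministic subtree): $\mu_{xy}=1$ for adjacent $x,y$, $0$ otherwise; $\mu_x$ is the degree in $\mathcal G$, $\mu(A)=\sum_{x\in A}\mu_x$, $d$ the graph distance, $B(x,r)=\{y\in\mathcal G:d(x,y)\le r\}$, $V(x,r)=\mu(B(x,r))$. $Y$ is the continuous-time simple random walk on $\mathcal G$ (exponential mean-1 holding times, jumps to a uniform neighbour) with law $P^x$, and $q_t(x,y)=P^x(Y_t=y)/\mu_y$. $M(x,r)$ is the smallest $m$ such that there is $A=\{z_1,\dots,z_m\}\subset\mathcal G$ with $d(x,z_i)\in[r/4,3r/4]$ for all $i$ such that every path in $\mathcal G$ from $x$ to $\mathcal G\setminus B(x,r)$ passes through $A$. For $\lambda\ge64$, $B(x,r)$ is $\lambda$-good if: $x\in\mathcal G$; $r^2\lambda^{-2}\le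 V(x,r)\le r^2\lambda$; $M(x,r)\le\lambda/64$; $V(x,r/\lambda)\ge r^2\lambda^{-4}$; $V(x,r/\lambda^2)\ge r^2\lambda^{-6}$. $\lambda_1\ge64$ is a fixed absolute constant (chosen in the paper so that, for the incipient infinite cluster, balls fail to be $\lambda_1$-good with probability at most $1/4$). Conditions: $F_1(x,y,r,k)$ holds if $x,y\in\mathcal G$ and there exist at least $k$ disjoint balls $B(z,r/2)$ with $z\in\gamma(x,y)$ which are $\lambda_1$-good. $A_*(z,r,N)$ holds if $z\in\mathcal G$ and $B(z,r)$ is $N$-good. With $z_0$ a middle point of $\gamma(x,y)$, $F_*(x,y,R,k;r,N)$ holds if $F_1(x,z_0,R,k/2)$, $F_1(z_0,y,R,k/2)$, $A_*(x,r,N)$, $A_*(z_0,r,N)$ and $A_*(y,r,N)$ all hold. *)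

theory Defs
  imports "HOL-Analysis.Analysis"
begin

text \<open>Vertices of B are finite words over {0..<n0}; the root is the empty word and
  the children of w are the words i # w with i < n0.\<close>

definition Bverts :: "nat \<Rightarrow> nat list set" where
  "Bverts n0 = {w. \<forall>i\<in>set w. i < n0}"

definition adjB :: "nat \<Rightarrow> nat list \<Rightarrow> nat list \<Rightarrow> bool" where
  "adjB n0 x y \<longleftrightarrow> x \<in> Bverts n0 \<and> y \<in> Bverts n0 \<and>
     ((\<exists>i<n0. x = i # y) \<or> (\<exists>i<n0. y = i # x))"

definition adjG :: "nat \<Rightarrow> nat list set \<Rightarrow> nat list \<Rightarrow> nat list \<Rightarrow> bool" where
  "adjG n0 G x y \<longleftrightarrow> x \<in> G \<and> y \<in> G \<and> adjB n0 x y"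

definition gpath :: "nat \<Rightarrow> nat list set \<Rightarrow> nat list list \<Rightarrow> nat list \<Rightarrow> nat list \<Rightarrow> bool" where
  "gpath n0 G p x y \<longleftrightarrow> p \<noteq> [] \<and> hd p = x \<and> last p = y \<and> set p \<subseteq> G \<and>
     (\<forall>i. Suc i < length p \<longrightarrow> adjG n0 G (p ! i) (p ! Suc i))"

definition connectedG :: "nat \<Rightarrow> nat list set \<Rightarrow> bool" where
  "connectedG n0 G \<longleftrightarrow> (\<forall>x\<in>G. \<forall>y\<in>G. \<exists>p. gpath n0 G p x y)"

definition gdist :: "nat \<Rightarrow> nat list set \<Rightarrow> nat list \<Rightarrow> nat list \<Rightarrow> nat" where
  "gdist n0 G x y = (LEAST n. \<exists>p. gpath n0 G p x y \<and> length p = Suc n)"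

definition geod :: "nat \<Rightarrow> nat list set \<Rightarrow> nat list \<Rightarrow> nat list \<Rightarrow> nat list set" where
  "geod n0 G x y = {z. \<exists>p. gpath n0 G p x y \<and> length p = Suc (gdist n0 G x y) \<and> z \<in> set p}"

definition middle_point :: "nat \<Rightarrow> nat list set \<Rightarrow> nat list \<Rightarrow> nat list \<Rightarrow> nat list \<Rightarrow> bool" where
  "middle_point n0 G x y z \<longleftrightarrow> z \<in> geod n0 G x y \<and>
     \<bar>real (gdist n0 G x z) - real (gdist n0 G x y) / 2\<bar> \<le> 1/2"

definition mu :: "nat \<Rightarrow> nat list set \<Rightarrow> nat list \<Rightarrow> real" where
  "mu n0 G x = real (card {y. adjG n0 G x y})"

definition muset :: "nat \<Rightarrow> nat list set \<Rightarrow> nat list set \<Rightarrow> real" where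
  "muset n0 G A = (\<Sum>x\<in>A. mu n0 G x)"

definition gball :: "nat \<Rightarrow> nat list set \<Rightarrow> nat list \<Rightarrow> real \<Rightarrow> nat list set" where
  "gball n0 G x r = {y \<in> G. real (gdist n0 G x y) \<le> r}"

definition Vol :: "nat \<Rightarrow> nat list set \<Rightarrow> nat list \<Rightarrow> real \<Rightarrow> real" where
  "Vol n0 G x r = muset n0 G (gball n0 G x r)"

text \<open>M(x,r), with value infinity if no cut set exists.\<close>
definition cutset :: "nat \<Rightarrow> nat list set \<Rightarrow> nat list \<Rightarrow> real \<Rightarrow> nat list set \<Rightarrow> bool" where
  "cutset n0 G x r A \<longleftrightarrow> finite A \<and>
     (\<forall>z\<in>A. z \<in> G \<and> r/4 \<le> real (gdist n0 G x z) \<and> real (gdist n0 G x z) \<le> 3*r/4) \<and>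
     (\<forall>p w. gpath n0 G p x w \<and> w \<in> G - gball n0 G x r \<longrightarrow> set p \<inter> A \<noteq> {})"

definition Mcut :: "nat \<Rightarrow> nat list set \<Rightarrow> nat list \<Rightarrow> real \<Rightarrow> ereal" where
  "Mcut n0 G x r = Inf {ereal (real (card A)) | A. cutset n0 G x r A}"

text \<open>lambda-good balls (the notion is defined for lambda \<ge> 64).\<close>
definition good :: "nat \<Rightarrow> nat list set \<Rightarrow> real \<Rightarrow> nat list \<Rightarrow> real \<Rightarrow> bool" where
  "good n0 G lam x r \<longleftrightarrow> lam \<ge> 64 \<and> x \<in> G \<and>
     r^2 / lam^2 \<le> Vol n0 G x r \<and> Vol n0 G x r \<le> r^2 * lam \<and>
     Mcut n0 G x r \<le> ereal (lam / 64) \<and>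
     Vol n0 G x (r / lam) \<ge> r^2 / lam^4 \<and>
     Vol n0 G x (r / lam^2) \<ge> r^2 / lam^6"

text \<open>The conditions F_1, A_*, F_* (lam1 is the fixed constant lambda_1;
  z0 is the chosen middle point).\<close>
definition F1 :: "nat \<Rightarrow> nat list set \<Rightarrow> real \<Rightarrow> nat list \<Rightarrow> nat list \<Rightarrow> real \<Rightarrow> real \<Rightarrow> bool" where
  "F1 n0 G lam1 x y r k \<longleftrightarrow> x \<in> G \<and> y \<in> G \<and>
     (\<exists>Z. finite Z \<and> Z \<subseteq> geod n0 G x y \<and> real (card Z) \<ge> k \<and>
        (\<forall>z\<in>Z. \<forall>z'\<in>Z. z \<noteq> z' \<longrightarrow> gball n0 G z (r/2) \<inter> gball n0 G z' (r/2) = {}) \<and>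
        (\<forall>z\<in>Z. good n0 G lam1 z (r/2)))"

definition Astar :: "nat \<Rightarrow> nat list set \<Rightarrow> nat list \<Rightarrow> real \<Rightarrow> real \<Rightarrow> bool" where
  "Astar n0 G z r N \<longleftrightarrow> z \<in> G \<and> good n0 G N z r"

definition Fstar :: "nat \<Rightarrow> nat list set \<Rightarrow> real \<Rightarrow> nat list \<Rightarrow> nat list \<Rightarrow> nat list
     \<Rightarrow> real \<Rightarrow> real \<Rightarrow> real \<Rightarrow> real \<Rightarrow> bool" where
  "Fstar n0 G lam1 z0 x y R k r N \<longleftrightarrow>
     F1 n0 G lam1 x z0 R (k/2) \<and> F1 n0 G lam1 z0 y R (k/2) \<and>
     Astar n0 G x r N \<and> Astar n0 G z0 r N \<and> Astar n0 G y r N"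

fun pstep :: "nat \<Rightarrow> nat list set \<Rightarrow> nat \<Rightarrow> nat list \<Rightarrow> nat list \<Rightarrow> real" where
  "pstep n0 G 0 x y = (if x = y then 1 else 0)"
| "pstep n0 G (Suc k) x y =
     (\<Sum>z\<in>{z. adjG n0 G x z}. pstep n0 G k z y / mu n0 G x)"

text \<open>With exponential mean-one holding times, the number of jumps up to time t is
  Poisson(t) and independent of the jump chain, so
  P^x(Y_t = y) = sum_k e^{-t} t^k / k! * p_k(x,y).\<close>
definition PY :: "nat \<Rightarrow> nat list set \<Rightarrow> real \<Rightarrow> nat list \<Rightarrow> nat list \<Rightarrow> real" where
  "PY n0 G t x y = (\<Sum>k. exp (-t) * t^k / fact k * pstep n0 G k x y)"

definition qt :: "nat \<Rightarrow> nat list set \<Rightarrow> real \<Rightarrow> nat list \<Rightarrow> nat list \<Rightarrow> real" where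
  "qt n0 G t x y = PY n0 G t x y / mu n0 G y"

end

theory Submission
  imports Defs "HOL-Library.Sublist"
begin

text \<open>
  Let z be the middle point, Q the averaging operator of the graph, and let u solve
  Q u = (1 + \<theta>) u off z with u = 1 at z, so that u(x) is the Laplace transform of the hitting time
  of z. Splitting at time t/2 and using reversibility together with the parabolic maximum principle,
  q_t(x,y) is at most e^(\<theta> t) (u(x) + u(y)) times the supremum of q_s(z,x) and q_s(z,y) over
  s in [t/2, t]. That supremum is O(N^2 t^(-2/3)) by Cauchy-Schwarz and the on-diagonal bound
  q_s(w,w) \<le> max (2 / V(w,\<rho>)) (4 \<rho> / s), a consequence of \<bar>f(w) - f(v)\<bar>^2 \<le> d(w,v) E(f,f).

  The decay of u is diffusive: along the geodesic towards z the increment of u over an edge is \<theta>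
  times the u-weighted volume behind that edge. A good ball contributes volume of order r^2 on which
  u is comparable to its value at the centre (here the small cut set enters), so consecutive good balls
  give U_{i+1} \<ge> U_i + \<sigma>^2 (U_0 + ... + U_i) with \<sigma>^2 of order \<theta> r^3, whence U grows like
  (1 + \<sigma>)^i. Since \<theta> t is of order \<sigma>^2 N only, a small constant \<sigma> makes the gain
  exp(- c \<sigma> N) beat the loss exp(C \<sigma>^2 N).
\<close>

section \<open>The heat semigroup of a locally finite graph\<close>

text \<open>What forces the running sum U_0 + ... + U_i is the comparison with the loss exp(\<theta>
  t). Taken one at a time, good balls only give U_{i+1} \<ge> (1 + \<sigma>^2) U_i, a gain exp(- c
  \<sigma>^2 N) of the same order in \<sigma> as the loss, and shrinking \<sigma> could not make the
  gain win. Letting each edge feel all the volume behind it turns \<sigma>^2 into \<sigma>. The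
  factor N^2 in the on-diagonal bound arises because the volume clause of an N-good ball that
  reaches down to the diffusive radius t^(1/3) loses powers of N; part of the exponential gain is
  spent on absorbing it. The graph is infinite and no probability space is built. Hitting times
  enter only through \<open>u\<close> and comparison principles, which have to do without an
  attained maximum, and energy estimates are proved for finitely supported functions before passing
  to the limit.\<close>

definition egf :: "(nat \<Rightarrow> real) \<Rightarrow> real \<Rightarrow> real" where
  "egf c t = (\<Sum>k. c k * t ^ k / fact k)"

lemma summable_egf:
  assumes "\<And>k. \<bar>c k\<bar> \<le> (C::real)"
  shows "summable (\<lambda>k. c k * t ^ k / fact k)"
proof (rule summable_comparison_test')
  show "summable (\<lambda>k. C * (\<bar>t\<bar> ^ k / fact k))"
    using summable_exp[of "\<bar>t\<bar>"] by (intro summable_mult) (simp add: divide_inverse mult.commute)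
  show "norm (c k * t ^ k / fact k) \<le> C * (\<bar>t\<bar> ^ k / fact k)" if "k \<ge> 0" for k
    using mult_right_mono[OF assms[of k], of "\<bar>t\<bar> ^ k / fact k"]
    by (simp add: abs_mult power_abs)
qed

lemma egf_sums:
  assumes "\<And>k. \<bar>c k\<bar> \<le> (C::real)"
  shows "(\<lambda>k. c k * t ^ k / fact k) sums egf c t"
  unfolding egf_def using summable_egf[OF assms] by (rule summable_sums)

lemma egf_const: "egf (\<lambda>k. C) t = C * exp t"
proof -
  have "(\<lambda>k. C * (t ^ k / fact k)) sums (C * exp t)"
    using exp_converges[of t] by (intro sums_mult) (simp add: divide_inverse mult.commute)
  then show ?thesis unfolding egf_def by (simp add: sums_iff)
qed

lemma egf_mono:
  assumes "\<And>k. \<bar>c k\<bar> \<le> (C::real)" "\<And>k. \<bar>d k\<bar> \<le> (D::real)" "\<And>k. c k \<le> d k" "t \<ge> 0"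
  shows "egf c t \<le> egf d t"
  unfolding egf_def
  by (intro suminf_le summable_egf[OF assms(1)] summable_egf[OF assms(2)] divide_right_mono
      mult_right_mono assms(3)) (use assms(4) in auto)

lemma egf_zero: "egf c 0 = c 0"
proof -
  have "(\<lambda>k. c k * 0 ^ k / fact k) = (\<lambda>k. (c k / fact k) * 0 ^ k)" by auto
  then show ?thesis unfolding egf_def by (simp only: powser_zero) simp
qed

lemma egf_add:
  assumes "\<And>k. \<bar>c k\<bar> \<le> (C::real)" "\<And>k. \<bar>d k\<bar> \<le> (D::real)"
  shows "egf (\<lambda>k. c k + d k) t = egf c t + egf d t"
proof -
  have "(\<lambda>k. c k * t ^ k / fact k + d k * t ^ k / fact k) sums (egf c t + egf d t)"
    by (intro sums_add egf_sums[OF assms(1)] egf_sums[OF assms(2)])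
  then show ?thesis unfolding egf_def by (simp add: sums_iff algebra_simps add_divide_distrib)
qed

lemma egf_cmult:
  assumes "\<And>k. \<bar>c k\<bar> \<le> (C::real)"
  shows "egf (\<lambda>k. a * c k) t = a * egf c t"
proof -
  have "(\<lambda>k. a * (c k * t ^ k / fact k)) sums (a * egf c t)"
    by (intro sums_mult egf_sums[OF assms])
  then show ?thesis unfolding egf_def by (simp add: sums_iff algebra_simps)
qed

lemma egf_sum:
  assumes "finite I" "\<And>i k. i \<in> I \<Longrightarrow> \<bar>c i k\<bar> \<le> (C::real)"
  shows "egf (\<lambda>k. \<Sum>i\<in>I. c i k) t = (\<Sum>i\<in>I. egf (c i) t)"
proof -
  have "(\<lambda>k. \<Sum>i\<in>I. (c i k * t ^ k / fact k)) sums (\<Sum>i\<in>I. egf (c i) t)"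
    by (intro sums_sum egf_sums[of _ C] assms)
  then show ?thesis unfolding egf_def
    by (simp add: sums_iff sum_distrib_right sum_divide_distrib)
qed

lemma has_derivative_egf:
  assumes "\<And>k. \<bar>c k\<bar> \<le> (C::real)"
  shows "(egf c has_real_derivative egf (\<lambda>k. c (Suc k)) t) (at t)"
proof -
  have d: "diffs (\<lambda>k. c k / fact k) = (\<lambda>k. c (Suc k) / fact k)"
    by (auto simp: diffs_def fun_eq_iff divide_simps)
  have "((\<lambda>x. \<Sum>n. (c n / fact n) * x ^ n) has_real_derivative
      (\<Sum>n. diffs (\<lambda>k. c k / fact k) n * t ^ n)) (at t)"
  proof (rule termdiffs_strong_converges_everywhere)
    show "summable (\<lambda>n. c n / fact n * y ^ n)" for y :: real
      using summable_egf[of c C y] assms by simp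
  qed
  then show ?thesis unfolding d egf_def[abs_def] by simp
qed

text \<open>The double series are truncated to squares so that finitely supported functions suffice
  in every energy computation.\<close>
lemma double_egf_tendsto:
  assumes "\<And>k l. \<bar>d k l\<bar> \<le> (C::real)"
  shows "(\<lambda>n. \<Sum>k<n. \<Sum>l<n. d k l * t ^ l / fact l * s ^ k / fact k)
           \<longlonglongrightarrow> egf (\<lambda>k. egf (d k) t) s"
proof -
  define R where "R n = (\<Sum>l. \<bar>t\<bar> ^ l / fact l) - (\<Sum>l<n. \<bar>t\<bar> ^ l / fact l)" for n
  have sE: "summable (\<lambda>l. \<bar>t\<bar> ^ l / fact l)"
    using summable_exp[of "\<bar>t\<bar>"] by (simp add: divide_inverse mult.commute)
  have sE': "summable (\<lambda>l. \<bar>s\<bar> ^ l / fact l)"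
    using summable_exp[of "\<bar>s\<bar>"] by (simp add: divide_inverse mult.commute)
  have R0: "R \<longlonglongrightarrow> 0"
    unfolding R_def using tendsto_diff[OF tendsto_const summable_LIMSEQ[OF sE],
       of "(\<Sum>l. \<bar>t\<bar> ^ l / fact l)"] by simp
  have C0: "C \<ge> 0" using assms[of 0 0] by linarith
  have tail: "\<bar>egf (d k) t - (\<Sum>l<n. d k l * t ^ l / fact l)\<bar> \<le> C * R n" for k n
  proof -
    have s1: "summable (\<lambda>l. d k l * t ^ l / fact l)" using summable_egf[OF assms] .
    have "egf (d k) t - (\<Sum>l<n. d k l * t ^ l / fact l)
          = (\<Sum>l. d k (l + n) * t ^ (l + n) / fact (l + n))"
      unfolding egf_def using suminf_minus_initial_segment[OF s1, of n] by simp
    also have "\<bar>\<dots>\<bar> \<le> (\<Sum>l. C * (\<bar>t\<bar> ^ (l + n) / fact (l + n)))"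
    proof -
      have sC: "summable (\<lambda>l. C * (\<bar>t\<bar> ^ (l + n) / fact (l + n)))"
        by (intro summable_mult summable_ignore_initial_segment sE)
      have le: "norm (d k (l + n) * t ^ (l + n) / fact (l + n))
            \<le> C * (\<bar>t\<bar> ^ (l + n) / fact (l + n))" for l
        using mult_right_mono[OF assms[of k "l+n"], of "\<bar>t\<bar> ^ (l + n) / fact (l + n)"]
        by (simp add: abs_mult power_abs)
      show ?thesis using norm_suminf_le[OF le sC] by simp
    qed
    also have "\<dots> = C * R n"
      unfolding R_def using suminf_mult[OF summable_ignore_initial_segment[OF sE, of n], of C]
        suminf_minus_initial_segment[OF sE, of n] by simp
    finally show ?thesis .
  qed
  have bdk: "\<bar>egf (d k) t\<bar> \<le> C * R 0" for k using tail[of k 0] by simp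
  have lim1: "(\<lambda>n. \<Sum>k<n. egf (d k) t * s ^ k / fact k) \<longlonglongrightarrow> egf (\<lambda>k. egf (d k) t) s"
    using egf_sums[of "\<lambda>k. egf (d k) t", OF bdk] by (simp add: sums_def)
  have lim2: "(\<lambda>n. (\<Sum>k<n. egf (d k) t * s ^ k / fact k)
      - (\<Sum>k<n. \<Sum>l<n. d k l * t ^ l / fact l * s ^ k / fact k)) \<longlonglongrightarrow> 0"
  proof (rule Lim_null_comparison)
    show "(\<lambda>n. C * R n * (\<Sum>k. \<bar>s\<bar> ^ k / fact k)) \<longlonglongrightarrow> 0"
      using tendsto_mult[OF tendsto_mult[OF tendsto_const R0] tendsto_const,
          of C "(\<Sum>k. \<bar>s\<bar> ^ k / fact k)"] by simp
    show "\<forall>\<^sub>F n in sequentially. norm ((\<Sum>k<n. egf (d k) t * s ^ k / fact k)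
      - (\<Sum>k<n. \<Sum>l<n. d k l * t ^ l / fact l * s ^ k / fact k)) \<le> C * R n * (\<Sum>k. \<bar>s\<bar> ^ k / fact k)"
    proof (intro always_eventually allI)
      fix n
      have R0': "C * R n \<ge> 0" using tail[of 0 n] by linarith
      have "(\<Sum>k<n. egf (d k) t * s ^ k / fact k)
          - (\<Sum>k<n. \<Sum>l<n. d k l * t ^ l / fact l * s ^ k / fact k)
         = (\<Sum>k<n. (egf (d k) t - (\<Sum>l<n. d k l * t ^ l / fact l)) * (s ^ k / fact k))"
        by (simp add: sum_subtractf left_diff_distrib sum_distrib_right diff_divide_distrib
            sum_divide_distrib mult.assoc)
      also have "\<bar>\<dots>\<bar> \<le> (\<Sum>k<n. C * R n * (\<bar>s\<bar> ^ k / fact k))"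
      proof (intro order_trans[OF sum_abs] sum_mono)
        fix k
        show "\<bar>(egf (d k) t - (\<Sum>l<n. d k l * t ^ l / fact l)) * (s ^ k / fact k)\<bar>
              \<le> C * R n * (\<bar>s\<bar> ^ k / fact k)"
          using mult_right_mono[OF tail[of k n], of "\<bar>s\<bar> ^ k / fact k"]
          by (simp add: abs_mult power_abs)
      qed
      also have "\<dots> = C * R n * (\<Sum>k<n. \<bar>s\<bar> ^ k / fact k)" by (simp add: sum_distrib_left)
      also have "\<dots> \<le> C * R n * (\<Sum>k. \<bar>s\<bar> ^ k / fact k)"
        by (intro mult_left_mono sum_le_suminf sE' R0') auto
      finally show "norm ((\<Sum>k<n. egf (d k) t * s ^ k / fact k)
          - (\<Sum>k<n. \<Sum>l<n. d k l * t ^ l / fact l * s ^ k / fact k))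
          \<le> C * R n * (\<Sum>k. \<bar>s\<bar> ^ k / fact k)" by simp
    qed
  qed
  from tendsto_diff[OF lim1 lim2] show ?thesis by simp
qed

section \<open>Averaging operator and heat semigroup\<close>

locale lf_graph =
  fixes E :: "'a \<Rightarrow> 'a \<Rightarrow> bool"
  assumes E_sym: "E x y \<Longrightarrow> E y x"
    and E_irrefl: "\<not> E x x"
    and finite_nbrs: "finite {y. E x y}"
begin

definition deg :: "'a \<Rightarrow> real" where "deg x = real (card {y. E x y})"

text \<open>Division by 0 makes \<open>Q f\<close> vanish at an isolated vertex, and in the
  application every word outside \<open>G\<close> is isolated. So \<open>Q\<close> is sub-Markovian,
  which is why upper bounds such as \<open>Q_le\<close> ask for \<open>C \<ge> 0\<close>, while the
  product form \<open>deg_Q\<close> is valid everywhere.\<close>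

definition Q :: "('a \<Rightarrow> real) \<Rightarrow> 'a \<Rightarrow> real" where
  "Q f x = (\<Sum>y | E x y. f y) / deg x"

text \<open>This is exp(t (Q - I)) as a Poisson mixture of powers of \<open>Q\<close>: from a
  non-isolated vertex, the mean of \<open>f\<close> at time \<open>t\<close> for the walk with
  mean-one exponential holding times. Boundedness of \<open>f\<close> is what makes the series
  converge.\<close>

definition S :: "real \<Rightarrow> ('a \<Rightarrow> real) \<Rightarrow> 'a \<Rightarrow> real" where
  "S t f x = exp (- t) * egf (\<lambda>k. (Q ^^ k) f x) t"

lemma deg_nonneg [simp]: "deg x \<ge> 0" by (simp add: deg_def)

lemma deg_pos: "E x y \<Longrightarrow> deg x > 0"
  unfolding deg_def using finite_nbrs[of x] by (auto simp: card_gt_0_iff)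

lemma deg_Q: "deg x * Q f x = (\<Sum>y | E x y. f y)"
proof (cases "deg x = 0")
  case True
  then have "{y. E x y} = {}" using finite_nbrs[of x] by (simp add: deg_def)
  with True show ?thesis by simp
qed (simp add: Q_def)

lemma Q_le:
  assumes "\<And>y. E x y \<Longrightarrow> f y \<le> C" "C \<ge> 0"
  shows "Q f x \<le> C"
proof -
  have "(\<Sum>y | E x y. f y) \<le> C * deg x"
    using sum_bounded_above[of "{y. E x y}" f C] assms by (simp add: deg_def mult.commute)
  then show ?thesis unfolding Q_def using assms(2) deg_nonneg[of x]
    by (cases "deg x = 0") (auto simp: pos_divide_le_eq less_le)
qed

lemma Q_mono: "(\<And>y. E x y \<Longrightarrow> f y \<le> g y) \<Longrightarrow> Q f x \<le> Q g x"
  unfolding Q_def by (intro divide_right_mono sum_mono) auto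

lemma Q_nonneg: "(\<And>y. E x y \<Longrightarrow> f y \<ge> 0) \<Longrightarrow> Q f x \<ge> 0"
  unfolding Q_def by (intro divide_nonneg_nonneg sum_nonneg) auto

lemma Q_add: "Q (\<lambda>w. f w + g w) x = Q f x + Q g x"
  by (simp add: Q_def sum.distrib add_divide_distrib)

lemma Q_diff: "Q (\<lambda>w. f w - g w) x = Q f x - Q g x"
  by (simp add: Q_def sum_subtractf diff_divide_distrib)

lemma Q_cmult: "Q (\<lambda>w. a * f w) x = a * Q f x"
  by (simp add: Q_def sum_distrib_left)

lemma Q_sum: "Q (\<lambda>w. \<Sum>i\<in>I. f i w) x = (\<Sum>i\<in>I. Q (f i) x)"
  by (simp add: Q_def sum.swap[of _ I] sum_divide_distrib)

lemma Qk_add: "(Q ^^ k) (\<lambda>w. f w + g w) = (\<lambda>w. (Q ^^ k) f w + (Q ^^ k) g w)"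
  by (induction k) (simp_all add: Q_add)

lemma Qk_cmult: "(Q ^^ k) (\<lambda>w. a * f w) = (\<lambda>w. a * (Q ^^ k) f w)"
  by (induction k) (simp_all add: Q_cmult)

lemma Qk_sum: "(Q ^^ k) (\<lambda>w. \<Sum>i\<in>I. f i w) = (\<lambda>w. \<Sum>i\<in>I. (Q ^^ k) (f i) w)"
  by (induction k) (simp_all add: Q_sum)

lemma Qk_mono:
  assumes "\<And>y. f y \<le> g y" shows "(Q ^^ k) f x \<le> (Q ^^ k) g x"
  using assms by (induction k arbitrary: x) (auto intro!: Q_mono)

lemma Qk_le:
  assumes "\<And>y. f y \<le> C" "C \<ge> 0" shows "(Q ^^ k) f x \<le> C"
  using assms by (induction k arbitrary: x) (auto intro!: Q_le)

lemma Qk_nonneg: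
  assumes "\<And>y. f y \<ge> 0" shows "(Q ^^ k) f x \<ge> 0"
  using assms by (induction k arbitrary: x) (auto intro!: Q_nonneg)

lemma Qk_abs_le:
  assumes "\<And>y. \<bar>f y\<bar> \<le> C" shows "\<bar>(Q ^^ k) f x\<bar> \<le> C"
proof -
  have C0: "C \<ge> 0" using assms[of x] by linarith
  have "(Q ^^ k) f x \<le> C" using assms C0 by (intro Qk_le) (auto simp: abs_le_iff)
  moreover have "(Q ^^ k) (\<lambda>w. (-1) * f w) x \<le> C"
    using assms C0 by (intro Qk_le) (auto simp: abs_le_iff)
  ultimately show ?thesis unfolding Qk_cmult by (simp add: abs_le_iff)
qed

lemma Qk_Q: "(Q ^^ k) (Q f) = Q ((Q ^^ k) f)"
  by (simp add: funpow_swap1)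

lemma S_zero [simp]: "S 0 f x = f x"
  by (simp add: S_def egf_zero)

lemma S_abs_le:
  assumes "\<And>y. \<bar>f y\<bar> \<le> C" "t \<ge> 0" shows "\<bar>S t f x\<bar> \<le> C"
proof -
  note b = Qk_abs_le[of f C, OF assms(1)]
  have "egf (\<lambda>k. (Q ^^ k) f x) t \<le> egf (\<lambda>k. C) t"
    using b assms by (intro egf_mono[of _ C _ "\<bar>C\<bar>"]) (auto simp: abs_le_iff)
  moreover have "egf (\<lambda>k. - C) t \<le> egf (\<lambda>k. (Q ^^ k) f x) t"
    using b assms by (intro egf_mono[of _ "\<bar>C\<bar>" _ C]) (auto simp: abs_le_iff intro: minus_le_iff[THEN iffD1])
  ultimately have "\<bar>egf (\<lambda>k. (Q ^^ k) f x) t\<bar> \<le> C * exp t"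
    by (simp add: egf_const abs_le_iff)
  then show ?thesis unfolding S_def by (simp add: abs_mult exp_minus field_simps)
qed

lemma S_mono:
  assumes "\<And>y. \<bar>f y\<bar> \<le> C" "\<And>y. \<bar>g y\<bar> \<le> C'" "\<And>y. f y \<le> g y" "t \<ge> 0"
  shows "S t f x \<le> S t g x"
  unfolding S_def
  using egf_mono[of "\<lambda>k. (Q ^^ k) f x" C "\<lambda>k. (Q ^^ k) g x" C' t] Qk_abs_le[of f C] Qk_abs_le[of g C']
    Qk_mono[of f g] assms by simp

lemma S_nonneg:
  assumes "\<And>y. \<bar>f y\<bar> \<le> C" "\<And>y. f y \<ge> 0" "t \<ge> 0" shows "S t f x \<ge> 0"
proof -
  have "egf (\<lambda>k. 0) t \<le> egf (\<lambda>k. (Q ^^ k) f x) t"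
    using Qk_abs_le[of f C] Qk_nonneg[of f] assms by (intro egf_mono[of _ 0 _ C]) auto
  then show ?thesis by (simp add: S_def egf_const)
qed

lemma S_add:
  assumes "\<And>y. \<bar>f y\<bar> \<le> C" "\<And>y. \<bar>g y\<bar> \<le> C'"
  shows "S t (\<lambda>w. f w + g w) x = S t f x + S t g x"
  unfolding S_def Qk_add using egf_add[of "\<lambda>k. (Q ^^ k) f x" C "\<lambda>k. (Q ^^ k) g x" C' t]
    Qk_abs_le[of f C] Qk_abs_le[of g C'] assms by (simp add: algebra_simps)

lemma Q_S:
  assumes "\<And>y. \<bar>f y\<bar> \<le> C"
  shows "Q (S t f) x = S t (Q f) x"
proof -
  have "egf (\<lambda>k. (Q ^^ k) (Q f) x) t = egf (\<lambda>k. \<Sum>y | E x y. (1 / deg x) * (Q ^^ k) f y) t"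
    unfolding Qk_Q by (simp add: Q_def sum_divide_distrib)
  also have "\<dots> = (\<Sum>y | E x y. egf (\<lambda>k. (1 / deg x) * (Q ^^ k) f y) t)"
    using Qk_abs_le[of f C] assms
    by (intro egf_sum[where C = "(1 / deg x) * C"] finite_nbrs)
      (auto simp: abs_mult intro!: divide_right_mono)
  also have "\<dots> = (\<Sum>y | E x y. (1 / deg x) * egf (\<lambda>k. (Q ^^ k) f y) t)"
    using Qk_abs_le[of f C] assms by (intro sum.cong refl egf_cmult[where C = C]) auto
  finally show ?thesis unfolding S_def
    by (simp add: Q_def sum_divide_distrib sum_distrib_left)
qed

lemma Q_bounded:
  assumes "\<And>y. \<bar>f y\<bar> \<le> C" shows "\<bar>Q f x\<bar> \<le> C"
  using Qk_abs_le[of f C 1 x] assms by simp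

lemma Qk_S:
  assumes "\<And>y. \<bar>f y\<bar> \<le> C"
  shows "(Q ^^ k) (S t f) x = S t ((Q ^^ k) f) x"
proof (induction k arbitrary: x)
  case (Suc k)
  have "(Q ^^ k) (S t f) = S t ((Q ^^ k) f)" using Suc by (rule ext)
  then have "(Q ^^ Suc k) (S t f) x = Q (S t ((Q ^^ k) f)) x" by simp
  also have "\<dots> = S t (Q ((Q ^^ k) f)) x"
    using Qk_abs_le[of f C] assms by (intro Q_S[where C = C]) auto
  finally show ?case by simp
qed simp

section \<open>Heat equation and parabolic maximum principle\<close>

lemma S_has_derivative:
  assumes "\<And>y. \<bar>f y\<bar> \<le> C"
  shows "((\<lambda>t. S t f x) has_real_derivative Q (S t f) x - S t f x) (at t)"
proof -
  have b: "\<And>k. \<bar>(Q ^^ k) f x\<bar> \<le> C" using Qk_abs_le[of f C] assms by auto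
  have "((\<lambda>t. exp (- t) * egf (\<lambda>k. (Q ^^ k) f x) t) has_real_derivative
     exp (- t) * egf (\<lambda>k. (Q ^^ Suc k) f x) t - exp (- t) * egf (\<lambda>k. (Q ^^ k) f x) t) (at t)"
    by (rule derivative_eq_intros has_derivative_egf[of _ C] b refl | simp add: algebra_simps)+
  moreover have "Q (S t f) x = exp (- t) * egf (\<lambda>k. (Q ^^ Suc k) f x) t"
    using Q_S[of f C t x, OF assms] by (simp add: S_def Qk_Q)
  ultimately show ?thesis by (simp add: S_def)
qed

text \<open>Iterating the differential inequality for exp s * g s improves the a priori bound
  C to C * s^k / k! for every k.\<close>
lemma parabolic_max_principle:
  assumes der: "\<And>s w. w \<in> D \<Longrightarrow> 0 \<le> s \<Longrightarrow> s \<le> T \<Longrightarrow>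
      \<exists>g'. ((\<lambda>s. g s w) has_real_derivative g') (at s) \<and> g' \<le> Q (g s) w - g s w"
    and init: "\<And>w. w \<in> D \<Longrightarrow> g 0 w \<le> 0"
    and bdry: "\<And>s w y. w \<in> D \<Longrightarrow> E w y \<Longrightarrow> y \<notin> D \<Longrightarrow> 0 \<le> s \<Longrightarrow> s \<le> T \<Longrightarrow> g s y \<le> 0"
    and bnd: "\<And>s w. w \<in> D \<Longrightarrow> 0 \<le> s \<Longrightarrow> s \<le> T \<Longrightarrow> g s w \<le> C"
    and w: "w \<in> D" and s: "0 \<le> s" "s \<le> T"
  shows "g s w \<le> 0"
proof -
  \<comment> \<open>\<open>D\<close> may be infinite, so a maximum need not be attained. The factor
    exp s absorbs the term \<open>- g s w\<close>, leaving (exp s * g)' \<le> Q (exp s * g), and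
    \<open>C'\<close> bounds exp s * g on [0, T].\<close>
  define C' where "C' = \<bar>C\<bar> * exp T"
  have C'0: "C' \<ge> 0" by (simp add: C'_def)
  have main: "\<forall>w s. w \<in> D \<longrightarrow> 0 \<le> s \<longrightarrow> s \<le> T \<longrightarrow> exp s * g s w \<le> C' * s ^ k / fact k" for k
  proof (induction k)
    case 0
    show ?case
    proof (intro allI impI)
      fix w s assume a: "w \<in> D" "0 \<le> s" "s \<le> T"
      have "exp s * g s w \<le> exp s * \<bar>C\<bar>" using bnd[OF a] by (intro mult_left_mono) auto
      also have "\<dots> \<le> exp T * \<bar>C\<bar>" using a by (intro mult_right_mono) auto
      finally show "exp s * g s w \<le> C' * s ^ 0 / fact 0" by (simp add: C'_def mult.commute)
    qed
  next
    case (Suc k)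
    show ?case
    proof (intro allI impI)
      fix w s assume a: "w \<in> D" "0 \<le> s" "s \<le> T"
      define h where "h r = exp r * g r w - C' * r ^ Suc k / fact (Suc k)" for r
      have "h s \<le> h 0"
      proof (rule DERIV_nonpos_imp_nonincreasing[OF a(2)])
        fix r assume r: "0 \<le> r" "r \<le> s"
        then have r': "r \<le> T" using a by simp
        from der[OF a(1) r(1) r'] obtain g' where
          g': "((\<lambda>s. g s w) has_real_derivative g') (at r)" "g' \<le> Q (g r) w - g r w" by auto
        have pd: "((\<lambda>r. C' * r ^ Suc k / fact (Suc k)) has_real_derivative C' * r ^ k / fact k) (at r)"
          using DERIV_cmult[OF DERIV_pow[of "Suc k" r], of "C' / fact (Suc k)"]
          by (simp add: field_simps del: of_nat_Suc power_Suc)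
        have dh: "(h has_real_derivative
            exp r * g' + exp r * g r w - C' * r ^ k / fact k) (at r)"
          unfolding h_def
          by (rule derivative_eq_intros g'(1) pd refl | simp add: algebra_simps)+
        have "exp r * Q (g r) w = Q (\<lambda>y. exp r * g r y) w" by (simp add: Q_cmult)
        also have "\<dots> \<le> C' * r ^ k / fact k"
        proof (rule Q_le)
          fix y assume y: "E w y"
          show "exp r * g r y \<le> C' * r ^ k / fact k"
          proof (cases "y \<in> D")
            case True
            then show ?thesis using Suc r r' by blast
          next
            case False
            then have "exp r * g r y \<le> 0"
              using bdry[OF a(1) y False r(1) r'] by (simp add: mult_le_0_iff)
            also have "0 \<le> C' * r ^ k / fact k" using C'0 r by simp
            finally show ?thesis .
          qed
        qed (use C'0 r in simp)
        finally have "exp r * Q (g r) w \<le> C' * r ^ k / fact k" .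
        moreover have "exp r * (g' + g r w) \<le> exp r * Q (g r) w"
          using g'(2) by (intro mult_left_mono) auto
        ultimately show "\<exists>y. (h has_real_derivative y) (at r) \<and> y \<le> 0"
          using dh by (intro exI conjI) (auto simp: algebra_simps)
      qed
      also have "h 0 \<le> 0" using init[OF a(1)] by (simp add: h_def)
      finally show "exp s * g s w \<le> C' * s ^ Suc k / fact (Suc k)" by (simp add: h_def)
    qed
  qed
  have "(\<lambda>k. C' * (s ^ k / fact k)) \<longlonglongrightarrow> C' * 0"
    using summable_exp[of s] by (intro tendsto_mult tendsto_const summable_LIMSEQ_zero)
      (simp add: divide_inverse mult.commute)
  then have "exp s * g s w \<le> C' * 0"
    by (rule LIMSEQ_le_const) (use main w s in auto)
  then show ?thesis by (simp add: mult_le_0_iff)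
qed

text \<open>In the variable \<open>s\<close> both sides are bounded solutions of the heat equation
  with initial value \<open>S t f\<close>. The maximum principle on the whole space, applied to the
  difference and to its negative, gives uniqueness.\<close>

lemma S_semigroup:
  assumes f: "\<And>y. \<bar>f y\<bar> \<le> C" and s: "s \<ge> 0" and t: "t \<ge> 0"
  shows "S s (S t f) x = S (s + t) f x"
proof -
  have St: "\<And>y. \<bar>S t f y\<bar> \<le> C" using S_abs_le[OF f t] .
  have d: "((\<lambda>r. S r (S t f) w - S (r + t) f w) has_real_derivative
      Q (\<lambda>w. S r (S t f) w - S (r + t) f w) w - (S r (S t f) w - S (r + t) f w)) (at r)" for r w
    unfolding Q_diff
    by (rule derivative_eq_intros S_has_derivative[of _ C] St refl
        DERIV_chain2[where f = "\<lambda>t. S t f w", OF S_has_derivative[of f C, OF f]] | simp add: algebra_simps)+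
  have d': "((\<lambda>r. S (r + t) f w - S r (S t f) w) has_real_derivative
      Q (\<lambda>w. S (r + t) f w - S r (S t f) w) w - (S (r + t) f w - S r (S t f) w)) (at r)" for r w
    using DERIV_minus[OF d[of w r]] by (simp add: Q_diff algebra_simps)
  have b: "\<bar>S r (S t f) w - S (r + t) f w\<bar> \<le> 2 * C" if "r \<ge> 0" for r w
  proof -
    have "\<bar>S r (S t f) w\<bar> \<le> C" using S_abs_le[OF St that] .
    moreover have "\<bar>S (r + t) f w\<bar> \<le> C" using S_abs_le[OF f, of "r + t"] that t by simp
    ultimately show ?thesis by linarith
  qed
  have "S s (S t f) x - S (s + t) f x \<le> 0"
    by (rule parabolic_max_principle[where D = UNIV and T = s and C = "2 * C"
          and g = "\<lambda>r w. S r (S t f) w - S (r + t) f w"])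
      (use d b s in \<open>auto simp: abs_le_iff\<close>)
  moreover have "S (s + t) f x - S s (S t f) x \<le> 0"
    by (rule parabolic_max_principle[where D = UNIV and T = s and C = "2 * C"
          and g = "\<lambda>r w. S (r + t) f w - S r (S t f) w"])
      (use d' b s in \<open>auto simp: abs_le_iff\<close>)
  ultimately show ?thesis by simp
qed

section \<open>Weighted inner product, reversibility and Dirichlet energy\<close>

definition delta :: "'a \<Rightarrow> 'a \<Rightarrow> real" where "delta x w = (if w = x then 1 else 0)"

text \<open>Summing over the support of the first argument leaves \<open>g\<close> arbitrary. The
  value is meaningful for finitely supported \<open>f\<close> only; otherwise the sum defaults to
  0.\<close>

definition ip :: "('a \<Rightarrow> real) \<Rightarrow> ('a \<Rightarrow> real) \<Rightarrow> real" where
  "ip f g = (\<Sum>w | f w \<noteq> 0. f w * g w * deg w)"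

abbreviation finsupp :: "('a \<Rightarrow> real) \<Rightarrow> bool" where "finsupp f \<equiv> finite {w. f w \<noteq> 0}"

lemma delta_bounded: "\<bar>delta x w\<bar> \<le> 1" by (simp add: delta_def)

lemma finsupp_delta: "finsupp (delta x)"
  by (rule finite_subset[of _ "{x}"]) (auto simp: delta_def)

lemma ip_eq:
  assumes "finite W" "{w. f w \<noteq> 0} \<subseteq> W"
  shows "ip f g = (\<Sum>w\<in>W. f w * g w * deg w)"
  unfolding ip_def using assms by (intro sum.mono_neutral_left) auto

lemma ip_delta: "ip (delta x) g = deg x * g x"
  by (subst ip_eq[of "{x}"]) (auto simp: delta_def)

lemma ip_comm: "finsupp f \<Longrightarrow> finsupp g \<Longrightarrow> ip f g = ip g f"
  by (simp add: ip_eq[of "{w. f w \<noteq> 0} \<union> {w. g w \<noteq> 0}"] mult_ac)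

lemma Q_support: "{w. Q f w \<noteq> 0} \<subseteq> (\<Union>y\<in>{y. f y \<noteq> 0}. {w. E y w})"
proof
  fix w assume "w \<in> {w. Q f w \<noteq> 0}"
  then have "(\<Sum>y | E w y. f y) \<noteq> 0" by (auto simp: Q_def)
  then obtain y where "E w y" "f y \<noteq> 0" by (metis (mono_tags, lifting) mem_Collect_eq sum.neutral)
  then show "w \<in> (\<Union>y\<in>{y. f y \<noteq> 0}. {w. E y w})" using E_sym by auto
qed

lemma finsupp_Q: "finsupp f \<Longrightarrow> finsupp (Q f)"
  by (rule finite_subset[OF Q_support]) (auto simp: finite_nbrs)

lemma finsupp_Qk: "finsupp f \<Longrightarrow> finsupp ((Q ^^ k) f)"
  by (induction k) (auto intro: finsupp_Q)

text \<open>Reversibility: both sides are the sum of \<open>f y * g w\<close> over the ordered edges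
  with \<open>y\<close> in the support of \<open>f\<close>.\<close>

lemma ip_Q:
  assumes "finsupp f"
  shows "ip (Q f) g = ip f (Q g)"
proof -
  define A where "A = {y. f y \<noteq> 0}"
  define W where "W = (\<Union>y\<in>A. {w. E y w})"
  have fA: "finite A" using assms by (simp add: A_def)
  have fW: "finite W" unfolding W_def using fA finite_nbrs by auto
  have "ip (Q f) g = (\<Sum>w\<in>W. Q f w * g w * deg w)"
    using fW Q_support[of f] by (intro ip_eq) (auto simp: W_def A_def)
  also have "\<dots> = (\<Sum>w\<in>W. \<Sum>y\<in>A. if E w y then f y * g w else 0)"
  proof (intro sum.cong refl)
    fix w
    have "Q f w * g w * deg w = (\<Sum>y | E w y. f y) * g w"
      using deg_Q[of w f] by (simp add: mult_ac)
    also have "(\<Sum>y | E w y. f y) = (\<Sum>y\<in>{y\<in>A. E w y}. f y)"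
      by (intro sum.mono_neutral_right) (auto simp: A_def finite_nbrs)
    also have "\<dots> * g w = (\<Sum>y\<in>A. if E w y then f y * g w else 0)"
      using fA by (simp add: sum.inter_filter sum_distrib_right if_distrib[of "\<lambda>a. a * g w"] cong: if_cong)
    finally show "Q f w * g w * deg w = (\<Sum>y\<in>A. if E w y then f y * g w else 0)" .
  qed
  also have "\<dots> = (\<Sum>y\<in>A. \<Sum>w\<in>W. if E w y then f y * g w else 0)" by (rule sum.swap)
  also have "\<dots> = (\<Sum>y\<in>A. f y * Q g y * deg y)"
  proof (intro sum.cong refl)
    fix y assume y: "y \<in> A"
    have "(\<Sum>w\<in>W. if E w y then f y * g w else 0) = (\<Sum>w\<in>{w\<in>W. E w y}. f y * g w)"
      using fW by (simp add: sum.inter_filter)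
    also have "{w\<in>W. E w y} = {w. E y w}" using y E_sym by (auto simp: W_def)
    also have "(\<Sum>w | E y w. f y * g w) = f y * Q g y * deg y"
      using deg_Q[of y g] by (simp add: sum_distrib_left[symmetric] mult_ac)
    finally show "(\<Sum>w\<in>W. if E w y then f y * g w else 0) = f y * Q g y * deg y" .
  qed
  also have "\<dots> = ip f (Q g)" by (simp add: ip_def A_def)
  finally show ?thesis .
qed

lemma ip_Qk: "finsupp f \<Longrightarrow> ip ((Q ^^ k) f) g = ip f ((Q ^^ k) g)"
proof (induction k arbitrary: g)
  case (Suc k)
  have "ip ((Q ^^ Suc k) f) g = ip ((Q ^^ k) f) (Q g)"
    using ip_Q[OF finsupp_Qk[OF Suc.prems]] by simp
  also have "\<dots> = ip f ((Q ^^ k) (Q g))" using Suc by simp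
  finally show ?case by (simp add: Qk_Q)
qed simp

lemma ip_sum_right: "ip f (\<lambda>w. \<Sum>i\<in>I. a i * g i w) = (\<Sum>i\<in>I. a i * ip f (g i))"
  unfolding ip_def sum_distrib_left sum_distrib_right
  by (subst sum.swap) (simp add: mult_ac)

lemma ip_sum_left:
  assumes "finite I" "\<And>i. i \<in> I \<Longrightarrow> finsupp (f i)"
  shows "ip (\<lambda>w. \<Sum>i\<in>I. a i * f i w) g = (\<Sum>i\<in>I. a i * ip (f i) g)"
proof -
  define W where "W = (\<Union>i\<in>I. {w. f i w \<noteq> 0})"
  have fW: "finite W" using assms by (auto simp: W_def)
  have "ip (\<lambda>w. \<Sum>i\<in>I. a i * f i w) g = (\<Sum>w\<in>W. (\<Sum>i\<in>I. a i * f i w) * g w * deg w)"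
  proof (rule ip_eq[OF fW], rule subsetI, rule ccontr)
    fix w assume w: "w \<in> {w. (\<Sum>i\<in>I. a i * f i w) \<noteq> 0}" "w \<notin> W"
    then have "(\<Sum>i\<in>I. a i * f i w) = 0" by (intro sum.neutral) (auto simp: W_def)
    with w show False by simp
  qed
  also have "\<dots> = (\<Sum>i\<in>I. a i * (\<Sum>w\<in>W. f i w * g w * deg w))"
    unfolding sum_distrib_left sum_distrib_right by (subst sum.swap) (simp add: mult_ac)
  also have "\<dots> = (\<Sum>i\<in>I. a i * ip (f i) g)"
    using fW by (intro sum.cong refl arg_cong2[where f = "(*)"] ip_eq[symmetric]) (auto simp: W_def)
  finally show ?thesis .
qed

lemma ip_Cauchy_Schwarz:
  assumes "finsupp f" "finsupp g"
  shows "(ip f g)\<^sup>2 \<le> ip f f * ip g g"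
proof -
  define W where "W = {w. f w \<noteq> 0} \<union> {w. g w \<noteq> 0}"
  have fW: "finite W" using assms by (simp add: W_def)
  have e: "ip h k = (\<Sum>w\<in>W. (h w * sqrt (deg w)) * (k w * sqrt (deg w)))"
    if "h = f \<or> h = g" for h k
    using that by (subst ip_eq[OF fW]) (auto simp: W_def mult_ac)
  show ?thesis
    using Cauchy_Schwarz_ineq_sum[of "\<lambda>w. f w * sqrt (deg w)" "\<lambda>w. g w * sqrt (deg w)" W]
    by (simp add: e power2_eq_square)
qed

lemma Q_one: "f w * Q (\<lambda>_. 1) w * deg w = f w * deg w"
  using deg_Q[of w "\<lambda>_. 1"] by (simp add: deg_def mult_ac)

text \<open>\<open>ip f f - ip f (Q f)\<close> is the Dirichlet energy, half the sum of
  \<open>(f w - f y)\<^sup>2\<close> over ordered edges. Injectivity makes the path edges distinct,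
  so together with their reversals they contribute twice the sum of squared increments;
  Cauchy-Schwarz along the path supplies the factor \<open>d\<close>.\<close>

lemma energy_path:
  assumes f: "finsupp f" and inj: "inj_on p {..d}"
    and path: "\<And>i. i < d \<Longrightarrow> E (p i) (p (Suc i))"
  shows "(f (p 0) - f (p d))\<^sup>2 \<le> real d * (ip f f - ip f (Q f))"
proof -
  define A where "A = {w. f w \<noteq> 0}"
  \<comment> \<open>The neighbours of the support are included so that edges leaving it are counted
    from both ends, the path vertices so that the path edges can be picked out of the sum over
    \<open>W\<close>.\<close>
  define W where "W = A \<union> (\<Union>y\<in>A. {w. E y w}) \<union> p ` {..d}"
  have fA: "finite A" using f by (simp add: A_def)
  have fW: "finite W" unfolding W_def using fA finite_nbrs by auto
  have sq: "{w. (f w)\<^sup>2 \<noteq> 0} = A" by (auto simp: A_def)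
  have e1: "(\<Sum>w\<in>W. \<Sum>y | E w y. (f w)\<^sup>2) = ip f f"
    using fW by (subst ip_eq[of W]) (auto simp: W_def A_def deg_def power2_eq_square mult_ac)
  have e2: "(\<Sum>w\<in>W. \<Sum>y | E w y. (f y)\<^sup>2) = ip f f"
  proof -
    have "(\<Sum>w\<in>W. \<Sum>y | E w y. (f y)\<^sup>2) = (\<Sum>w\<in>W. Q (\<lambda>y. (f y)\<^sup>2) w * 1 * deg w)"
      using deg_Q by (simp add: mult.commute)
    also have "\<dots> = ip (Q (\<lambda>y. (f y)\<^sup>2)) (\<lambda>_. 1)"
      using fW Q_support[of "\<lambda>y. (f y)\<^sup>2"] by (intro ip_eq[symmetric]) (auto simp: W_def A_def)
    also have "\<dots> = ip (\<lambda>y. (f y)\<^sup>2) (Q (\<lambda>_. 1))" using fA sq by (intro ip_Q) simp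
    also have "\<dots> = ip f f" unfolding ip_def sq
      by (intro sum.cong) (use Q_one[of "\<lambda>y. (f y)\<^sup>2"] in \<open>auto simp: A_def power2_eq_square\<close>)
    finally show ?thesis .
  qed
  have e3: "(\<Sum>w\<in>W. \<Sum>y | E w y. f w * f y) = ip f (Q f)"
  proof -
    have "(\<Sum>w\<in>W. \<Sum>y | E w y. f w * f y) = (\<Sum>w\<in>W. f w * Q f w * deg w)"
      using deg_Q[of _ f] by (simp add: sum_distrib_left[symmetric] mult_ac)
    also have "\<dots> = ip f (Q f)" using fW by (intro ip_eq[symmetric]) (auto simp: W_def A_def)
    finally show ?thesis .
  qed
  have "2 * (ip f f - ip f (Q f)) = (\<Sum>w\<in>W. \<Sum>y | E w y. (f w - f y)\<^sup>2)"
    using e1 e2 e3 by (simp add: power2_diff sum.distrib sum_subtractf sum_distrib_left[symmetric] mult.assoc)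
  also have "\<dots> = (\<Sum>(w,y)\<in>Sigma W (\<lambda>w. {y. E w y}). (f w - f y)\<^sup>2)"
    using fW finite_nbrs by (intro sum.Sigma) auto
  also have "\<dots> \<ge> (\<Sum>(w,y)\<in>(\<lambda>i. (p i, p (Suc i))) ` {..<d} \<union> (\<lambda>i. (p (Suc i), p i)) ` {..<d}. (f w - f y)\<^sup>2)"
  proof (intro sum_mono2)
    show "finite (Sigma W (\<lambda>w. {y. E w y}))" using fW finite_nbrs by auto
    show "(\<lambda>i. (p i, p (Suc i))) ` {..<d} \<union> (\<lambda>i. (p (Suc i), p i)) ` {..<d} \<subseteq> Sigma W (\<lambda>w. {y. E w y})"
      using path E_sym by (auto simp: W_def)
  qed auto
  also have "(\<Sum>(w,y)\<in>(\<lambda>i. (p i, p (Suc i))) ` {..<d} \<union> (\<lambda>i. (p (Suc i), p i)) ` {..<d}. (f w - f y)\<^sup>2)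
     = (\<Sum>(w,y)\<in>(\<lambda>i. (p i, p (Suc i))) ` {..<d}. (f w - f y)\<^sup>2)
      + (\<Sum>(w,y)\<in>(\<lambda>i. (p (Suc i), p i)) ` {..<d}. (f w - f y)\<^sup>2)"
  proof (intro sum.union_disjoint)
    show "(\<lambda>i. (p i, p (Suc i))) ` {..<d} \<inter> (\<lambda>i. (p (Suc i), p i)) ` {..<d} = {}"
    proof (rule ccontr)
      assume "\<not> ?thesis"
      then obtain i j where ij: "i < d" "j < d" "p i = p (Suc j)" "p (Suc i) = p j" by auto
      then have "i = Suc j" "Suc i = j" using inj_onD[OF inj, of i "Suc j"] inj_onD[OF inj, of "Suc i" j] by auto
      then show False by simp
    qed
  qed auto
  also have "(\<Sum>(w,y)\<in>(\<lambda>i. (p i, p (Suc i))) ` {..<d}. (f w - f y)\<^sup>2) = (\<Sum>i<d. (f (p i) - f (p (Suc i)))\<^sup>2)"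
    by (subst sum.reindex) (auto intro!: inj_onI dest: inj_onD[OF inj])
  also have "(\<Sum>(w,y)\<in>(\<lambda>i. (p (Suc i), p i)) ` {..<d}. (f w - f y)\<^sup>2) = (\<Sum>i<d. (f (p i) - f (p (Suc i)))\<^sup>2)"
    by (subst sum.reindex) (auto intro!: inj_onI dest: inj_onD[OF inj] simp: power2_commute)
  finally have en: "(\<Sum>i<d. (f (p i) - f (p (Suc i)))\<^sup>2) \<le> ip f f - ip f (Q f)" by simp
  have "f (p 0) - f (p d) = (\<Sum>i<d. 1 * (f (p i) - f (p (Suc i))))"
    using sum_lessThan_telescope'[of "\<lambda>i. f (p i)" d] by simp
  then have "(f (p 0) - f (p d))\<^sup>2 \<le> (\<Sum>i<d. 1\<^sup>2) * (\<Sum>i<d. (f (p i) - f (p (Suc i)))\<^sup>2)"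
    using Cauchy_Schwarz_ineq_sum[of "\<lambda>i. 1" "\<lambda>i. f (p i) - f (p (Suc i))" "{..<d}"] by simp
  also have "\<dots> \<le> real d * (ip f f - ip f (Q f))"
    using en by (simp add: mult_left_mono)
  finally show ?thesis .
qed

text \<open>The truncation of exp t * S t. It keeps finite support, so the energy estimates apply to
  it before the limit is taken.\<close>

definition expsum :: "real \<Rightarrow> nat \<Rightarrow> ('a \<Rightarrow> real) \<Rightarrow> 'a \<Rightarrow> real" where
  "expsum t n f w = (\<Sum>k<n. t ^ k / fact k * (Q ^^ k) f w)"

lemma finsupp_expsum:
  assumes "finsupp f" shows "finsupp (expsum t n f)"
proof (rule finite_subset)
  show "{w. expsum t n f w \<noteq> 0} \<subseteq> (\<Union>k<n. {w. (Q ^^ k) f w \<noteq> 0})"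
  proof (rule subsetI, rule ccontr)
    fix w assume "w \<in> {w. expsum t n f w \<noteq> 0}" "w \<notin> (\<Union>k<n. {w. (Q ^^ k) f w \<noteq> 0})"
    moreover from this(2) have "expsum t n f w = 0"
      unfolding expsum_def by (intro sum.neutral) auto
    ultimately show False by simp
  qed
  show "finite (\<Union>k<n. {w. (Q ^^ k) f w \<noteq> 0})" using finsupp_Qk[OF assms] by auto
qed

lemma expsum_tendsto:
  assumes "\<And>y. \<bar>f y\<bar> \<le> C"
  shows "(\<lambda>n. expsum t n f w) \<longlonglongrightarrow> exp t * S t f w"
proof -
  have "exp t * S t f w = egf (\<lambda>k. (Q ^^ k) f w) t"
    by (simp add: S_def mult.assoc[symmetric] mult_exp_exp)
  then show ?thesis
    using egf_sums[of "\<lambda>k. (Q ^^ k) f w" C t] Qk_abs_le[of f C] assms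
    by (simp add: sums_def expsum_def mult.commute)
qed

lemma Q_expsum: "Q (expsum t n f) = expsum t n (Q f)"
  by (rule ext) (simp only: expsum_def[abs_def] Q_sum Q_cmult Qk_Q)


text \<open>Moving all powers of \<open>Q\<close> onto \<open>f\<close> turns the inner product into
  the square truncation of a double exponential series at \<open>x\<close>, and the semigroup law
  merges its two factors into time \<open>2 * t\<close>. This gives a meaning to the inner product
  although \<open>S t f\<close> need not have finite support.\<close>

lemma ip_expsum_tendsto:
  assumes f: "\<And>y. \<bar>f y\<bar> \<le> C" and t: "t \<ge> 0"
  shows "(\<lambda>n. ip (expsum t n (delta x)) (expsum t n f)) \<longlonglongrightarrow> deg x * exp (2 * t) * S (2 * t) f x"
proof -
  have b: "\<bar>(Q ^^ k) f y\<bar> \<le> C" for k y using Qk_abs_le[of f C] f by auto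
  have e: "ip (expsum t n (delta x)) (expsum t n f) =
     (\<Sum>k<n. \<Sum>l<n. deg x * (Q ^^ l) ((Q ^^ k) f) x * t ^ l / fact l * t ^ k / fact k)" for n
  proof -
    have "ip (expsum t n (delta x)) (expsum t n f)
       = (\<Sum>k<n. t ^ k / fact k * (\<Sum>l<n. t ^ l / fact l * ip ((Q ^^ k) (delta x)) ((Q ^^ l) f)))"
      unfolding expsum_def[abs_def]
      by (subst ip_sum_left) (auto simp only: ip_sum_right finite_lessThan intro: finsupp_Qk finsupp_delta)
    also have "\<dots> = (\<Sum>k<n. t ^ k / fact k * (\<Sum>l<n. t ^ l / fact l * (deg x * (Q ^^ l) ((Q ^^ k) f) x)))"
      by (simp add: ip_Qk[OF finsupp_delta] ip_delta funpow_add[symmetric, THEN fun_cong, simplified comp_apply] add.commute)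
    finally show ?thesis by (simp add: sum_distrib_left mult_ac)
  qed
  have b': "\<bar>deg x * (Q ^^ l) ((Q ^^ k) f) x\<bar> \<le> deg x * C" for k l
    using Qk_abs_le[of "(Q ^^ k) f" C l x] b by (simp add: abs_mult mult_left_mono)
  have "(\<lambda>n. ip (expsum t n (delta x)) (expsum t n f)) \<longlonglongrightarrow>
     egf (\<lambda>k. egf (\<lambda>l. deg x * (Q ^^ l) ((Q ^^ k) f) x) t) t"
    unfolding e by (rule double_egf_tendsto[OF b'])
  also have "egf (\<lambda>k. egf (\<lambda>l. deg x * (Q ^^ l) ((Q ^^ k) f) x) t) t
     = egf (\<lambda>k. (deg x * exp t) * (Q ^^ k) (S t f) x) t"
  proof -
    have "egf (\<lambda>l. deg x * (Q ^^ l) ((Q ^^ k) f) x) t = (deg x * exp t) * (Q ^^ k) (S t f) x" for k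
      using egf_cmult[of "\<lambda>l. (Q ^^ l) ((Q ^^ k) f) x" C "deg x" t] Qk_abs_le[of "(Q ^^ k) f" C] b
        Qk_S[of f C k t x] f by (simp add: S_def exp_minus)
    then show ?thesis by simp
  qed
  also have "\<dots> = (deg x * exp t) * (exp t * S t (S t f) x)"
    using egf_cmult[of "\<lambda>k. (Q ^^ k) (S t f) x" C "deg x * exp t" t] Qk_abs_le[of "S t f" C]
      S_abs_le[of f C t] f t by (simp add: S_def[of t "S t f"] exp_minus)
  also have "S t (S t f) x = S (2 * t) f x" using S_semigroup[of f C t t x] f t by simp
  also have "(deg x * exp t) * (exp t * S (2 * t) f x) = deg x * exp (2 * t) * S (2 * t) f x"
    unfolding exp_double power2_eq_square by (simp only: mult_ac)
  finally show ?thesis .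
qed

text \<open>Up to the factor exp t, the left-hand quantity is the limit of inner products of
  truncations at time t/2 started from the two deltas, and Cauchy-Schwarz survives the
  limit.\<close>

lemma S_delta_Cauchy_Schwarz:
  assumes t: "t \<ge> 0"
  shows "(deg x * S t (delta y) x)\<^sup>2 \<le> (deg x * S t (delta x) x) * (deg y * S t (delta y) y)"
proof -
  define s where "s = t / 2"
  have s: "s \<ge> 0" "2 * s = t" using t by (auto simp: s_def)
  have l: "(\<lambda>n. ip (expsum s n (delta a)) (expsum s n (delta b))) \<longlonglongrightarrow>
      deg a * exp t * S t (delta b) a" for a b
    using ip_expsum_tendsto[OF delta_bounded s(1)] s(2) by simp
  have "(deg x * exp t * S t (delta y) x)\<^sup>2
      \<le> (deg x * exp t * S t (delta x) x) * (deg y * exp t * S t (delta y) y)"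
    by (rule LIMSEQ_le[OF tendsto_power[OF l] tendsto_mult[OF l l]])
      (auto intro!: exI[of _ 0] ip_Cauchy_Schwarz finsupp_expsum finsupp_delta)
  then have "(exp t)\<^sup>2 * (deg x * S t (delta y) x)\<^sup>2
      \<le> (exp t)\<^sup>2 * ((deg x * S t (delta x) x) * (deg y * S t (delta y) y))"
    by (simp add: power_mult_distrib power2_eq_square mult_ac)
  then show ?thesis by simp
qed

text \<open>Since \<open>Q (S r f) x - S r f x\<close> is the time derivative, the energy of the
  truncations at time \<open>t\<close> becomes in the limit \<open>deg z\<close> times the rate of
  decrease of \<open>S r (delta z) z\<close> at \<open>r = 2 * t\<close>. The path inequality
  thereby turns into a differential inequality for the return probability.\<close>

lemma S_energy_path:
  assumes t: "t \<ge> 0" and inj: "inj_on p {..d}"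
    and path: "\<And>i. i < d \<Longrightarrow> E (p i) (p (Suc i))"
  shows "(S t (delta z) (p 0) - S t (delta z) (p d))\<^sup>2
     \<le> real d * (deg z * (S (2 * t) (delta z) z - Q (S (2 * t) (delta z)) z))"
proof -
  have Qb: "\<And>y. \<bar>Q (delta z) y\<bar> \<le> 1" by (rule Q_bounded[OF delta_bounded])
  have l1: "(\<lambda>n. ip (expsum t n (delta z)) (expsum t n (delta z))) \<longlonglongrightarrow>
      deg z * exp (2 * t) * S (2 * t) (delta z) z"
    by (rule ip_expsum_tendsto[OF delta_bounded t])
  have l2: "(\<lambda>n. ip (expsum t n (delta z)) (Q (expsum t n (delta z)))) \<longlonglongrightarrow>
      deg z * exp (2 * t) * Q (S (2 * t) (delta z)) z"
    unfolding Q_expsum Q_S[OF delta_bounded] by (rule ip_expsum_tendsto[OF Qb t])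
  have l3: "(\<lambda>n. expsum t n (delta z) w) \<longlonglongrightarrow> exp t * S t (delta z) w" for w
    by (rule expsum_tendsto[OF delta_bounded])
  have "(exp t * S t (delta z) (p 0) - exp t * S t (delta z) (p d))\<^sup>2
     \<le> real d * (deg z * exp (2 * t) * S (2 * t) (delta z) z - deg z * exp (2 * t) * Q (S (2 * t) (delta z)) z)"
    by (rule LIMSEQ_le[OF tendsto_power[OF tendsto_diff[OF l3 l3]]
          tendsto_mult[OF tendsto_const tendsto_diff[OF l1 l2]]])
      (auto intro!: exI[of _ 0] energy_path finsupp_expsum finsupp_delta inj path)
  then have "exp (2 * t) * (S t (delta z) (p 0) - S t (delta z) (p d))\<^sup>2
     \<le> exp (2 * t) * (real d * (deg z * (S (2 * t) (delta z) z - Q (S (2 * t) (delta z)) z)))"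
    unfolding right_diff_distrib[symmetric] power_mult_distrib exp_double
    by (simp add: right_diff_distrib mult_ac)
  then show ?thesis by simp
qed

text \<open>The composition of \<open>S t\<close>, multiplication by the indicator of
  \<open>D\<close>, and \<open>S t\<close> is self-adjoint for the weights \<open>deg\<close>. Term
  by term, the powers l and k change places when the operator moves from one delta to the other, and
  square truncations are invariant under that exchange. It reverses walks that are in
  \<open>D\<close> at their middle time.\<close>

lemma S_symmetric:
  assumes t: "t \<ge> 0"
  shows "deg x * S t (\<lambda>w. indicator D w * S t (delta y) w) x
       = deg y * S t (\<lambda>w. indicator D w * S t (delta x) w) y"
proof -
  define h where "h f w = (indicator D w * f w :: real)" for f w
  have hb: "\<bar>h f w\<bar> \<le> C" if "\<And>y. \<bar>f y\<bar> \<le> C" for f w and C :: real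
    using that[of w] by (auto simp: h_def indicator_def)
  have lim: "(\<lambda>n. \<Sum>k<n. \<Sum>l<n. (deg x * (Q ^^ l) (h ((Q ^^ k) (delta y))) x) * t ^ l / fact l * t ^ k / fact k)
     \<longlonglongrightarrow> (exp t * exp t) * (deg x * S t (h (S t (delta y))) x)" for x y
  proof -
    have b0: "\<bar>(Q ^^ l) (h ((Q ^^ k) (delta y))) v\<bar> \<le> 1" for k l v
      by (intro Qk_abs_le hb delta_bounded)
    have b: "\<bar>deg x * (Q ^^ l) (h ((Q ^^ k) (delta y))) x\<bar> \<le> deg x" for k l
      using mult_left_mono[OF b0, of "deg x"] by (simp add: abs_mult)
    have b': "\<bar>deg x * (Q ^^ k) (h ((Q ^^ l) (delta y))) x\<bar> \<le> deg x" for k l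
      using b[of k l] b[of l k] by simp
    have "egf (\<lambda>k. egf (\<lambda>l. deg x * (Q ^^ k) (h ((Q ^^ l) (delta y))) x) t) t
      = (exp t * exp t) * (deg x * S t (h (S t (delta y))) x)"
    proof -
      \<comment> \<open>The inner series commutes with \<open>Q ^^ k\<close> because each
        application of \<open>Q\<close> is a finite sum.\<close>
      have hS: "(Q ^^ k) (h (S t (delta y))) v = exp (- t) * egf (\<lambda>l. (Q ^^ k) (h ((Q ^^ l) (delta y))) v) t" for k v
      proof (induction k arbitrary: v)
        case 0
        show ?case by (simp add: h_def S_def egf_cmult[OF Qk_abs_le[OF delta_bounded]])
      next
        case (Suc k)
        have "(Q ^^ k) (h (S t (delta y))) = (\<lambda>v. exp (- t) * egf (\<lambda>l. (Q ^^ k) (h ((Q ^^ l) (delta y))) v) t)"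
          using Suc by (rule ext)
        then have "(Q ^^ Suc k) (h (S t (delta y))) v
            = exp (- t) * Q (\<lambda>v. egf (\<lambda>l. (Q ^^ k) (h ((Q ^^ l) (delta y))) v) t) v"
          by (simp add: Q_cmult)
        also have "Q (\<lambda>v. egf (\<lambda>l. (Q ^^ k) (h ((Q ^^ l) (delta y))) v) t) v
           = egf (\<lambda>l. (1 / deg v) * (\<Sum>z | E v z. (Q ^^ k) (h ((Q ^^ l) (delta y))) z)) t"
        proof (subst egf_cmult)
          show "\<bar>\<Sum>z | E v z. (Q ^^ k) (h ((Q ^^ l) (delta y))) z\<bar> \<le> real (card {z. E v z})" for l
            using sum_bounded_above[of "{z. E v z}" "\<lambda>z. \<bar>(Q ^^ k) (h ((Q ^^ l) (delta y))) z\<bar>" 1] b0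
            by (intro order_trans[OF sum_abs]) auto
          show "Q (\<lambda>v. egf (\<lambda>l. (Q ^^ k) (h ((Q ^^ l) (delta y))) v) t) v
             = (1 / deg v) * egf (\<lambda>l. \<Sum>z | E v z. (Q ^^ k) (h ((Q ^^ l) (delta y))) z) t"
            by (subst egf_sum[where C = 1]) (auto simp: Q_def finite_nbrs b0)
        qed
        also have "\<dots> = egf (\<lambda>l. (Q ^^ Suc k) (h ((Q ^^ l) (delta y))) v) t" by (simp add: Q_def)
        finally show ?case .
      qed
      have "egf (\<lambda>l. deg x * (Q ^^ k) (h ((Q ^^ l) (delta y))) x) t
         = (deg x * exp t) * (Q ^^ k) (h (S t (delta y))) x" for k
        using egf_cmult[of "\<lambda>l. (Q ^^ k) (h ((Q ^^ l) (delta y))) x" 1 "deg x" t] b0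
        by (simp add: hS exp_minus)
      moreover have "egf (\<lambda>k. (deg x * exp t) * (Q ^^ k) (h (S t (delta y))) x) t
         = (deg x * exp t) * (exp t * S t (h (S t (delta y))) x)"
        using egf_cmult[OF Qk_abs_le[OF hb[OF S_abs_le[OF delta_bounded t]]]]
        by (simp add: S_def[of t "h (S t (delta y))"] exp_minus)
      ultimately show ?thesis by simp
    qed
    moreover have "(\<lambda>n. \<Sum>k<n. \<Sum>l<n. (deg x * (Q ^^ k) (h ((Q ^^ l) (delta y))) x) * t ^ l / fact l * t ^ k / fact k)
      \<longlonglongrightarrow> egf (\<lambda>k. egf (\<lambda>l. deg x * (Q ^^ k) (h ((Q ^^ l) (delta y))) x) t) t"
      by (rule double_egf_tendsto[OF b'])
    moreover have "(\<Sum>k<n. \<Sum>l<n. (deg x * (Q ^^ k) (h ((Q ^^ l) (delta y))) x) * t ^ l / fact l * t ^ k / fact k)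
       = (\<Sum>k<n. \<Sum>l<n. (deg x * (Q ^^ l) (h ((Q ^^ k) (delta y))) x) * t ^ l / fact l * t ^ k / fact k)" for n
      by (subst sum.swap) (simp add: mult_ac)
    ultimately show ?thesis by simp
  qed
  have sym: "deg x * (Q ^^ l) (h ((Q ^^ k) (delta y))) x = deg y * (Q ^^ k) (h ((Q ^^ l) (delta x))) y" for k l
  proof -
    have fh: "finsupp (h f)" if "finsupp f" for f
      by (rule finite_subset[OF _ that]) (auto simp: h_def)
    have "deg x * (Q ^^ l) (h ((Q ^^ k) (delta y))) x = ip ((Q ^^ l) (delta x)) (h ((Q ^^ k) (delta y)))"
      by (simp add: ip_Qk[OF finsupp_delta] ip_delta)
    also have "\<dots> = ip (h ((Q ^^ k) (delta y))) ((Q ^^ l) (delta x))"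
      by (intro ip_comm fh finsupp_Qk finsupp_delta)
    also have "\<dots> = ip ((Q ^^ k) (delta y)) (h ((Q ^^ l) (delta x)))"
      using finsupp_Qk[OF finsupp_delta, of k y] by (subst ip_eq[of "{w. (Q ^^ k) (delta y) w \<noteq> 0}"])
        (auto simp: h_def ip_def mult_ac)
    also have "\<dots> = deg y * (Q ^^ k) (h ((Q ^^ l) (delta x))) y"
      by (simp add: ip_Qk[OF finsupp_delta] ip_delta)
    finally show ?thesis .
  qed
  have eq: "(\<lambda>n. \<Sum>k<n. \<Sum>l<n. (deg x * (Q ^^ l) (h ((Q ^^ k) (delta y))) x) * t ^ l / fact l * t ^ k / fact k)
     = (\<lambda>n. \<Sum>k<n. \<Sum>l<n. (deg y * (Q ^^ l) (h ((Q ^^ k) (delta x))) y) * t ^ l / fact l * t ^ k / fact k)"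
    unfolding sym by (rule ext, subst sum.swap) (simp add: mult_ac)
  have "(exp t * exp t) * (deg x * S t (h (S t (delta y))) x) = (exp t * exp t) * (deg y * S t (h (S t (delta x))) y)"
    by (rule LIMSEQ_unique[OF lim[of x y, unfolded eq] lim[of y x]])
  then show ?thesis by (simp add: h_def[abs_def])
qed

lemma S_delta_sym:
  assumes t: "t \<ge> 0"
  shows "deg x * S t (delta y) x = deg y * S t (delta x) y"
proof -
  have "deg x * (Q ^^ k) (delta y) x = deg y * (Q ^^ k) (delta x) y" for k
    using ip_comm[OF finsupp_Qk[OF finsupp_delta] finsupp_delta, of k x y]
    by (simp add: ip_Qk[OF finsupp_delta] ip_delta)
  then show ?thesis
    using egf_cmult[of "\<lambda>k. (Q ^^ k) (delta y) x" 1 "deg x" t]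
      egf_cmult[of "\<lambda>k. (Q ^^ k) (delta x) y" 1 "deg y" t] Qk_abs_le[OF delta_bounded]
    by (simp add: S_def)
qed

lemma S_delta_mass:
  assumes "finite B" "t \<ge> 0"
  shows "(\<Sum>w\<in>B. S t (delta w) z) \<le> 1"
proof -
  have "(\<Sum>w\<in>B. S t (delta w) z) = S t (\<lambda>v. \<Sum>w\<in>B. delta w v) z"
    unfolding S_def Qk_sum
    by (subst egf_sum[where C = 1]) (auto simp: assms sum_distrib_left intro: Qk_abs_le delta_bounded)
  also have "\<dots> \<le> 1"
  proof -
    have "\<bar>\<Sum>w\<in>B. delta w v\<bar> \<le> 1" for v
      using assms(1) by (simp add: delta_def)
    from S_abs_le[of "\<lambda>v. \<Sum>w\<in>B. delta w v" 1 t z, OF this assms(2)] show ?thesis by (simp add: abs_le_iff)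
  qed
  finally show ?thesis .
qed

section \<open>Heat kernel and its on-diagonal bound\<close>

definition hk :: "real \<Rightarrow> 'a \<Rightarrow> 'a \<Rightarrow> real" where
  "hk t x y = S t (delta y) x / deg y"

lemma hk_nonneg: "t \<ge> 0 \<Longrightarrow> hk t x y \<ge> 0"
  unfolding hk_def by (intro divide_nonneg_nonneg S_nonneg[OF delta_bounded]) (auto simp: delta_def)

lemma hk_Cauchy_Schwarz:
  assumes "t \<ge> 0" "deg x > 0" "deg y > 0" "hk t x x \<le> K" "hk t y y \<le> K"
  shows "hk t x y \<le> K"
proof -
  have "(deg x * deg y * hk t x y)\<^sup>2 \<le> (deg x * deg x * hk t x x) * (deg y * deg y * hk t y y)"
    using S_delta_Cauchy_Schwarz[OF assms(1), of x y] assms by (simp add: hk_def)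
  then have "(deg x * deg y)\<^sup>2 * (hk t x y)\<^sup>2 \<le> (deg x * deg y)\<^sup>2 * (hk t x x * hk t y y)"
    by (simp add: power_mult_distrib power2_eq_square mult_ac)
  then have "(hk t x y)\<^sup>2 \<le> hk t x x * hk t y y" using assms by simp
  also have "\<dots> \<le> K * K"
    using assms hk_nonneg[OF assms(1)] by (intro mult_mono) (auto intro: order_trans)
  finally have "(hk t x y)\<^sup>2 \<le> K\<^sup>2" by (simp only: power2_eq_square)
  moreover have "K \<ge> 0" using hk_nonneg[OF assms(1), of x x] assms(4) by linarith
  ultimately show ?thesis by (rule power2_le_imp_le)
qed

text \<open>A Nash-type argument for \<phi>(r) = \<open>hk r z z\<close>. As long as \<phi> exceeds
  2 / V, some \<open>w\<close> in \<open>B\<close> has density at most 1 / V because the total mass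
  is at most 1. The energy inequality along the path from \<open>z\<close> to \<open>w\<close> then
  gives \<phi>^2 \<le> - 4 \<rho> \<phi>', and integrating (1 / \<phi>)' \<ge> 1 / (4 \<rho>) over
  [0, s] yields the second alternative.\<close>

lemma hk_on_diagonal:
  assumes B: "finite B" and dz: "deg z > 0" and rho: "\<rho> > 0" and s: "s > 0"
    and V: "(\<Sum>w\<in>B. deg w) = V" "V > 0"
    and paths: "\<And>w. w \<in> B \<Longrightarrow> \<exists>p d. p 0 = z \<and> p d = w \<and> real d \<le> \<rho> \<and> inj_on p {..d}
        \<and> (\<forall>i<d. E (p i) (p (Suc i)))"
  shows "hk s z z \<le> max (2 / V) (4 * \<rho> / s)"
proof (rule ccontr)
  assume neg: "\<not> ?thesis"
  define \<phi> where "\<phi> r = hk r z z" for r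
  define en where "en r = (S r (delta z) z - Q (S r (delta z)) z) / deg z" for r
  have der: "(\<phi> has_real_derivative - en r) (at r)" for r
    unfolding \<phi>_def hk_def en_def
    using DERIV_cdivide[OF S_has_derivative[of "delta z" 1 z r, OF delta_bounded], of "deg z"]
    by (simp add: minus_divide_left)
  have en_path: "(hk (r / 2) z z - hk (r / 2) w z)\<^sup>2 \<le> \<rho> * en r \<and> en r \<ge> 0"
    if w: "w \<in> B" and r: "r \<ge> 0" for w r
  proof -
    obtain p d where p: "p 0 = z" "p d = w" "real d \<le> \<rho>" "inj_on p {..d}" "\<And>i. i<d \<Longrightarrow> E (p i) (p (Suc i))"
      using paths[OF w] by blast
    have e: "(S (r/2) (delta z) (p 0) - S (r/2) (delta z) (p d))\<^sup>2
      \<le> real d * (deg z * (S r (delta z) z - Q (S r (delta z)) z))"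
      using S_energy_path[of "r/2" p d z] p(4,5) r by simp
    \<comment> \<open>For \<open>w = z\<close> the path may be trivial and says nothing about the
      sign of the energy; a single edge at \<open>z\<close> settles it.\<close>
    have "0 \<le> real 1 * (deg z * (S r (delta z) z - Q (S r (delta z)) z))"
    proof -
      obtain v where v: "E z v" using dz finite_nbrs[of z] by (auto simp: deg_def card_gt_0_iff)
      have "(S (r/2) (delta z) ((\<lambda>i. if i = (0::nat) then z else v) 0)
          - S (r/2) (delta z) ((\<lambda>i. if i = (0::nat) then z else v) 1))\<^sup>2
         \<le> real 1 * (deg z * (S (2 * (r/2)) (delta z) z - Q (S (2 * (r/2)) (delta z)) z))"
        by (rule S_energy_path) (use v r E_irrefl in \<open>auto simp: inj_on_def\<close>)
      from order_trans[OF zero_le_power2 this] show ?thesis by simp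
    qed
    then have en0: "en r \<ge> 0" using dz by (simp add: en_def zero_le_mult_iff)
    have "(hk (r / 2) z z - hk (r / 2) w z)\<^sup>2 \<le> real d * en r"
      using divide_right_mono[OF e, of "(deg z)\<^sup>2"] p(1,2) dz
      by (simp add: hk_def en_def diff_divide_distrib[symmetric] power_divide power2_eq_square)
    also have "\<dots> \<le> \<rho> * en r" using p en0 by (intro mult_right_mono) auto
    finally show ?thesis using en0 by simp
  qed
  obtain w0 where "w0 \<in> B" using V by fastforce
  then have en0: "en r \<ge> 0" if "r \<ge> 0" for r using en_path that by blast
  have mono: "\<phi> b \<le> \<phi> a" if "0 \<le> a" "a \<le> b" for a b
    by (rule DERIV_nonpos_imp_nonincreasing[OF that(2)]) (use der en0 that in \<open>force\<close>)
  have big: "\<phi> r > 2 / V" if "0 \<le> r" "r \<le> s" for r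
    using mono[OF that] neg by (simp add: \<phi>_def)
  have ineq: "(\<phi> r)\<^sup>2 \<le> 4 * \<rho> * en r" if r: "0 \<le> r" "r \<le> s" for r
  proof -
    have "\<exists>w\<in>B. hk (r / 2) w z \<le> 1 / V"
    proof (rule ccontr)
      assume "\<not> ?thesis"
      then have gt: "\<And>w. w \<in> B \<Longrightarrow> hk (r / 2) w z > 1 / V" by force
      have "1 = (\<Sum>w\<in>B. deg w * (1 / V))"
        using V by (simp add: sum_distrib_right[symmetric] sum_divide_distrib[symmetric])
      also have "\<dots> < (\<Sum>w\<in>B. deg w * hk (r / 2) w z)"
      proof (rule sum_strict_mono_ex1[OF B])
        show "\<forall>w\<in>B. deg w * (1 / V) \<le> deg w * hk (r / 2) w z"
          by (intro ballI mult_left_mono less_imp_le[OF gt] deg_nonneg)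
        obtain w where w: "w \<in> B" "deg w \<noteq> 0" using V by (metis less_irrefl sum.neutral)
        then have "deg w > 0" using deg_nonneg[of w] by linarith
        then have "deg w * (1 / V) < deg w * hk (r / 2) w z"
          using gt[OF w(1)] mult_strict_left_mono by blast
        then show "\<exists>w\<in>B. deg w * (1 / V) < deg w * hk (r / 2) w z" using w by blast
      qed
      also have "\<dots> = (\<Sum>w\<in>B. S (r/2) (delta w) z)"
        using S_delta_sym[of "r/2" _ z] r dz by (intro sum.cong refl) (simp add: hk_def)
      also have "\<dots> \<le> 1" using S_delta_mass[OF B] r by simp
      finally show False by simp
    qed
    then obtain w where w: "w \<in> B" "hk (r / 2) w z \<le> 1 / V" by blast
    \<comment> \<open>\<open>\<phi>\<close> is nonincreasing and \<open>\<phi> r > 2 / V\<close>, so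
      subtracting 1 / V from \<open>\<phi> (r / 2)\<close> still leaves half of
      \<open>\<phi> r\<close>. This is the origin of the 2 in \<open>2 / V\<close>.\<close>
    have "\<phi> r / 2 \<le> \<phi> (r / 2) - 1 / V"
      using mono[of "r/2" r] big[OF r] r by (simp add: field_simps)
    also have "\<dots> \<le> hk (r / 2) z z - hk (r / 2) w z" using w by (simp add: \<phi>_def)
    finally have "(\<phi> r / 2)\<^sup>2 \<le> (hk (r / 2) z z - hk (r / 2) w z)\<^sup>2"
      using big[OF r] V by (intro power_mono) (auto intro: less_imp_le order_trans[rotated])
    also have "\<dots> \<le> \<rho> * en r" using en_path[OF w(1) r(1)] by simp
    finally show ?thesis by (simp add: power_divide)
  qed
  have pos: "\<phi> r > 0" if "0 \<le> r" "r \<le> s" for r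
  proof -
    have "0 < 2 / V" using V by simp
    with big[OF that] show ?thesis by linarith
  qed
  define h where "h r = r / (4 * \<rho>) - 1 / \<phi> r" for r
  have "h s \<le> h 0"
  proof (rule DERIV_nonpos_imp_nonincreasing[of 0 s h])
    fix r assume r: "0 \<le> r" "r \<le> s"
    have "(h has_real_derivative 1 / (4 * \<rho>) - en r / (\<phi> r)\<^sup>2) (at r)"
      unfolding h_def
      by (rule derivative_eq_intros der refl | use pos[OF r] rho in \<open>simp add: power2_eq_square\<close>)+
    moreover have "1 / (4 * \<rho>) - en r / (\<phi> r)\<^sup>2 \<le> 0"
      using ineq[OF r] pos[OF r] rho by (simp add: field_simps)
    ultimately show "\<exists>y. (h has_real_derivative y) (at r) \<and> y \<le> 0" by blast
  qed (use s in simp)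
  also have "h 0 \<le> 0" using pos[of 0] s by (simp add: h_def)
  finally have "s / (4 * \<rho>) \<le> 1 / \<phi> s" by (simp add: h_def)
  then have "\<phi> s \<le> 4 * \<rho> / s" using pos[of s] s rho by (simp add: field_simps)
  then show False using neg by (simp add: \<phi>_def)
qed

section \<open>Exit functions and their comparison with the semigroup\<close>

lemma exists_exit_function:
  assumes th: "\<theta> > 0"
  obtains u where "\<And>w. 0 \<le> u w" "\<And>w. u w \<le> 1" "u z = 1" "\<And>w. w \<noteq> z \<Longrightarrow> Q u w = (1 + \<theta>) * u w"
proof -
  \<comment> \<open>A mean-one exponential holding time has Laplace transform
    \<open>1 / (1 + \<theta>)\<close>, the discount for each jump before \<open>z\<close> is hit.
    The iteration starts at the supersolution 1 and hence decreases; finite neighbourhoods let the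
    limit pass through \<open>Q\<close>.\<close>
  define \<Psi> where "\<Psi> f w = (if w = z then 1 else Q f w / (1 + \<theta>))" for f w
  define a where "a k = (\<Psi> ^^ k) (\<lambda>_. 1)" for k
  have aS: "a (Suc k) w = \<Psi> (a k) w" for k w by (simp add: a_def)
  have a0: "0 \<le> a k w" for k w
    by (induction k arbitrary: w) (use th in \<open>auto simp: a_def \<Psi>_def intro!: divide_nonneg_nonneg Q_nonneg\<close>)
  have dec: "a (Suc k) w \<le> a k w" for k w
  proof (induction k arbitrary: w)
    case 0
    have "Q (\<lambda>_. 1) w \<le> 1" by (rule Q_le) auto
    then show ?case using th by (auto simp: a_def \<Psi>_def)
  next
    case (Suc k)
    then show ?case using th unfolding aS[of "Suc k"] aS[of k]
      by (auto simp: \<Psi>_def intro!: divide_right_mono Q_mono)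
  qed
  have decs: "decseq (\<lambda>k. a k w)" for w using dec by (simp add: decseq_Suc_iff)
  have a1: "a k w \<le> 1" for k w
    using decseqD[OF decs, of 0 k w] by (simp add: a_def)
  define u where "u w = lim (\<lambda>k. a k w)" for w
  have lim: "(\<lambda>k. a k w) \<longlonglongrightarrow> u w" for w
    unfolding u_def using decseq_convergent[OF decs, of 0] a0 by (metis limI)
  have "0 \<le> u w" for w using LIMSEQ_le_const[OF lim] a0 by blast
  moreover have "u w \<le> 1" for w using LIMSEQ_le_const2[OF lim] a1 by blast
  moreover have "u z = 1"
  proof -
    have "(\<lambda>k. a (Suc k) z) \<longlonglongrightarrow> u z" using lim LIMSEQ_Suc by blast
    then show ?thesis unfolding aS \<Psi>_def by (simp add: LIMSEQ_const_iff)
  qed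
  moreover have "Q u w = (1 + \<theta>) * u w" if "w \<noteq> z" for w
  proof -
    have "(\<lambda>k. a (Suc k) w) \<longlonglongrightarrow> Q u w / (1 + \<theta>)"
      unfolding aS \<Psi>_def Q_def divide_inverse using that by (auto intro!: tendsto_intros lim)
    then have "u w = Q u w / (1 + \<theta>)" using LIMSEQ_unique LIMSEQ_Suc[OF lim] by blast
    then show ?thesis using th by simp
  qed
  ultimately show ?thesis using that by blast
qed

text \<open>An elliptic maximum principle on a possibly infinite \<open>D\<close>. The discount
  replaces compactness: every use of the equation shrinks the error by the factor
  \<open>1 / (1 + \<theta>)\<close>.\<close>

lemma exit_function_local_bound:
  assumes u1: "\<And>w. u w \<le> 1" and th: "\<theta> > 0" and b: "b \<ge> 0"
    and eq: "\<And>w. w \<in> D \<Longrightarrow> Q u w = (1 + \<theta>) * u w"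
    and bdry: "\<And>w y. w \<in> D \<Longrightarrow> E w y \<Longrightarrow> y \<notin> D \<Longrightarrow> u y \<le> b"
    and w: "w \<in> D"
  shows "u w \<le> b"
proof -
  have main: "\<forall>w\<in>D. u w \<le> b + (1 / (1 + \<theta>)) ^ k" for k
  proof (induction k)
    case 0
    show ?case using u1 b by (simp add: add_increasing)
  next
    case (Suc k)
    show ?case
    proof
      fix w assume w: "w \<in> D"
      have "(1 + \<theta>) * u w = Q u w" using eq[OF w] by simp
      also have "\<dots> \<le> b + (1 / (1 + \<theta>)) ^ k"
      proof (rule Q_le)
        fix y assume y: "E w y"
        show "u y \<le> b + (1 / (1 + \<theta>)) ^ k"
        proof (cases "y \<in> D")
          case True then show ?thesis using Suc by blast
        next
          case False
          have "0 \<le> (1 / (1 + \<theta>)) ^ k" using th by simp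
          with bdry[OF w y False] show ?thesis by linarith
        qed
      qed (use b th in simp)
      also have "\<dots> = b + (1 + \<theta>) * (1 / (1 + \<theta>)) ^ Suc k" using th by simp
      also have "\<dots> \<le> (1 + \<theta>) * (b + (1 / (1 + \<theta>)) ^ Suc k)"
        using th b unfolding distrib_left by (intro add_right_mono) (simp add: mult_le_cancel_right1)
      finally show "u w \<le> b + (1 / (1 + \<theta>)) ^ Suc k" using th by simp
    qed
  qed
  have "(\<lambda>k. b + (1 / (1 + \<theta>)) ^ k) \<longlonglongrightarrow> b + 0"
    using th by (intro tendsto_intros LIMSEQ_power_zero) auto
  then show ?thesis using LIMSEQ_le_const[of _ "b + 0" "u w"] main w by auto
qed

text \<open>Off \<open>z\<close>, Q u - u = \<theta> u, so \<open>exp (\<theta> * s) * u\<close>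
  solves the heat equation there. Multiplied by \<open>K\<close> it dominates \<open>S s h\<close>
  on \<open>D\<close> at time 0 and at the only exit \<open>z\<close> at all times, hence throughout
  \<open>D\<close>.\<close>

lemma S_le_exit_function:
  assumes u: "\<And>w. 0 \<le> u w" "\<And>w. u w \<le> 1" "u z = 1" "\<And>w. w \<noteq> z \<Longrightarrow> Q u w = (1 + \<theta>) * u w"
    and th: "\<theta> > 0" and zD: "z \<notin> D" and D: "\<And>w y. w \<in> D \<Longrightarrow> E w y \<Longrightarrow> y \<notin> D \<Longrightarrow> y = z"
    and h: "\<And>w. \<bar>h w\<bar> \<le> C" "\<And>w. w \<in> D \<Longrightarrow> h w \<le> 0"
    and K: "K \<ge> 0" "\<And>s. 0 \<le> s \<Longrightarrow> s \<le> T \<Longrightarrow> S s h z \<le> K"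
    and w: "w \<in> D" and T: "T \<ge> 0"
  shows "S T h w \<le> K * exp (\<theta> * T) * u w"
proof -
  define g where "g s w = S s h w - K * exp (\<theta> * s) * u w" for s w
  have "g T w \<le> 0"
  proof (rule parabolic_max_principle[where g = g and D = D and T = T and C = C])
    fix s v assume v: "v \<in> D" and s: "0 \<le> s" "s \<le> T"
    have "v \<noteq> z" using v zD by auto
    then have Qu: "Q u v = (1 + \<theta>) * u v" using u by simp
    have "((\<lambda>s. g s v) has_real_derivative
       (Q (S s h) v - S s h v) - K * (exp (\<theta> * s) * \<theta>) * u v) (at s)"
      unfolding g_def
      by (rule derivative_eq_intros S_has_derivative[OF h(1)] refl | simp add: algebra_simps)+
    moreover have "(Q (S s h) v - S s h v) - K * (exp (\<theta> * s) * \<theta>) * u v = Q (g s) v - g s v"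
      unfolding g_def Q_diff Q_cmult Qu by (simp add: algebra_simps)
    ultimately show "\<exists>g'. ((\<lambda>s. g s v) has_real_derivative g') (at s) \<and> g' \<le> Q (g s) v - g s v"
      by (intro exI conjI) auto
  next
    fix v assume "v \<in> D"
    then show "g 0 v \<le> 0" using h(2)[of v] u(1)[of v] K(1) by (simp add: g_def add_increasing2 order_trans[of _ 0])
  next
    fix s v y assume v: "v \<in> D" "E v y" "y \<notin> D" and s: "0 \<le> s" "s \<le> T"
    have "y = z" using D v by blast
    moreover have "K * 1 \<le> K * exp (\<theta> * s)" using K th s by (intro mult_left_mono) auto
    ultimately show "g s y \<le> 0" using K(2)[OF s] u(3) by (simp add: g_def)
  next
    fix s v assume "v \<in> D" and s: "0 \<le> s" "s \<le> T"
    have "S s h v \<le> C" using S_abs_le[OF h(1) s(1)] by (simp add: abs_le_iff)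
    moreover have "K * exp (\<theta> * s) * u v \<ge> 0" using K u by simp
    ultimately show "g s v \<le> C" by (simp add: g_def)
  qed (use w T in auto)
  then show ?thesis by (simp add: g_def)
qed

text \<open>Split the walk from x to y at time t/2 according to the side of z it is on. On the part that
  is already across, x has had to pass z before t/2; on the other part, by reversibility,
  so has the walk started from y.\<close>
lemma hk_le_exit_function:
  assumes u: "\<And>w. 0 \<le> u w" "\<And>w. u w \<le> 1" "u z = 1" "\<And>w. w \<noteq> z \<Longrightarrow> Q u w = (1 + \<theta>) * u w"
    and th: "\<theta> > 0" and zD: "z \<notin> D" and D: "\<And>w y. w \<in> D \<Longrightarrow> E w y \<Longrightarrow> y \<notin> D \<Longrightarrow> y = z"
    and x: "x \<in> D" and y: "y \<notin> D" "y \<noteq> z" and deg: "deg x > 0" "deg y > 0" and t: "t > 0"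
    and K: "K \<ge> 0" "\<And>s. t / 2 \<le> s \<Longrightarrow> s \<le> t \<Longrightarrow> hk s z x \<le> K" "\<And>s. t / 2 \<le> s \<Longrightarrow> s \<le> t \<Longrightarrow> hk s z y \<le> K"
  shows "hk t x y \<le> K * exp (\<theta> * t) * (u x + u y)"
proof -
  define s where "s = t / 2"
  have s: "s \<ge> 0" "s + s = t" "s > 0" using t by (auto simp: s_def)
  have b: "\<bar>S s (delta v) w\<bar> \<le> 1" for v w by (rule S_abs_le[OF delta_bounded s(1)])
  have nn: "S s (delta v) w \<ge> 0" for v w
    by (rule S_nonneg[OF delta_bounded _ s(1)]) (simp add: delta_def)
  have bi: "\<bar>indicator A w * S s (delta v) w\<bar> \<le> 1" for A :: "'a set" and v w
    using b[of v w] by (auto simp: indicator_def)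
  \<comment> \<open>\<open>F\<close> is the side of \<open>z\<close> on which the walk starts,
    \<open>A\<close> a set disjoint from it that the walk occupies at time t/2. At \<open>z\<close>
    the semigroup law leaves the times r + t/2 with r \<le> t/2, which explains the window [t/2, t]
    in the bounds on the kernel.\<close>
  have half: "S s (\<lambda>w. indicator A w * S s (delta v) w) x' / deg v \<le> K * exp (\<theta> * s) * u x'"
    if A: "\<And>w. w \<in> F \<Longrightarrow> w \<notin> A" and zF: "z \<notin> F"
      and F: "\<And>w y. w \<in> F \<Longrightarrow> E w y \<Longrightarrow> y \<notin> F \<Longrightarrow> y = z" and x': "x' \<in> F" and v: "deg v > 0"
      and Kv: "\<And>r. t / 2 \<le> r \<Longrightarrow> r \<le> t \<Longrightarrow> hk r z v \<le> K" for A F v x'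
  proof -
    have "S s (\<lambda>w. indicator A w * S s (delta v) w) x' \<le> (K * deg v) * exp (\<theta> * s) * u x'"
    proof (rule S_le_exit_function[OF u th zF F bi])
      fix r assume r: "0 \<le> r" "r \<le> s"
      have "S r (\<lambda>w. indicator A w * S s (delta v) w) z \<le> S r (S s (delta v)) z"
        using nn by (intro S_mono[OF bi b _ r(1)]) (auto simp: indicator_def)
      also have "\<dots> = S (r + s) (delta v) z" by (rule S_semigroup[OF delta_bounded r(1) s(1)])
      also have "\<dots> \<le> K * deg v" using Kv[of "r + s"] r s v by (simp add: hk_def s_def field_simps)
      finally show "S r (\<lambda>w. indicator A w * S s (delta v) w) z \<le> K * deg v" .
    qed (use K A x' s v in auto)
    then show ?thesis using v by (simp add: field_simps)
  qed
  have "S t (delta y) x = S s (S s (delta y)) x"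
    using S_semigroup[OF delta_bounded s(1) s(1)] s(2) by simp
  also have "S s (delta y) = (\<lambda>w. indicator (- D) w * S s (delta y) w + indicator D w * S s (delta y) w)"
    by (auto simp: indicator_def)
  also have "S s \<dots> x = S s (\<lambda>w. indicator (- D) w * S s (delta y) w) x
      + S s (\<lambda>w. indicator D w * S s (delta y) w) x"
    by (rule S_add[OF bi bi])
  also have "S s (\<lambda>w. indicator D w * S s (delta y) w) x
      = deg y * S s (\<lambda>w. indicator D w * S s (delta x) w) y / deg x"
    using S_symmetric[OF s(1), of x D y] deg by (simp add: field_simps)
  finally have "hk t x y = S s (\<lambda>w. indicator (- D) w * S s (delta y) w) x / deg y
      + S s (\<lambda>w. indicator D w * S s (delta x) w) y / deg x"
    using deg by (simp add: hk_def field_simps)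
  also have "\<dots> \<le> K * exp (\<theta> * s) * u x + K * exp (\<theta> * s) * u y"
  proof (intro add_mono)
    show "S s (\<lambda>w. indicator (- D) w * S s (delta y) w) x / deg y \<le> K * exp (\<theta> * s) * u x"
      by (rule half[where F = D]) (use zD D x deg K(3) in auto)
    \<comment> \<open>\<open>z\<close> lies in \<open>- D\<close> and counts as already across in
      the first half. The starting side of \<open>y\<close> has to leave it out, and by symmetry of
      \<open>E\<close> its only exit is again \<open>z\<close>.\<close>
    show "S s (\<lambda>w. indicator D w * S s (delta x) w) y / deg x \<le> K * exp (\<theta> * s) * u y"
      by (rule half[where F = "- D - {z}"]) (use zD D y E_sym deg K(2) in auto)
  qed
  also have "\<dots> = K * exp (\<theta> * s) * (u x + u y)" by (simp add: algebra_simps)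
  also have "\<dots> \<le> K * exp (\<theta> * t) * (u x + u y)"
    using K(1) u(1) th s t by (intro mult_right_mono mult_left_mono) (auto simp: s_def)
  finally show ?thesis .
qed

end

section \<open>Exit functions on rooted trees\<close>

text \<open>The root will be the middle point rather than the root of B: \<open>par\<close> is then
  a step towards the point to be hit and \<open>depth\<close> the distance to it. The tree structure
  is imposed on \<open>V\<close> only, as the type also contains words outside
  \<open>G\<close>.\<close>

locale rooted_tree = lf_graph E for E :: "'a \<Rightarrow> 'a \<Rightarrow> bool" +
  fixes V :: "'a set" and rt :: 'a and par :: "'a \<Rightarrow> 'a" and depth :: "'a \<Rightarrow> nat"
  assumes rt_in: "rt \<in> V"
    and depth_rt: "depth rt = 0"
    and par_in: "w \<in> V \<Longrightarrow> w \<noteq> rt \<Longrightarrow> par w \<in> V"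
    and par_nbr: "w \<in> V \<Longrightarrow> w \<noteq> rt \<Longrightarrow> E w (par w)"
    and depth_par: "w \<in> V \<Longrightarrow> w \<noteq> rt \<Longrightarrow> depth w = Suc (depth (par w))"
    and nbr_in: "w \<in> V \<Longrightarrow> E w y \<Longrightarrow> y \<in> V"
    and nbr_cases: "w \<in> V \<Longrightarrow> E w y \<Longrightarrow> (w \<noteq> rt \<and> y = par w) \<or> (y \<noteq> rt \<and> par y = w)"
begin

definition desc :: "'a \<Rightarrow> 'a set" where
  "desc c = {w \<in> V. depth c \<le> depth w \<and> (par ^^ (depth w - depth c)) w = c}"

definition children :: "'a \<Rightarrow> 'a set" where
  "children c = {y \<in> V. y \<noteq> rt \<and> par y = c}"

lemma par_pow:
  "w \<in> V \<Longrightarrow> i \<le> depth w \<Longrightarrow> (par ^^ i) w \<in> V \<and> depth ((par ^^ i) w) = depth w - i"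
proof (induction i)
  case (Suc i)
  then have IH: "(par ^^ i) w \<in> V" "depth ((par ^^ i) w) = depth w - i" by auto
  then have ne: "(par ^^ i) w \<noteq> rt" using Suc.prems depth_rt by auto
  show ?case using par_in[OF IH(1) ne] depth_par[OF IH(1) ne] IH(2) by simp
qed simp

lemma desc_self: "c \<in> V \<Longrightarrow> c \<in> desc c" by (simp add: desc_def)

lemma desc_in: "w \<in> desc c \<Longrightarrow> w \<in> V" by (simp add: desc_def)

lemma desc_depth: "w \<in> desc c \<Longrightarrow> depth c \<le> depth w" by (simp add: desc_def)

lemma desc_pow: "w \<in> desc c \<Longrightarrow> (par ^^ (depth w - depth c)) w = c" by (simp add: desc_def)

lemma desc_unique: "w \<in> desc a \<Longrightarrow> w \<in> desc b \<Longrightarrow> depth a = depth b \<Longrightarrow> a = b"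
  by (auto simp: desc_def)

lemma rt_desc: "rt \<in> desc c \<longleftrightarrow> c = rt"
  using rt_in depth_rt by (auto simp: desc_def)

lemma pow_desc:
  assumes "w \<in> V" "i \<le> depth w" shows "w \<in> desc ((par ^^ i) w)"
  using par_pow[OF assms] assms by (auto simp: desc_def)

lemma desc_trans:
  assumes "a \<in> desc b" "b \<in> desc c" shows "a \<in> desc c"
proof -
  have d: "depth c \<le> depth b" "depth b \<le> depth a" using assms desc_depth by auto
  have "(par ^^ (depth a - depth c)) a = (par ^^ ((depth b - depth c) + (depth a - depth b))) a"
    using d by simp
  also have "\<dots> = c" using desc_pow[OF assms(1)] desc_pow[OF assms(2)] by (simp add: funpow_add)
  finally show ?thesis using d desc_in[OF assms(1)] by (simp add: desc_def)
qed

lemma child_desc: "y \<in> children c \<Longrightarrow> y \<in> desc c"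
  using pow_desc[of y 1] depth_par[of y] by (auto simp: children_def)

lemma par_desc:
  assumes "w \<in> desc c" "w \<noteq> c" shows "par w \<in> desc c" "w \<noteq> rt"
proof -
  have lt: "depth c < depth w" using assms by (cases "depth c = depth w") (auto simp: desc_def)
  then have w: "w \<in> V" "w \<noteq> rt" using desc_in[OF assms(1)] depth_rt by auto
  then have d: "depth w = Suc (depth (par w))" using depth_par by auto
  then have "(par ^^ (depth (par w) - depth c)) (par w) = (par ^^ (depth w - depth c)) w"
    using lt by (simp add: Suc_diff_le funpow_swap1)
  then show "par w \<in> desc c" using assms d lt par_in[OF w] by (auto simp: desc_def)
  show "w \<noteq> rt" using w by simp
qed

lemma nbr_desc:
  assumes "w \<in> desc c" "E w y" shows "y \<in> desc c \<or> (w = c \<and> c \<noteq> rt \<and> y = par c)"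
proof -
  from nbr_cases[OF desc_in[OF assms(1)] assms(2)] show ?thesis
  proof (elim disjE conjE)
    assume "w \<noteq> rt" "y = par w"
    then show ?thesis using par_desc(1)[OF assms(1)] by auto
  next
    assume "y \<noteq> rt" "par y = w"
    then have "y \<in> children w" using nbr_in[OF desc_in[OF assms(1)] assms(2)] by (simp add: children_def)
    then show ?thesis using desc_trans[OF child_desc assms(1)] by blast
  qed
qed

lemma children_subset: "children c \<subseteq> {y. E c y}"
  using par_nbr E_sym by (auto simp: children_def)

lemma finite_children: "finite (children c)"
  by (rule finite_subset[OF children_subset finite_nbrs])

lemma nbrs_eq:
  assumes "c \<in> V" "c \<noteq> rt"
  shows "{y. E c y} = insert (par c) (children c)" "par c \<notin> children c"
proof -
  show "{y. E c y} = insert (par c) (children c)"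
    using children_subset[of c] par_nbr[OF assms] nbr_cases[OF assms(1)] nbr_in[OF assms(1)]
    by (auto simp: children_def)
  show "par c \<notin> children c"
  proof
    assume "par c \<in> children c"
    then have "depth (par c) = Suc (depth c)" using depth_par[of "par c"] by (auto simp: children_def)
    then show False using depth_par[OF assms] by simp
  qed
qed

lemma depth_child: "y \<in> children c \<Longrightarrow> depth y = Suc (depth c)"
  using depth_par by (auto simp: children_def)

lemma desc_cases:
  assumes "w \<in> desc c" "w \<noteq> c"
  obtains y where "y \<in> children c" "w \<in> desc y"
proof -
  have lt: "depth c < depth w" using assms by (cases "depth c = depth w") (auto simp: desc_def)
  define k where "k = depth w - depth c - 1"
  define y where "y = (par ^^ k) w"
  have y: "y \<in> V" "depth y = Suc (depth c)"
    using par_pow[OF desc_in[OF assms(1)], of k] lt by (auto simp: y_def k_def)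
  have "par y = (par ^^ Suc k) w" by (simp add: y_def)
  also have "Suc k = depth w - depth c" using lt by (simp add: k_def)
  finally have "par y = c" using desc_pow[OF assms(1)] by simp
  moreover have "y \<noteq> rt" using y depth_rt by auto
  ultimately have "y \<in> children c" using y by (simp add: children_def)
  moreover have "w \<in> desc y" unfolding y_def
    by (rule pow_desc[OF desc_in[OF assms(1)]]) (simp add: k_def)
  ultimately show ?thesis using that by blast
qed

text \<open>The recursion for sums over subtrees that matches \<open>flux_eq\<close>; the two flux
  estimates are inductions that unfold both in parallel.\<close>

lemma sum_desc:
  fixes f :: "'a \<Rightarrow> real"
  assumes "finite T" "c \<in> V"
  shows "sum f (T \<inter> desc c) = (if c \<in> T then f c else 0) + (\<Sum>y\<in>children c. sum f (T \<inter> desc y))"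
proof -
  have "w \<in> desc c \<longleftrightarrow> w = c \<or> (\<exists>y\<in>children c. w \<in> desc y)" for w
    using desc_trans[OF _ child_desc] desc_self[OF assms(2)] by (metis desc_cases)
  then have "T \<inter> desc c = (T \<inter> {c}) \<union> (\<Union>y\<in>children c. T \<inter> desc y)" by blast
  moreover have "(T \<inter> {c}) \<inter> (\<Union>y\<in>children c. T \<inter> desc y) = {}"
    using desc_depth[of c] depth_child by fastforce
  ultimately have "sum f (T \<inter> desc c) = sum f (T \<inter> {c}) + sum f (\<Union>y\<in>children c. T \<inter> desc y)"
    using assms(1) finite_children by (simp add: sum.union_disjoint)
  also have "sum f (\<Union>y\<in>children c. T \<inter> desc y) = (\<Sum>y\<in>children c. sum f (T \<inter> desc y))"
  proof (intro sum.UNION_disjoint ballI impI)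
    fix y y' assume y: "y \<in> children c" "y' \<in> children c" "y \<noteq> y'"
    then have "desc y \<inter> desc y' = {}" using desc_unique[of _ y y'] depth_child by fastforce
    then show "(T \<inter> desc y) \<inter> (T \<inter> desc y') = {}" by blast
  qed (use assms(1) finite_children in auto)
  also have "sum f (T \<inter> {c}) = (if c \<in> T then f c else 0)" by simp
  finally show ?thesis .
qed

text \<open>Each step climbs at most one level. It places a ball of radius \<open>m\<close> inside
  the single subtree below the \<open>m\<close>-th ancestor of its centre.\<close>

lemma walk_desc:
  assumes "z \<in> V" "(E ^^ m) z w" "m \<le> depth z"
  shows "w \<in> desc ((par ^^ m) z)"
  using assms(2,3)
proof (induction m arbitrary: w)
  case 0
  then show ?case using assms desc_self by simp
next
  case (Suc m)
  then obtain v where v: "(E ^^ m) z v" "E v w" by auto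
  have up: "(par ^^ m) z \<in> desc ((par ^^ Suc m) z)"
  proof -
    have p: "(par ^^ m) z \<in> V" "depth ((par ^^ m) z) = depth z - m"
      using par_pow[OF assms(1), of m] Suc.prems by auto
    then show ?thesis using pow_desc[of "(par ^^ m) z" 1] Suc.prems by simp
  qed
  have "v \<in> desc ((par ^^ m) z)" using Suc v by simp
  from nbr_desc[OF this v(2)] show ?case
  proof (elim disjE conjE)
    assume "w \<in> desc ((par ^^ m) z)"
    then show ?thesis using desc_trans[OF _ up] by blast
  next
    assume "w = par ((par ^^ m) z)"
    then show ?thesis using desc_self par_pow[OF assms(1) Suc.prems(2)] by simp
  qed
qed

end

section \<open>Flux of an exit function through the edges of the tree\<close>

locale tree_exit = rooted_tree +
  fixes u :: "'a \<Rightarrow> real" and \<theta> :: real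
  assumes u_nonneg: "0 \<le> u w" and u_le_1: "u w \<le> 1" and u_rt: "u rt = 1"
    and u_eq: "w \<noteq> rt \<Longrightarrow> Q u w = (1 + \<theta>) * u w" and theta_pos: "\<theta> > 0"
begin

text \<open>A current towards the leaves: by \<open>flux_eq\<close>, what enters \<open>w\<close> is
  either absorbed at rate \<theta> deg u or passed on to the children. At the root the value depends
  on an unspecified \<open>par rt\<close>, hence the recurring condition
  \<open>w \<noteq> rt\<close>.\<close>

definition flux :: "'a \<Rightarrow> real" where "flux w = u (par w) - u w"

lemma flux_eq:
  assumes "w \<in> V" "w \<noteq> rt"
  shows "flux w = \<theta> * deg w * u w + (\<Sum>y\<in>children w. flux y)"
proof -
  have "(\<Sum>y | E w y. u y) = deg w * ((1 + \<theta>) * u w)" using deg_Q[of w u] u_eq[OF assms(2)] by simp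
  moreover have "(\<Sum>y | E w y. u y) = u (par w) + (\<Sum>y\<in>children w. u y)"
    using nbrs_eq[OF assms] finite_children by simp
  moreover have "deg w = 1 + real (card (children w))"
    unfolding deg_def using nbrs_eq[OF assms] finite_children by simp
  moreover have "(\<Sum>y\<in>children w. flux y) = real (card (children w)) * u w - (\<Sum>y\<in>children w. u y)"
    by (simp add: flux_def children_def sum_subtractf)
  ultimately show ?thesis by (simp add: flux_def algebra_simps)
qed

text \<open>The subtree below \<open>w\<close> can be left only through \<open>par w\<close>, so the
  elliptic maximum principle bounds \<open>u\<close> on it by \<open>u (par w)\<close>, even if the
  subtree is infinite.\<close>

lemma flux_nonneg:
  assumes "w \<in> V" "w \<noteq> rt" shows "flux w \<ge> 0"
proof -
  have "u w \<le> u (par w)"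
  proof (rule exit_function_local_bound[where D = "desc w" and \<theta> = \<theta>])
    fix v assume "v \<in> desc w"
    then have "v \<noteq> rt" using assms rt_desc by auto
    then show "Q u v = (1 + \<theta>) * u v" by (rule u_eq)
  next
    fix v y assume "v \<in> desc w" "E v y" "y \<notin> desc w"
    then show "u y \<le> u (par w)" using nbr_desc[of v w y] by auto
  qed (use assms desc_self u_nonneg u_le_1 theta_pos in auto)
  then show ?thesis by (simp add: flux_def)
qed

lemma flux_mono:
  assumes "y \<in> children w" "w \<in> V" "w \<noteq> rt" shows "flux y \<le> flux w"
proof -
  have "flux y \<le> (\<Sum>y\<in>children w. flux y)"
    using assms(1) flux_nonneg by (intro member_le_sum finite_children) (auto simp: children_def)
  also have "\<dots> \<le> flux w" using flux_eq[OF assms(2,3)] theta_pos u_nonneg[of w] by simp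
  finally show ?thesis .
qed

lemma flux_pow:
  assumes "w \<in> V" "i < depth w" shows "flux w \<le> flux ((par ^^ i) w)"
  using assms(2)
proof (induction i)
  case (Suc i)
  have p: "(par ^^ i) w \<in> V" "depth ((par ^^ i) w) = depth w - i" using par_pow[OF assms(1), of i] Suc by auto
  have p': "(par ^^ Suc i) w \<in> V" "depth ((par ^^ Suc i) w) = depth w - Suc i"
    using par_pow[OF assms(1), of "Suc i"] Suc.prems by auto
  have "(par ^^ i) w \<noteq> rt" "(par ^^ Suc i) w \<noteq> rt" using p p' Suc.prems depth_rt by auto
  then have "flux ((par ^^ i) w) \<le> flux ((par ^^ Suc i) w)"
    using p p' by (intro flux_mono) (auto simp: children_def)
  then show ?case using Suc by simp
qed simp

text \<open>The flux only grows on the way to the root, so \<open>u\<close> is convex along a branch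
  and lies above the line given by its initial slope.\<close>

lemma u_pow_ge:
  assumes "w \<in> V" "i \<le> depth w"
  shows "u ((par ^^ i) w) \<ge> u w + real i * flux w"
  using assms(2)
proof (induction i)
  case (Suc i)
  have "u ((par ^^ Suc i) w) = u ((par ^^ i) w) + flux ((par ^^ i) w)" by (simp add: flux_def)
  also have "\<dots> \<ge> u w + real i * flux w + flux w"
    using Suc flux_pow[OF assms(1), of i] by (intro add_mono) auto
  finally show ?case by (simp add: algebra_simps)
qed simp

lemma u_pow_le:
  assumes "w \<in> V" "i \<le> depth w" "\<And>j. j < i \<Longrightarrow> flux ((par ^^ j) w) \<le> C"
  shows "u ((par ^^ i) w) \<le> u w + real i * C"
  using assms(2,3)
proof (induction i)
  case (Suc i)
  have "u ((par ^^ Suc i) w) = u ((par ^^ i) w) + flux ((par ^^ i) w)" by (simp add: flux_def)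
  also have "\<dots> \<le> u w + real i * C + C" using Suc by (intro add_mono) auto
  finally show ?case by (simp add: algebra_simps)
qed simp

lemma u_desc_le:
  assumes "w \<in> desc c" shows "u w \<le> u c"
proof (cases "w = rt")
  case True then show ?thesis using assms rt_desc by auto
next
  case False
  then have "u w + real (depth w - depth c) * flux w \<le> u c"
    using u_pow_ge[OF desc_in[OF assms], of "depth w - depth c"] desc_pow[OF assms] by simp
  moreover have "real (depth w - depth c) * flux w \<ge> 0"
    using flux_nonneg[OF desc_in[OF assms] False] by simp
  ultimately show ?thesis by linarith
qed

text \<open>Unfolding \<open>flux_eq\<close> downwards collects the absorbed mass. As the subtree
  may be infinite, the sum is restricted to a finite \<open>T\<close>; what lies outside contributes
  nonnegatively and is dropped. The induction is on the number \<open>n\<close> of levels that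
  \<open>T\<close> may reach from \<open>c\<close> downwards.\<close>

lemma flux_ge:
  assumes "finite T" "c \<in> V" "c \<noteq> rt"
  shows "flux c \<ge> \<theta> * (\<Sum>w\<in>T \<inter> desc c. deg w * u w)"
proof -
  have "\<forall>c\<in>V - {rt}. (\<forall>w\<in>T. depth w < depth c + n) \<longrightarrow> \<theta> * (\<Sum>w\<in>T \<inter> desc c. deg w * u w) \<le> flux c" for n
  proof (induction n)
    case 0
    show ?case
    proof (intro ballI impI)
      fix c assume c: "c \<in> V - {rt}" "\<forall>w\<in>T. depth w < depth c + 0"
      then have "T \<inter> desc c = {}" using desc_depth by fastforce
      then show "\<theta> * (\<Sum>w\<in>T \<inter> desc c. deg w * u w) \<le> flux c" using flux_nonneg c by simp
    qed
  next
    case (Suc n)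
    show ?case
    proof (intro ballI impI)
      fix c assume c: "c \<in> V - {rt}" "\<forall>w\<in>T. depth w < depth c + Suc n"
      have "\<theta> * (\<Sum>w\<in>T \<inter> desc c. deg w * u w)
         = \<theta> * (if c \<in> T then deg c * u c else 0) + (\<Sum>y\<in>children c. \<theta> * (\<Sum>w\<in>T \<inter> desc y. deg w * u w))"
        using sum_desc[OF assms(1), of c "\<lambda>w. deg w * u w"] c
        by (simp add: distrib_left sum_distrib_left)
      also have "\<dots> \<le> \<theta> * deg c * u c + (\<Sum>y\<in>children c. flux y)"
      proof (intro add_mono sum_mono)
        show "\<theta> * (if c \<in> T then deg c * u c else 0) \<le> \<theta> * deg c * u c"
          using theta_pos u_nonneg[of c] by simp
        fix y assume y: "y \<in> children c"
        then show "\<theta> * (\<Sum>w\<in>T \<inter> desc y. deg w * u w) \<le> flux y"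
          using Suc c depth_child[OF y] by (auto simp: children_def)
      qed
      also have "\<dots> = flux c" using flux_eq c by simp
      finally show "\<theta> * (\<Sum>w\<in>T \<inter> desc c. deg w * u w) \<le> flux c" .
    qed
  qed
  moreover have "\<forall>w\<in>T. depth w < depth c + Suc (Max (depth ` T))"
    using assms(1) by (auto simp: less_Suc_eq_le trans_le_add2)
  ultimately show ?thesis using assms by blast
qed

text \<open>The same unfolding, stopped at \<open>A\<close>. Neighbours of a vertex of
  \<open>T\<close> lie in \<open>T \<union> A\<close>, so the recursion goes on until it meets a
  vertex of \<open>A\<close>, whose flux is left as it stands.\<close>

lemma flux_le:
  assumes "finite T" "finite A" "c \<in> V" "c \<noteq> rt" "c \<in> T \<union> A"
    and bd: "\<And>w y. w \<in> T \<Longrightarrow> E w y \<Longrightarrow> y \<in> T \<union> A" and TV: "A \<subseteq> V"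
  shows "flux c \<le> \<theta> * (\<Sum>w\<in>T \<inter> desc c. deg w * u w) + (\<Sum>a\<in>A \<inter> desc c. flux a)"
proof -
  have du: "\<theta> * (\<Sum>w\<in>T \<inter> desc c. deg w * u w) \<ge> 0" for c
    using theta_pos u_nonneg by (intro mult_nonneg_nonneg sum_nonneg) auto
  have fl0: "(\<Sum>a\<in>A \<inter> desc c. flux a) \<ge> 0" if "c \<in> V" "c \<noteq> rt" for c
  proof (intro sum_nonneg flux_nonneg)
    fix a assume "a \<in> A \<inter> desc c"
    then show "a \<in> V" "a \<noteq> rt" using TV that rt_desc by auto
  qed
  have inA: "flux c \<le> \<theta> * (\<Sum>w\<in>T \<inter> desc c. deg w * u w) + (\<Sum>a\<in>A \<inter> desc c. flux a)"
    if c: "c \<in> V" "c \<noteq> rt" "c \<in> A" for c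
  proof -
    have "flux c \<le> (\<Sum>a\<in>A \<inter> desc c. flux a)"
    proof (rule member_le_sum)
      show "c \<in> A \<inter> desc c" using c desc_self by auto
      fix a assume "a \<in> A \<inter> desc c - {c}"
      then show "0 \<le> flux a" using TV c rt_desc by (intro flux_nonneg) auto
    qed (use assms in auto)
    with du[of c] show ?thesis by linarith
  qed
  have "\<forall>c\<in>V - {rt}. c \<in> T \<union> A \<longrightarrow> (\<forall>w\<in>T. depth w < depth c + n) \<longrightarrow>
     flux c \<le> \<theta> * (\<Sum>w\<in>T \<inter> desc c. deg w * u w) + (\<Sum>a\<in>A \<inter> desc c. flux a)" for n
  proof (induction n)
    case 0
    show ?case using inA by auto
  next
    case (Suc n)
    show ?case
    proof (intro ballI impI)
      fix c assume c: "c \<in> V - {rt}" "c \<in> T \<union> A" "\<forall>w\<in>T. depth w < depth c + Suc n"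
      show "flux c \<le> \<theta> * (\<Sum>w\<in>T \<inter> desc c. deg w * u w) + (\<Sum>a\<in>A \<inter> desc c. flux a)"
      proof (cases "c \<in> A")
        case True then show ?thesis using inA c by auto
      next
        case False
        then have cT: "c \<in> T" using c by auto
        have "flux c = \<theta> * (deg c * u c) + (\<Sum>y\<in>children c. flux y)" using flux_eq c by simp
        also have "\<dots> \<le> \<theta> * (deg c * u c) + (\<Sum>y\<in>children c.
            \<theta> * (\<Sum>w\<in>T \<inter> desc y. deg w * u w) + (\<Sum>a\<in>A \<inter> desc y. flux a))"
        proof (intro add_left_mono sum_mono)
          fix y assume y: "y \<in> children c"
          then have "y \<in> T \<union> A" using bd[OF cT] children_subset[of c] by auto
          then show "flux y \<le> \<theta> * (\<Sum>w\<in>T \<inter> desc y. deg w * u w) + (\<Sum>a\<in>A \<inter> desc y. flux a)"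
            using Suc c depth_child[OF y] y by (auto simp: children_def)
        qed
        also have "\<dots> = \<theta> * (\<Sum>w\<in>T \<inter> desc c. deg w * u w) + (\<Sum>a\<in>A \<inter> desc c. flux a)"
          using sum_desc[OF assms(1), of c "\<lambda>w. deg w * u w"] sum_desc[OF assms(2), of c flux] c cT False
          by (simp add: distrib_left sum_distrib_left sum.distrib)
        finally show ?thesis .
      qed
    qed
  qed
  moreover have "\<forall>w\<in>T. depth w < depth c + Suc (Max (depth ` T))"
    using assms(1) by (auto simp: less_Suc_eq_le trans_le_add2)
  ultimately show ?thesis using assms by blast
qed

text \<open>The flux through any edge inside T is at most what is absorbed in T plus what leaves
  through the cut set A; the latter is small because A is small and far away from c.\<close>
lemma u_ge_of_cutset:
  assumes "finite T" "finite A" "A \<subseteq> V"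
    and bd: "\<And>w y. w \<in> T \<Longrightarrow> E w y \<Longrightarrow> y \<in> T \<union> A"
    and w: "w \<in> desc c" and wT: "\<And>j. j < depth w - depth c \<Longrightarrow> (par ^^ j) w \<in> T"
    and L: "L > 0" "\<And>a. a \<in> A \<Longrightarrow> a \<in> desc c \<Longrightarrow> L \<le> real (depth a - depth c)"
    and m: "real (card A) \<le> m" and VT: "(\<Sum>w\<in>T. deg w) \<le> VT"
    and l: "real (depth w - depth c) \<le> l"
  shows "u w \<ge> u c * (1 - l * (\<theta> * VT + m / L))"
proof -
  define C where "C = u c * (\<theta> * VT + m / L)"
  have VT0: "VT \<ge> 0" using VT sum_nonneg[of T deg] by simp
  have m0: "m \<ge> 0" using m by linarith
  have C0: "C \<ge> 0" unfolding C_def using VT0 m0 L u_nonneg theta_pos by simp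
  \<comment> \<open>By convexity along the branch, climbing from \<open>a\<close> to
    \<open>c\<close> gains at least \<open>L * flux a\<close>, and the gain cannot exceed
    \<open>u c\<close>.\<close>
  have fluxA: "flux a \<le> u c / L" if a: "a \<in> A" "a \<in> desc c" for a
  proof -
    have "u c \<ge> u a + real (depth a - depth c) * flux a"
      using u_pow_ge[OF desc_in[OF a(2)], of "depth a - depth c"] desc_pow[OF a(2)] by simp
    moreover have "L * flux a \<le> real (depth a - depth c) * flux a"
    proof (cases "a = rt")
      case True
      then have "c = rt" using a rt_desc by simp
      with True have "depth a - depth c = 0" by simp
      then show ?thesis using L(2)[OF a] L(1) by simp
    next
      case False
      then show ?thesis using L(2)[OF a] flux_nonneg[OF desc_in[OF a(2)] False] by (intro mult_right_mono)
    qed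
    ultimately have "L * flux a \<le> u c" using u_nonneg[of a] by linarith
    then show ?thesis using L(1) by (simp add: field_simps)
  qed
  have "u ((par ^^ (depth w - depth c)) w) \<le> u w + real (depth w - depth c) * C"
  proof (rule u_pow_le)
    show "w \<in> V" using desc_in[OF w] .
    fix j assume j: "j < depth w - depth c"
    define v where "v = (par ^^ j) w"
    have v: "v \<in> V" "depth v = depth w - j" using par_pow[OF desc_in[OF w], of j] j by (auto simp: v_def)
    have vrt: "v \<noteq> rt" using v j depth_rt by auto
    have vc: "v \<in> desc c"
    proof -
      have "(par ^^ (depth v - depth c)) v = (par ^^ ((depth v - depth c) + j)) w"
        by (simp add: v_def funpow_add)
      also have "(depth v - depth c) + j = depth w - depth c" using v j by simp
      finally show ?thesis using v j desc_pow[OF w] by (simp add: desc_def)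
    qed
    have "flux v \<le> \<theta> * (\<Sum>w\<in>T \<inter> desc v. deg w * u w) + (\<Sum>a\<in>A \<inter> desc v. flux a)"
      by (rule flux_le[OF assms(1,2) v(1) vrt _ bd assms(3)]) (use wT[OF j] in \<open>auto simp: v_def\<close>)
    also have "(\<Sum>w\<in>T \<inter> desc v. deg w * u w) \<le> (\<Sum>w\<in>T \<inter> desc v. deg w * u c)"
      using u_desc_le desc_trans[OF _ vc] by (intro sum_mono mult_left_mono) auto
    also have "\<dots> = (\<Sum>w\<in>T \<inter> desc v. deg w) * u c" by (simp add: sum_distrib_right)
    also have "(\<Sum>w\<in>T \<inter> desc v. deg w) \<le> (\<Sum>w\<in>T. deg w)"
      using assms(1) by (intro sum_mono2) auto
    also have "\<dots> \<le> VT" by (rule VT)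
    also have "(\<Sum>a\<in>A \<inter> desc v. flux a) \<le> (\<Sum>a\<in>A \<inter> desc v. u c / L)"
      using fluxA desc_trans[OF _ vc] by (intro sum_mono) auto
    also have "\<dots> = real (card (A \<inter> desc v)) * (u c / L)" by simp
    also have "\<dots> \<le> m * (u c / L)"
    proof (intro mult_right_mono)
      have "card (A \<inter> desc v) \<le> card A" using assms(2) by (intro card_mono) auto
      then show "real (card (A \<inter> desc v)) \<le> m" using m by linarith
    qed (use u_nonneg L in auto)
    finally show "flux ((par ^^ j) w) \<le> C"
      using theta_pos u_nonneg[of c] by (simp add: C_def v_def algebra_simps mult_left_mono mult_right_mono)
  qed simp
  also have "\<dots> \<le> u w + l * C" using l C0 by (intro add_left_mono mult_right_mono)
  finally show ?thesis using desc_pow[OF w] by (simp add: C_def algebra_simps)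
qed

end

section \<open>Connected subgraphs of the regular tree\<close>

locale tree_subgraph =
  fixes n0 :: nat and G :: "nat list set"
  assumes connected: "connectedG n0 G"
begin

abbreviation adj where "adj \<equiv> adjG n0 G"
abbreviation gd where "gd \<equiv> gdist n0 G"

lemma adj_cases: "adj x y \<Longrightarrow> (\<exists>i. x = i # y) \<or> (\<exists>i. y = i # x)"
  by (auto simp: adjG_def adjB_def)

lemma adj_in: "adj x y \<Longrightarrow> x \<in> G \<and> y \<in> G" by (simp add: adjG_def)

lemma adj_sym: "adj x y \<Longrightarrow> adj y x" by (auto simp: adjG_def adjB_def)

sublocale lf_graph adj
proof
  fix x
  show "finite {y. adj x y}"
    by (rule finite_subset[of _ "insert (tl x) ((\<lambda>i. i # x) ` {..<n0})"])
      (auto simp: adjG_def adjB_def)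
  show "\<not> adj x x" using adj_cases[of x x] by auto
qed (rule adj_sym)

lemma mu_eq_deg: "mu n0 G x = deg x"
  by (simp add: mu_def deg_def)

lemma pstep_eq: "pstep n0 G k x y = (Q ^^ k) (delta y) x"
  by (induction k arbitrary: x) (auto simp: delta_def Q_def mu_eq_deg sum_divide_distrib)

lemma qt_eq_hk: "qt n0 G t x y = hk t x y"
proof -
  have "summable (\<lambda>k. (Q ^^ k) (delta y) x * t ^ k / fact k)"
    by (rule summable_egf[of _ 1]) (rule Qk_abs_le, rule delta_bounded)
  then have "(\<Sum>k. exp (- t) * ((Q ^^ k) (delta y) x * t ^ k / fact k)) = S t (delta y) x"
    unfolding S_def egf_def by (rule suminf_mult)
  then show ?thesis
    unfolding qt_def PY_def hk_def pstep_eq mu_eq_deg by (simp add: mult_ac)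
qed

text \<open>Relational powers replace lists because concatenating and reversing walks then needs no
  index arithmetic.\<close>

lemma gpath_iff_walk:
  assumes "x \<in> G"
  shows "(\<exists>p. gpath n0 G p x y \<and> length p = Suc n) \<longleftrightarrow> (adj ^^ n) x y"
proof
  assume "\<exists>p. gpath n0 G p x y \<and> length p = Suc n"
  then obtain p where p: "gpath n0 G p x y" "length p = Suc n" by auto
  then have "p ! 0 = x" "p ! n = y" by (auto simp: gpath_def hd_conv_nth last_conv_nth)
  then show "(adj ^^ n) x y"
    unfolding relpowp_fun_conv using p by (intro exI[of _ "\<lambda>i. p ! i"]) (auto simp: gpath_def)
next
  assume "(adj ^^ n) x y"
  then obtain f where f: "f 0 = x" "f n = y" "\<And>i. i < n \<Longrightarrow> adj (f i) (f (Suc i))"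
    unfolding relpowp_fun_conv by auto
  have "f i \<in> G" if "i \<le> n" for i
    using that f(1) assms adj_in[OF f(3)] by (cases i) auto
  then have "gpath n0 G (map f [0..<Suc n]) x y"
    unfolding gpath_def using f by (auto simp: hd_map last_map nth_append simp del: upt_Suc)
  then show "\<exists>p. gpath n0 G p x y \<and> length p = Suc n" by (intro exI conjI) auto
qed

lemma gd_eq: "x \<in> G \<Longrightarrow> gd x y = (LEAST n. (adj ^^ n) x y)"
  unfolding gdist_def using gpath_iff_walk by simp

lemma walk_gd:
  assumes "x \<in> G" "y \<in> G" shows "(adj ^^ gd x y) x y"
proof -
  obtain p where p: "gpath n0 G p x y" using connected assms by (auto simp: connectedG_def)
  then have "length p = Suc (length p - 1)" by (auto simp: gpath_def)
  then have "(adj ^^ (length p - 1)) x y" using gpath_iff_walk[OF assms(1)] p by metis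
  then show ?thesis unfolding gd_eq[OF assms(1)] by (rule LeastI)
qed

lemma gd_le: "x \<in> G \<Longrightarrow> (adj ^^ n) x y \<Longrightarrow> gd x y \<le> n"
  unfolding gd_eq by (rule Least_le)

lemma walk_sym: "(adj ^^ n) x y \<Longrightarrow> (adj ^^ n) y x"
proof (induction n arbitrary: y)
  case (Suc n)
  then obtain v where "(adj ^^ n) x v" "adj v y" by auto
  then have "adj y v" "(adj ^^ n) v x" using Suc adj_sym by auto
  then show ?case by (rule relpowp_Suc_I2)
qed simp

lemma gd_sym: "x \<in> G \<Longrightarrow> y \<in> G \<Longrightarrow> gd x y = gd y x"
  using gd_le[OF _ walk_sym[OF walk_gd]] by (metis order_antisym)

lemma walk_add: "(adj ^^ m) x y \<Longrightarrow> (adj ^^ n) y z \<Longrightarrow> (adj ^^ (m + n)) x z"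
  unfolding relpowp_add by blast

lemma gd_triangle: "x \<in> G \<Longrightarrow> y \<in> G \<Longrightarrow> z \<in> G \<Longrightarrow> gd x z \<le> gd x y + gd y z"
  by (rule gd_le[OF _ walk_add[OF walk_gd walk_gd]])

lemma gd_self: "x \<in> G \<Longrightarrow> gd x x = 0" using gd_le[of x 0 x] by simp

lemma gd_eq_0: "x \<in> G \<Longrightarrow> y \<in> G \<Longrightarrow> gd x y = 0 \<longleftrightarrow> x = y"
  using walk_gd[of x y] gd_self by auto

lemma gd_adj: "z \<in> G \<Longrightarrow> adj x y \<Longrightarrow> gd z y \<le> Suc (gd z x)"
  by (rule gd_le, assumption, rule relpowp_Suc_I[OF walk_gd]) (auto dest: adj_in)

lemma walk_parity: "(adj ^^ n) x y \<Longrightarrow> even (length x + length y + n)"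
proof (induction n arbitrary: y)
  case (Suc n)
  then obtain v where v: "(adj ^^ n) x v" "adj v y" by auto
  then have "length v = Suc (length y) \<or> length y = Suc (length v)" using adj_cases[of v y] by auto
  then show ?case using Suc.IH[OF v(1)] by auto
qed simp

text \<open>Word length changes parity along every edge, so distances from \<open>z\<close> do too.
  Hence every edge joins a vertex to its parent, in one direction or the other.\<close>

lemma gd_adj_ne:
  assumes "z \<in> G" "adj x y" shows "gd z x \<noteq> gd z y"
proof
  assume e: "gd z x = gd z y"
  have "x \<in> G" "y \<in> G" using adj_in assms by auto
  then have "even (length z + length x + gd z x)" "even (length z + length y + gd z y)"
    using walk_parity walk_gd assms by auto
  moreover have "length x = Suc (length y) \<or> length y = Suc (length x)" using adj_cases[OF assms(2)] by auto
  ultimately show False using e by auto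
qed

section \<open>Branches at a vertex and re-rooting the tree\<close>

lemma walk_suffix_below:
  assumes "\<And>i. i \<le> k \<Longrightarrow> f i \<noteq> w" "\<And>i. i < k \<Longrightarrow> adj (f i) (f (Suc i))" "suffix (a # w) (f 0)"
  shows "suffix (a # w) (f k)"
  using assms
proof (induction k)
  case (Suc k)
  then have IH: "suffix (a # w) (f k)" by simp
  have "f (Suc k) \<noteq> w" "adj (f k) (f (Suc k))" using Suc by auto
  then show ?case using IH adj_cases[of "f k" "f (Suc k)"] by (auto simp: suffix_Cons)
qed simp

lemma walk_not_suffix:
  assumes "\<And>i. i \<le> k \<Longrightarrow> f i \<noteq> w" "\<And>i. i < k \<Longrightarrow> adj (f i) (f (Suc i))" "\<not> suffix w (f 0)"
  shows "\<not> suffix w (f k)"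
  using assms
proof (induction k)
  case (Suc k)
  then have IH: "\<not> suffix w (f k)" by simp
  have "f (Suc k) \<noteq> w" "adj (f k) (f (Suc k))" using Suc by auto
  then show ?case using IH adj_cases[of "f k" "f (Suc k)"] by (auto simp: suffix_Cons)
qed simp

lemma closer_nbr_walk:
  assumes "z \<in> G" "adj w y" "gd z y < gd z w"
  obtains k f where "f 0 = y" "f k = z" "\<And>i. i \<le> k \<Longrightarrow> f i \<noteq> w" "\<And>i. i < k \<Longrightarrow> adj (f i) (f (Suc i))"
proof -
  have y: "y \<in> G" using adj_in assms by auto
  from walk_gd[OF y assms(1)] obtain f where
    f: "f 0 = y" "f (gd y z) = z" "\<And>i. i < gd y z \<Longrightarrow> adj (f i) (f (Suc i))"
    unfolding relpowp_fun_conv by auto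
  have "f i \<noteq> w" if i: "i \<le> gd y z" for i
  proof
    assume w: "f i = w"
    have "(adj ^^ (gd y z - i)) w z"
      unfolding relpowp_fun_conv using f i w by (intro exI[of _ "\<lambda>j. f (i + j)"]) auto
    then have "gd z w \<le> gd y z - i" using gd_le[OF assms(1)] walk_sym by blast
    then show False using assms gd_sym[OF y assms(1)] by simp
  qed
  with f that show ?thesis by blast
qed

text \<open>The branches of B at \<open>w\<close> are the sets of words with a given suffix
  \<open>i # w\<close> and the set of words without suffix \<open>w\<close>. A geodesic from a
  closer neighbour to \<open>z\<close> avoids \<open>w\<close>, hence stays in the branch of that
  neighbour, and \<open>z\<close> lies in one branch only.\<close>

lemma closer_nbr_unique:
  assumes z: "z \<in> G" and y: "adj w y" "gd z y < gd z w" and y': "adj w y'" "gd z y' < gd z w"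
  shows "y = y'"
proof -
  have up: "suffix (i # w) z" if "y = i # w" "adj w y" "gd z y < gd z w" for i y
    using closer_nbr_walk[OF z that(2,3)] walk_suffix_below[of _ _ w i] that(1)
    by (metis suffix_order.order_refl)
  have dn: "\<not> suffix w z" if "w = i # y" "adj w y" "gd z y < gd z w" for i y
  proof -
    have "\<not> suffix w y" using that(1) suffix_length_le by force
    then show ?thesis
      using closer_nbr_walk[OF z that(2,3)] walk_not_suffix[of _ _ w] by metis
  qed
  show ?thesis
    using adj_cases[OF y(1)] adj_cases[OF y'(1)]
  proof (elim disjE exE)
    fix i j assume "w = i # y" "y' = j # w"
    then show ?thesis using dn[OF _ y] up[OF _ y'] by (auto dest: suffix_ConsD)
  next
    fix i j assume "y = i # w" "w = j # y'"
    then show ?thesis using dn[OF _ y'] up[OF _ y] by (auto dest: suffix_ConsD)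
  next
    fix i j assume a: "y = i # w" "y' = j # w"
    then have "suffix y z" "suffix y' z" using up[OF _ y] up[OF _ y'] by auto
    then show ?thesis using a by (metis length_Cons suffix_length_suffix suffix_order.antisym order_refl)
  qed simp
qed

text \<open>For \<open>w \<noteq> z\<close> the choice is unique by
  \<open>closer_nbr_unique\<close>; the value at \<open>z\<close> is a default.\<close>

definition parent :: "nat list \<Rightarrow> nat list \<Rightarrow> nat list" where
  "parent z w = (if w = z then z else (SOME y. adj w y \<and> gd z y < gd z w))"

lemma parent_ex:
  assumes "z \<in> G" "w \<in> G" "w \<noteq> z"
  shows "adj w (parent z w) \<and> gd z (parent z w) < gd z w"
proof -
  have "gd z w \<noteq> 0" using gd_eq_0 assms by metis
  then obtain n where n: "gd z w = Suc n" using not0_implies_Suc by blast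
  then have "(adj ^^ Suc n) z w" using walk_gd[OF assms(1,2)] by simp
  then obtain y where "(adj ^^ n) z y" "adj y w" by auto
  then have "adj w y \<and> gd z y < gd z w" using gd_le[OF assms(1)] n adj_sym by (metis le_imp_less_Suc)
  then have "\<exists>y. adj w y \<and> gd z y < gd z w" by blast
  then show ?thesis unfolding parent_def if_not_P[OF assms(3)] by (rule someI_ex)
qed

lemma rooted_tree_at:
  assumes z: "z \<in> G"
  shows "rooted_tree adj G z (parent z) (gd z)"
proof unfold_locales
  show "gd z z = 0" using gd_self z by simp
  fix w
  assume w: "w \<in> G"
  {
    assume ne: "w \<noteq> z"
    from parent_ex[OF z w ne] have p: "adj w (parent z w)" "gd z (parent z w) < gd z w" by auto
    then show "parent z w \<in> G" "adj w (parent z w)" using adj_in by auto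
    show "gd z w = Suc (gd z (parent z w))"
      using p gd_adj[OF z adj_sym[OF p(1)]] by simp
  }
  fix y assume wy: "adj w y"
  then show y: "y \<in> G" using adj_in by auto
  show "(w \<noteq> z \<and> y = parent z w) \<or> (y \<noteq> z \<and> parent z y = w)"
  proof (cases "gd z y < gd z w")
    case True
    then have "w \<noteq> z" using gd_self[OF z] by auto
    with parent_ex[OF z w] closer_nbr_unique[OF z wy True] show ?thesis by metis
  next
    case False
    then have lt: "gd z w < gd z y" using gd_adj_ne[OF z wy] by simp
    then have "y \<noteq> z" using gd_self[OF z] by auto
    with parent_ex[OF z y] closer_nbr_unique[OF z adj_sym[OF wy] lt] show ?thesis by metis
  qed
qed (rule z)

lemma finite_gball:
  assumes "z \<in> G" shows "finite (gball n0 G z r)"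
proof -
  have fin: "finite {y. (adj ^^ k) z y}" for k
  proof (induction k)
    case (Suc k)
    have "{y. (adj ^^ Suc k) z y} \<subseteq> (\<Union>v\<in>{y. (adj ^^ k) z y}. {y. adj v y})" by auto
    then show ?case by (rule finite_subset) (use Suc finite_nbrs in auto)
  qed simp
  have "gball n0 G z r \<subseteq> (\<Union>k\<le>nat \<lfloor>r\<rfloor>. {y. (adj ^^ k) z y})"
  proof
    fix y assume "y \<in> gball n0 G z r"
    then have y: "y \<in> G" "real (gd z y) \<le> r" by (auto simp: gball_def)
    then have "gd z y \<le> nat \<lfloor>r\<rfloor>" by linarith
    then show "y \<in> (\<Union>k\<le>nat \<lfloor>r\<rfloor>. {y. (adj ^^ k) z y})" using walk_gd[OF assms y(1)] by auto
  qed
  then show ?thesis using fin by (auto intro: finite_subset)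
qed

lemma Vol_eq: "Vol n0 G z r = (\<Sum>w\<in>gball n0 G z r. deg w)"
  by (simp add: Vol_def muset_def mu_eq_deg)

lemma hk_on_diagonal_Vol:
  assumes z: "z \<in> G" "deg z > 0" and "\<rho> > 0" "s > 0" "v > 0" "Vol n0 G z \<rho> \<ge> v"
  shows "hk s z z \<le> max (2 / v) (4 * \<rho> / s)"
proof -
  interpret rooted_tree adj G z "parent z" "gd z" by (rule rooted_tree_at[OF z(1)])
  have "hk s z z \<le> max (2 / Vol n0 G z \<rho>) (4 * \<rho> / s)"
  proof (rule hk_on_diagonal[OF finite_gball[OF z(1)] z(2) assms(3,4) Vol_eq[symmetric]])
    fix w assume "w \<in> gball n0 G z \<rho>"
    then have w: "w \<in> G" "real (gd z w) \<le> \<rho>" by (auto simp: gball_def)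
    define p where "p i = (parent z ^^ (gd z w - i)) w" for i
    have pi: "p i \<in> G" "i \<le> gd z w \<Longrightarrow> gd z (p i) = i" for i
      using par_pow[OF w(1), of "gd z w - i"] by (auto simp: p_def)
    have "p 0 = z" using pi[of 0] gd_eq_0[OF z(1), of "p 0"] by auto
    moreover have "p (gd z w) = w" by (simp add: p_def)
    moreover have "inj_on p {..gd z w}" using pi(2) by (intro inj_onI) (metis atMost_iff)
    moreover have "adj (p i) (p (Suc i))" if "i < gd z w" for i
    proof -
      have "p (Suc i) \<noteq> z" using pi(2)[of "Suc i"] that gd_self[OF z(1)] by auto
      then have "adj (p (Suc i)) (parent z (p (Suc i)))" using par_nbr pi(1) by auto
      moreover have "parent z (p (Suc i)) = (parent z ^^ Suc (gd z w - Suc i)) w" by (simp add: p_def)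
      moreover have "Suc (gd z w - Suc i) = gd z w - i" using that by simp
      ultimately show ?thesis using adj_sym by (simp add: p_def)
    qed
    ultimately show "\<exists>p d. p 0 = z \<and> p d = w \<and> real d \<le> \<rho> \<and> inj_on p {..d} \<and> (\<forall>i<d. adj (p i) (p (Suc i)))"
      using w(2) by blast
  qed (use assms in linarith)
  also have "\<dots> \<le> max (2 / v) (4 * \<rho> / s)"
    using assms by (intro max.mono divide_left_mono) auto
  finally show ?thesis .
qed

text \<open>Every step of a geodesic towards \<open>z\<close> goes to the unique closer neighbour.
  In the tree rooted at \<open>z\<close> the geodesic is thus the chain of ancestors of
  \<open>x\<close>, and a point on it is located by its number of steps from
  \<open>x\<close>.\<close>

lemma geod_parent:
  assumes z: "z \<in> G" and x: "x \<in> G" and w: "w \<in> geod n0 G x z"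
  shows "\<exists>j\<le>gd z x. w = (parent z ^^ j) x"
proof -
  interpret rooted_tree adj G z "parent z" "gd z" by (rule rooted_tree_at[OF z])
  from w obtain p where p: "gpath n0 G p x z" "length p = Suc (gd x z)" "w \<in> set p"
    by (auto simp: geod_def)
  define d where "d = gd z x"
  have len: "length p = Suc d" using p(2) gd_sym x z by (simp add: d_def)
  have p0: "p ! 0 = x" "p ! d = z" using p(1) len by (auto simp: gpath_def hd_conv_nth last_conv_nth)
  have padj: "adj (p ! i) (p ! Suc i)" if "i < d" for i using p(1) len that by (auto simp: gpath_def)
  have pin: "p ! i \<in> G" if "i \<le> d" for i using p(1) len that by (auto simp: gpath_def subset_iff)
  have le: "gd z (p ! i) \<le> d - i" if "i \<le> d" for i
  proof -
    have "(adj ^^ (d - i)) (p ! i) z"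
      unfolding relpowp_fun_conv using p0 padj that by (intro exI[of _ "\<lambda>j. p ! (i + j)"]) auto
    then show ?thesis using gd_le[OF z] walk_sym by blast
  qed
  have "p ! i = (parent z ^^ i) x" if "i \<le> d" for i
    using that
  proof (induction i)
    case (Suc i)
    then have IH: "p ! i = (parent z ^^ i) x" by simp
    then have dp: "gd z (p ! i) = d - i" using par_pow[OF x, of i] Suc.prems by (simp add: d_def)
    then have lt: "gd z (p ! Suc i) < gd z (p ! i)" using le[of "Suc i"] Suc.prems by simp
    have ne: "p ! i \<noteq> z" using dp Suc.prems gd_self[OF z] by auto
    have "p ! Suc i = parent z (p ! i)"
      using closer_nbr_unique[OF z padj lt] parent_ex[OF z pin ne] Suc.prems by auto
    then show ?case using IH by simp
  qed (simp add: p0)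
  moreover obtain i where "i \<le> d" "w = p ! i" using p(3) len by (auto simp: in_set_conv_nth less_Suc_eq_le)
  ultimately show ?thesis by (auto simp: d_def)
qed

lemma geod_sym:
  assumes "x \<in> G" "y \<in> G" shows "geod n0 G x y \<subseteq> geod n0 G y x"
proof
  fix w assume "w \<in> geod n0 G x y"
  then obtain p where p: "gpath n0 G p x y" "length p = Suc (gd x y)" "w \<in> set p" by (auto simp: geod_def)
  have "gpath n0 G (rev p) y x"
    unfolding gpath_def
  proof (intro conjI allI impI)
    fix i assume i: "Suc i < length (rev p)"
    define j where "j = length p - Suc (Suc i)"
    have j: "Suc j < length p" "rev p ! i = p ! Suc j" "rev p ! Suc i = p ! j"
      using i by (auto simp: j_def rev_nth Suc_diff_Suc)
    then have "adj (p ! j) (p ! Suc j)" using p by (auto simp: gpath_def)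
    then show "adj (rev p ! i) (rev p ! Suc i)" using adj_sym j by simp
  qed (use p in \<open>auto simp: gpath_def hd_rev last_rev\<close>)
  then show "w \<in> geod n0 G y x" unfolding geod_def using p gd_sym assms by (intro CollectI exI[of _ "rev p"]) auto
qed

lemma geod_split:
  assumes "x \<in> G" "y \<in> G" "w \<in> geod n0 G x y" shows "w \<in> G" "gd x w + gd w y \<le> gd x y"
proof -
  from assms obtain p where p: "gpath n0 G p x y" "length p = Suc (gd x y)" "w \<in> set p" by (auto simp: geod_def)
  then show w: "w \<in> G" by (auto simp: gpath_def)
  obtain i where i: "i \<le> gd x y" "w = p ! i" using p(2,3) by (auto simp: in_set_conv_nth less_Suc_eq_le)
  have "p \<noteq> []" "hd p = x" "last p = y" using p(1) by (auto simp: gpath_def)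
  then have p0: "p ! 0 = x" "p ! (gd x y) = y" using p(2) by (metis hd_conv_nth, metis diff_Suc_1 last_conv_nth)
  have padj: "adj (p ! i) (p ! Suc i)" if "i < gd x y" for i using p that by (auto simp: gpath_def)
  have "(adj ^^ i) x w" unfolding relpowp_fun_conv using p0 i padj by (intro exI[of _ "\<lambda>j. p ! j"]) auto
  moreover have "(adj ^^ (gd x y - i)) w y"
    unfolding relpowp_fun_conv using p0 padj i by (intro exI[of _ "\<lambda>j. p ! (i + j)"]) auto
  ultimately show "gd x w + gd w y \<le> gd x y" using gd_le assms w i by (metis add_mono le_add_diff_inverse)
qed

end

section \<open>Growth of the exit function along good balls\<close>

lemma cumulative_growth:
  fixes U :: "nat \<Rightarrow> real"
  assumes s: "0 \<le> \<sigma>" "\<sigma> \<le> 1" and U0: "\<And>m. m \<le> M \<Longrightarrow> U m \<ge> 0"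
    and step: "\<And>m. m \<le> M \<Longrightarrow> U (Suc m) \<ge> U m + \<sigma>\<^sup>2 * (\<Sum>l\<le>m. U l)"
  shows "U (Suc M) \<ge> \<sigma> * (1 + \<sigma>) ^ M * U 0"
proof -
  \<comment> \<open>The recurrence is a discrete U'' = \<sigma>^2 U with U' given by \<sigma>^2
    times the running sum. \<open>\<Phi>\<close> plays the role of U + U' / \<sigma>, the
    combination that gains a factor \<open>1 + \<sigma>\<close> at every step.\<close>
  define \<Phi> where "\<Phi> m = U m + \<sigma> * (\<Sum>l\<le>m. U l)" for m
  have "\<Phi> m \<ge> (1 + \<sigma>) ^ m * U 0" if "m \<le> M" for m
    using that
  proof (induction m)
    case 0
    then show ?case using s U0[of 0] by (simp add: \<Phi>_def)
  next
    case (Suc m)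
    have step': "U (Suc m) \<ge> U m + \<sigma>\<^sup>2 * (\<Sum>l\<le>m. U l)" using step Suc.prems by simp
    have "0 \<le> \<sigma>\<^sup>2 * (\<Sum>l\<le>m. U l)"
      using U0 Suc.prems by (intro mult_nonneg_nonneg sum_nonneg) auto
    then have "\<sigma> * U m \<le> \<sigma> * U (Suc m)" using step' s by (intro mult_left_mono) auto
    then have "\<Phi> (Suc m) \<ge> (1 + \<sigma>) * \<Phi> m"
      using step' by (simp add: \<Phi>_def algebra_simps power2_eq_square)
    moreover have "(1 + \<sigma>) * \<Phi> m \<ge> (1 + \<sigma>) * ((1 + \<sigma>) ^ m * U 0)"
      using Suc s by (intro mult_left_mono) auto
    ultimately show ?case by simp
  qed
  from this[of M] have "\<sigma> * ((1 + \<sigma>) ^ M * U 0) \<le> \<sigma> * \<Phi> M" using s by (intro mult_left_mono) auto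
  also have "\<sigma> * \<Phi> M = \<sigma> * U M + \<sigma>\<^sup>2 * (\<Sum>l\<le>M. U l)"
    by (simp add: \<Phi>_def algebra_simps power2_eq_square)
  also have "\<dots> \<le> U M + \<sigma>\<^sup>2 * (\<Sum>l\<le>M. U l)"
    using s U0[of M] mult_right_mono[of \<sigma> 1 "U M"] by simp
  also have "\<dots> \<le> U (Suc M)" using step by simp
  finally show ?thesis by (simp add: mult.assoc)
qed

text \<open>\<open>Mcut\<close> is an infimum; the strict room between \<open>b\<close> and
  \<open>b'\<close> produces a cut set without a discussion of whether the infimum is
  attained.\<close>

lemma Mcut_cutset:
  assumes "Mcut n0 G z r \<le> ereal b" "b < b'"
  obtains A where "cutset n0 G z r A" "real (card A) < b'"
proof -
  have "Mcut n0 G z r < ereal b'" using assms by (meson ereal_less_eq(3) le_less_trans less_ereal.simps(1))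
  then show ?thesis unfolding Mcut_def Inf_less_iff using that by auto
qed

context tree_subgraph
begin

lemma walk_par:
  assumes z: "z \<in> G" and w: "w \<in> G" and j: "j \<le> gd z w"
  shows "(adj ^^ j) w ((parent z ^^ j) w)"
  using j
proof (induction j)
  case (Suc j)
  interpret rooted_tree adj G z "parent z" "gd z" by (rule rooted_tree_at[OF z])
  have p: "(parent z ^^ j) w \<in> G" "gd z ((parent z ^^ j) w) = gd z w - j"
    using par_pow[OF w, of j] Suc.prems by auto
  then have "(parent z ^^ j) w \<noteq> z" using Suc.prems gd_self[OF z] by auto
  then have "adj ((parent z ^^ j) w) (parent z ((parent z ^^ j) w))" using par_nbr p(1) by blast
  then show ?case using relpowp_Suc_I[of j adj w "(parent z ^^ j) w"] Suc by simp
qed simp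

lemma gd_par:
  assumes "z \<in> G" "w \<in> G" "j \<le> gd z w"
  shows "gd w ((parent z ^^ j) w) \<le> j"
  by (rule gd_le[OF assms(2) walk_par[OF assms]])

text \<open>The reference point is the \<open>k\<close>-th ancestor of the centre because the whole
  small ball lies below it, so that the flux above it collects the entire ball. On the climb from a
  point of the ball to that ancestor, the volume bound and the small cut set keep the flux so low
  that \<open>u\<close> at most doubles.\<close>

lemma u_ge_half_on_good_ball:
  assumes ex: "tree_exit adj G z0 (parent z0) (gd z0) u \<theta>"
    and z: "z \<in> G" and r: "r > 0" and good: "good n0 G lam z r"
    and th: "\<theta> * r ^ 3 \<le> 3 / 32"
    and k: "real k \<le> r / lam" "r / lam < real k + 1" "k \<le> gd z0 z"
    and w: "w \<in> gball n0 G z (r / lam)"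
  shows "w \<in> rooted_tree.desc G (parent z0) (gd z0) ((parent z0 ^^ k) z)"
    "u w \<ge> u ((parent z0 ^^ k) z) / 2"
proof -
  interpret tree_exit adj G z0 "parent z0" "gd z0" u \<theta> by (rule ex)
  have lam: "lam \<ge> 64" using good by (simp add: good_def)
  have rl: "r / lam \<le> r / 64" using lam r by (intro divide_left_mono) auto
  have z0: "z0 \<in> G" by (rule rt_in)
  define c where "c = (parent z0 ^^ k) z"
  have c: "c \<in> G" "gd z0 c = gd z0 z - k" using par_pow[OF z k(3)] by (auto simp: c_def)
  have wG: "w \<in> G" and dw: "gd z w \<le> k" using w k(2) by (auto simp: gball_def)
  define m where "m = gd z w"
  have m: "m \<le> k" using dw by (simp add: m_def)
  have "w \<in> desc ((parent z0 ^^ m) z)"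
    using walk_desc[OF z, of m w] walk_gd[OF z wG] m k(3) by (simp add: m_def)
  moreover have "(parent z0 ^^ m) z \<in> desc c"
  proof -
    have p: "(parent z0 ^^ m) z \<in> G" "gd z0 ((parent z0 ^^ m) z) = gd z0 z - m"
      using par_pow[OF z, of m] m k(3) by auto
    have "(parent z0 ^^ (k - m)) ((parent z0 ^^ m) z) = (parent z0 ^^ ((k - m) + m)) z"
      by (simp add: funpow_add)
    also have "\<dots> = c" using m by (simp add: c_def)
    finally show ?thesis using pow_desc[OF p(1), of "k - m"] p(2) m k(3) by simp
  qed
  ultimately have wc: "w \<in> desc c" by (rule desc_trans)
  then show "w \<in> desc ((parent z0 ^^ k) z)" by (simp add: c_def)
  obtain A where A: "cutset n0 G z r A" and cA: "real (card A) < lam / 32"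
    using Mcut_cutset[of n0 G z r "lam / 64" "lam / 32"] good lam by (auto simp: good_def)
  have Ad: "\<And>a. a \<in> A \<Longrightarrow> a \<in> G \<and> r / 4 \<le> real (gd z a)" and fA: "finite A"
    using A by (auto simp: cutset_def)
  \<comment> \<open>What can be reached from the centre without touching \<open>A\<close>. The cut
    set confines it to the ball of radius \<open>r\<close>, so it is finite with volume at most
    \<open>r^2 * lam\<close>, and edges leaving it end in \<open>A\<close>.\<close>
  define T where "T = {v. \<exists>p. gpath n0 G p z v \<and> set p \<inter> A = {}}"
  have TG: "T \<subseteq> G"
  proof
    fix v assume "v \<in> T"
    then obtain p where "gpath n0 G p z v" by (auto simp: T_def)
    then have "v = last p" "p \<noteq> []" "set p \<subseteq> G" by (auto simp: gpath_def)
    then show "v \<in> G" using last_in_set by blast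
  qed
  then have Tball: "T \<subseteq> gball n0 G z r" using A by (force simp: T_def cutset_def)
  have fT: "finite T" using finite_subset[OF Tball finite_gball[OF z]] .
  have Tnbr: "y \<in> T \<union> A" if v: "v \<in> T" and vy: "adj v y" for v y
  proof (rule UnCI)
    assume y: "y \<notin> A"
    obtain p where p: "gpath n0 G p z v" "set p \<inter> A = {}" using v by (auto simp: T_def)
    have "gpath n0 G (p @ [y]) z y"
      unfolding gpath_def
    proof (intro conjI allI impI)
      fix i assume i: "Suc i < length (p @ [y])"
      show "adj ((p @ [y]) ! i) ((p @ [y]) ! Suc i)"
      proof (cases "Suc i < length p")
        case True
        then show ?thesis using p(1) by (auto simp: gpath_def nth_append)
      next
        case False
        then have "Suc i = length p" using i by simp
        then have "i = length p - 1" "i < length p" by auto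
        moreover have "p ! (length p - 1) = v" using p(1) by (auto simp: gpath_def last_conv_nth)
        ultimately show ?thesis using vy \<open>Suc i = length p\<close> by (simp add: nth_append)
      qed
    qed (use p(1) adj_in[OF vy] in \<open>auto simp: gpath_def\<close>)
    then show "y \<in> T" using p(2) y by (auto simp: T_def intro!: exI[of _ "p @ [y]"])
  qed
  \<comment> \<open>\<open>A\<close> keeps distance r/4 from the centre, while the climb from
    \<open>w\<close> to the ancestor \<open>c\<close> stays within 3 k \<le> 3 r / 64 of it.\<close>
  have close: "v \<in> T" if v: "v \<in> G" "real (gd z v) < r / 4" for v
  proof -
    obtain p where p: "gpath n0 G p z v" "length p = Suc (gd z v)"
      using gpath_iff_walk[OF z] walk_gd[OF z v(1)] by blast
    have "a \<notin> A" if a: "a \<in> set p" for a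
    proof
      assume "a \<in> A"
      have "a \<in> geod n0 G z v" using p a by (auto simp: geod_def)
      then have "gd z a \<le> gd z v" using geod_split(2)[OF z v(1)] by fastforce
      then show False using Ad[OF \<open>a \<in> A\<close>] v(2) by linarith
    qed
    then show ?thesis using p(1) by (auto simp: T_def)
  qed
  have dwc: "gd z0 w - gd z0 c \<le> 2 * k"
    using gd_triangle[OF z0 z wG] dw c(2) by simp
  \<comment> \<open>The climb is at most 2 r / lam: \<open>w\<close> is at most \<open>k\<close>
    levels below the centre and \<open>c\<close> is \<open>k\<close> above it. The distance r/5 from
    \<open>c\<close> to \<open>A\<close> comes from 1/4 - 1/64 > 1/5. The cut term equals 2 * 5 / 32
    = 5/16, and \<theta> r^3 \<le> 3/32 brings the total to at most 1/2.\<close>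
  have "u w \<ge> u c * (1 - (2 * (r / lam)) * (\<theta> * (r^2 * lam) + (lam / 32) / (r / 5)))"
  proof (rule u_ge_of_cutset[OF fT fA _ Tnbr wc])
    show "A \<subseteq> G" using Ad by auto
    fix j assume j: "j < gd z0 w - gd z0 c"
    have jw: "j \<le> gd z0 w" using j by simp
    have pj: "(parent z0 ^^ j) w \<in> G" using par_pow[OF wG jw] by simp
    have "gd z ((parent z0 ^^ j) w) \<le> gd z w + gd w ((parent z0 ^^ j) w)"
      by (rule gd_triangle[OF z wG pj])
    also have "\<dots> \<le> k + 2 * k" using dw gd_par[OF z0 wG jw] j dwc by linarith
    finally have "real (gd z ((parent z0 ^^ j) w)) \<le> 3 * real k" by linarith
    also have "\<dots> < r / 4" using k(1) rl r by linarith
    finally show "(parent z0 ^^ j) w \<in> T" by (rule close[OF pj])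
  next
    fix a assume a: "a \<in> A" "a \<in> desc c"
    have aG: "a \<in> G" using Ad a by auto
    have "gd a c \<le> gd z0 a - gd z0 c"
      using gd_par[OF z0 aG, of "gd z0 a - gd z0 c"] desc_pow[OF a(2)] by simp
    moreover have "gd z a \<le> gd z c + gd c a" by (rule gd_triangle[OF z c(1) aG])
    moreover have "gd z c \<le> k" using gd_par[OF z0 z k(3)] by (simp add: c_def)
    ultimately have "gd z a \<le> k + (gd z0 a - gd z0 c)" using gd_sym[OF aG c(1)] by simp
    then have "real (gd z a) \<le> real k + real (gd z0 a - gd z0 c)" by linarith
    then show "r / 5 \<le> real (gd z0 a - gd z0 c)" using Ad[OF a(1)] k(1) rl r by linarith
  next
    have "(\<Sum>w\<in>T. deg w) \<le> Vol n0 G z r"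
      unfolding Vol_eq by (rule sum_mono2[OF finite_gball[OF z] Tball]) auto
    then show "(\<Sum>w\<in>T. deg w) \<le> r^2 * lam" using good by (simp add: good_def)
    show "real (gd z0 w - gd z0 c) \<le> 2 * (r / lam)" using dwc k(1) by linarith
  qed (use r cA in auto)
  also have "(2 * (r / lam)) * (\<theta> * (r^2 * lam) + (lam / 32) / (r / 5)) = 2 * (\<theta> * r ^ 3) + 5 / 16"
    using r lam by (simp add: field_simps power2_eq_square power3_eq_cube)
  finally have "u w \<ge> u c * (1 - (2 * (\<theta> * r ^ 3) + 5 / 16))" .
  moreover have "u c * (1 - (2 * (\<theta> * r ^ 3) + 5 / 16)) \<ge> u c * (1 / 2)"
    using th u_nonneg by (intro mult_left_mono) auto
  ultimately show "u w \<ge> u ((parent z0 ^^ k) z) / 2" by (simp add: c_def)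
qed

text \<open>The centres are ordered by their number of steps from \<open>x\<close>, and U_m is the
  value of \<open>u\<close> at the point \<open>k\<close> steps beyond the m-th centre. The flux
  there collects the small balls 0, ..., m, and the next such point is more than \<open>r\<close>
  steps further on.\<close>

lemma u_le_of_good_balls:
  assumes ex: "tree_exit adj G z0 (parent z0) (gd z0) u \<theta>"
    and x: "x \<in> G" and r: "r > 0" and lam: "lam \<ge> 64"
    and Z: "finite Z" "Z \<subseteq> geod n0 G x z0" "card Z \<ge> 3"
    and disj: "\<And>z z'. z \<in> Z \<Longrightarrow> z' \<in> Z \<Longrightarrow> z \<noteq> z' \<Longrightarrow> gball n0 G z r \<inter> gball n0 G z' r = {}"
    and good: "\<And>z. z \<in> Z \<Longrightarrow> good n0 G lam z r"
    and th: "\<theta> * r ^ 3 = 2 * lam ^ 4 * \<sigma>\<^sup>2" "2 * lam ^ 4 * \<sigma>\<^sup>2 \<le> 3 / 32" and s: "0 < \<sigma>" "\<sigma> \<le> 1"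
  shows "\<sigma> * (1 + \<sigma>) ^ (card Z - 3) * u x \<le> 1"
proof -
  interpret tree_exit adj G z0 "parent z0" "gd z0" u \<theta> by (rule ex)
  have z0: "z0 \<in> G" by (rule rt_in)
  define v where "v j = (parent z0 ^^ j) x" for j
  define d where "d = gd z0 x"
  define n where "n = card Z"
  define I where "I = {j. j \<le> d \<and> v j \<in> Z}"
  define k where "k = nat \<lfloor>r / lam\<rfloor>"
  have vj: "v j \<in> G" "gd z0 (v j) = d - j" if "j \<le> d" for j
    using par_pow[OF x] that by (auto simp: v_def d_def)
  have vv: "(parent z0 ^^ i) (v j) = v (j + i)" for i j
    by (simp add: v_def funpow_add[symmetric, THEN fun_cong, simplified comp_apply] add.commute)
  have k: "real k \<le> r / lam" "r / lam < real k + 1"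
  proof -
    have "0 \<le> r / lam" using r lam by simp
    then show "real k \<le> r / lam" "r / lam < real k + 1" unfolding k_def by linarith+
  qed
  have kr: "real k < r"
  proof -
    have "r / lam < r / 1" using r lam by (intro divide_strict_left_mono) auto
    then show ?thesis using k by simp
  qed
  have "Z = v ` I"
  proof
    show "Z \<subseteq> v ` I"
    proof
      fix z assume z: "z \<in> Z"
      then obtain j where "j \<le> d" "z = v j"
        using geod_parent[OF z0 x] Z(2) unfolding v_def d_def by blast
      then show "z \<in> v ` I" using z by (auto simp: I_def)
    qed
  qed (auto simp: I_def)
  moreover have "inj_on v I"
  proof (rule inj_onI)
    fix i j assume "i \<in> I" "j \<in> I" "v i = v j"
    then have "d - i = d - j" "i \<le> d" "j \<le> d" using vj(2)[of i] vj(2)[of j] by (auto simp: I_def)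
    then show "i = j" by simp
  qed
  ultimately have cI: "card I = n" by (simp add: n_def card_image)
  have fI: "finite I" by (rule finite_subset[of _ "{..d}"]) (auto simp: I_def)
  obtain e :: "nat \<Rightarrow> nat" where e: "strict_mono_on {..<n} e" "\<And>m. m < n \<Longrightarrow> e m \<in> I"
    using finite_enumerate[OF fI] cI by auto
  have ed: "e m \<le> d" "v (e m) \<in> Z" if "m < n" for m using e(2)[OF that] by (auto simp: I_def)
  \<comment> \<open>Otherwise the second centre would lie in both balls of radius
    \<open>r\<close>.\<close>
  have gap: "r < real (e m') - real (e m)" if "m < m'" "m' < n" for m m'
  proof (rule ccontr)
    assume neg: "\<not> ?thesis"
    have lt: "e m < e m'" using strict_mono_onD[OF e(1)] that by auto
    have le: "e m' - e m \<le> gd z0 (v (e m))" using vj[of "e m"] ed[of m] ed[of m'] that by simp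
    have "gd (v (e m)) (v (e m')) \<le> e m' - e m"
      using gd_par[OF z0 vj(1) le] vv[of "e m' - e m" "e m"] ed[of m] that lt by simp
    then have "v (e m') \<in> gball n0 G (v (e m)) r"
      using neg lt vj(1) ed[of m'] that by (auto simp: gball_def)
    moreover have "v (e m') \<in> gball n0 G (v (e m')) r"
      using vj(1) ed[of m'] that r gd_self by (auto simp: gball_def)
    moreover have "v (e m) \<noteq> v (e m')"
    proof
      assume "v (e m) = v (e m')"
      then have "d - e m = d - e m'" using vj(2)[of "e m"] vj(2)[of "e m'"] ed[of m] ed[of m'] that by simp
      then show False using lt ed[of m'] that by linarith
    qed
    ultimately show False using disj[OF ed(2) ed(2), of m m'] that by auto
  qed
  have ek: "e m + k \<le> e m'" if "m < m'" "m' < n" for m m'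
    using gap[OF that] kr by linarith
  define c where "c m = v (e m + k)" for m
  define U where "U m = u (c m)" for m
  define B where "B m = gball n0 G (v (e m)) (r / lam)" for m
  have n3: "n \<ge> 3" using Z by (simp add: n_def)
  have ball: "w \<in> desc (c m)" "u w \<ge> U m / 2" if m: "Suc m < n" and w: "w \<in> B m" for m w
  proof -
    have zz: "v (e m) \<in> G" "k \<le> gd z0 (v (e m))"
      using vj[of "e m"] ed[of m] ek[of m "Suc m"] ed[of "Suc m"] m by auto
    have "\<theta> * r ^ 3 \<le> 3 / 32" using th by simp
    from u_ge_half_on_good_ball[OF ex zz(1) r good[OF ed(2)] this k zz(2)] m w
    show "w \<in> desc (c m)" "u w \<ge> U m / 2" unfolding B_def c_def U_def vv by auto
  qed
  \<comment> \<open>The centre with index m + 2 guarantees that \<open>c (Suc m)\<close> does not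
    overshoot \<open>z0\<close>. Hence m stops at n - 3, which is the exponent in the
    conclusion.\<close>
  have step: "U (Suc m) \<ge> U m + \<sigma>\<^sup>2 * (\<Sum>l\<le>m. U l)" if m: "m \<le> n - 3" for m
  proof -
    have m': "Suc m < n" "Suc (Suc m) < n" using m n3 by auto
    have ekd: "e (Suc m) + k \<le> d" using ek[of "Suc m" "Suc (Suc m)"] ed[of "Suc (Suc m)"] m' by simp
    have lt: "e m < e (Suc m)" using strict_mono_onD[OF e(1)] m' by auto
    have cm: "c m \<in> G" "gd z0 (c m) = d - (e m + k)" using vj[of "e m + k"] ekd lt by (auto simp: c_def)
    have cm_ne: "c m \<noteq> z0" using cm ekd lt gd_self[OF z0] by auto
    have desc_l: "c l \<in> desc (c m)" if l: "l \<le> m" for l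
    proof (cases "l = m")
      case True
      then show ?thesis using desc_self cm by simp
    next
      case False
      then have el: "e l < e m" using strict_mono_onD[OF e(1)] m' l by auto
      have "c m = (parent z0 ^^ (e m - e l)) (c l)" using el by (simp add: c_def vv add.commute)
      moreover have "c l \<in> G" "gd z0 (c l) = d - (e l + k)" using vj[of "e l + k"] ekd lt el by (auto simp: c_def)
      ultimately show ?thesis using pow_desc[of "c l" "e m - e l"] ekd lt el by simp
    qed
    define TT where "TT = (\<Union>l\<le>m. B l)"
    have fB: "finite (B l)" if "l \<le> m" for l
      unfolding B_def using finite_gball vj(1) ed(1)[of l] that m' by auto
    have fTT: "finite TT" unfolding TT_def using fB by auto
    have sub: "TT \<inter> desc (c m) = TT"
    proof -
      have "w \<in> desc (c m)" if l: "l \<le> m" "w \<in> B l" for l w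
        using desc_trans[OF ball(1)[OF _ l(2)] desc_l[OF l(1)]] l(1) m' by simp
      then show ?thesis by (auto simp: TT_def)
    qed
    have "(\<Sum>l\<le>m. (r^2 / lam^4) * (U l / 2)) \<le> (\<Sum>l\<le>m. \<Sum>w\<in>B l. deg w * u w)"
    proof (rule sum_mono)
      fix l assume l: "l \<in> {..m}"
      have "(r^2 / lam^4) * (U l / 2) \<le> Vol n0 G (v (e l)) (r / lam) * (U l / 2)"
        using good[OF ed(2), of l] l m' u_nonneg by (intro mult_right_mono) (auto simp: good_def U_def)
      also have "\<dots> = (\<Sum>w\<in>B l. deg w * (U l / 2))" by (simp add: Vol_eq B_def sum_distrib_right)
      also have "\<dots> \<le> (\<Sum>w\<in>B l. deg w * u w)"
        using ball(2) l m' by (intro sum_mono mult_left_mono) auto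
      finally show "(r^2 / lam^4) * (U l / 2) \<le> (\<Sum>w\<in>B l. deg w * u w)" .
    qed
    also have "\<dots> = (\<Sum>w\<in>TT. deg w * u w)"
      unfolding TT_def
    proof (rule sum.UNION_disjoint[symmetric])
      show "\<forall>i\<in>{..m}. \<forall>j\<in>{..m}. i \<noteq> j \<longrightarrow> B i \<inter> B j = {}"
      proof (intro ballI impI)
        fix i j assume ij: "i \<in> {..m}" "j \<in> {..m}" "i \<noteq> j"
        have "e i \<noteq> e j" using ij gap[of i j] gap[of j i] m' r by (cases "i < j") auto
        then have "v (e i) \<noteq> v (e j)"
          using vj(2)[of "e i"] vj(2)[of "e j"] ed[of i] ed[of j] ij m' by auto
        then have "gball n0 G (v (e i)) r \<inter> gball n0 G (v (e j)) r = {}"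
          using disj ed ij m' by auto
        moreover have "B i \<subseteq> gball n0 G (v (e i)) r" for i
        proof -
          have "r / lam \<le> r / 1" using r lam by (intro divide_left_mono) auto
          then show ?thesis by (auto simp: B_def gball_def)
        qed
        ultimately show "B i \<inter> B j = {}" by blast
      qed
    qed (use fB in auto)
    finally have "(\<Sum>l\<le>m. (r^2 / lam^4) * (U l / 2)) \<le> (\<Sum>w\<in>TT. deg w * u w)" .
    then have "\<theta> * (\<Sum>l\<le>m. (r^2 / lam^4) * (U l / 2)) \<le> \<theta> * (\<Sum>w\<in>TT. deg w * u w)"
      using theta_pos by (intro mult_left_mono) auto
    also have "\<dots> \<le> flux (c m)" using flux_ge[OF fTT cm(1) cm_ne] sub by simp
    finally have fl: "\<theta> * (r^2 / lam^4) / 2 * (\<Sum>l\<le>m. U l) \<le> flux (c m)"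
      by (simp flip: sum_distrib_left sum_divide_distrib)
    \<comment> \<open>The loss of 1/2 inside a ball, its volume r^2 / lam^4 and the climb of length
      \<open>r\<close> multiply to this constant; this fixes the normalisation
      \<open>\<theta> * r ^ 3 = 2 * lam ^ 4 * \<sigma>\<^sup>2\<close>.\<close>
    have "\<sigma>\<^sup>2 * (\<Sum>l\<le>m. U l) = r * (\<theta> * (r^2 / lam^4) / 2 * (\<Sum>l\<le>m. U l))"
    proof -
      have "r * (\<theta> * (r^2 / lam^4) / 2) = (\<theta> * r ^ 3) / (2 * lam ^ 4)"
        by (simp add: power2_eq_square power3_eq_cube mult_ac)
      also have "\<dots> = \<sigma>\<^sup>2" unfolding th(1) using lam by simp
      finally have "r * (\<theta> * (r^2 / lam^4) / 2) = \<sigma>\<^sup>2" .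
      then show ?thesis by (simp only: mult.assoc[symmetric])
    qed
    also have "\<dots> \<le> r * flux (c m)" using fl r by (intro mult_left_mono) auto
    also have "\<dots> \<le> real (e (Suc m) - e m) * flux (c m)"
      using gap[of m "Suc m"] m' lt flux_nonneg[OF cm(1) cm_ne] by (intro mult_right_mono) auto
    finally have "U m + \<sigma>\<^sup>2 * (\<Sum>l\<le>m. U l) \<le> u (c m) + real (e (Suc m) - e m) * flux (c m)"
      by (simp add: U_def)
    also have "\<dots> \<le> u ((parent z0 ^^ (e (Suc m) - e m)) (c m))"
      by (rule u_pow_ge[OF cm(1)]) (use cm ekd lt in simp)
    also have "(parent z0 ^^ (e (Suc m) - e m)) (c m) = c (Suc m)" using lt by (simp add: c_def vv add.commute)
    finally show ?thesis by (simp add: U_def)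
  qed
  have "u x \<le> U 0"
  proof -
    have "e 0 + k \<le> d" using ek[of 0 1] ed[of 1] n3 by simp
    then have "x \<in> desc (c 0)" unfolding c_def v_def by (intro pow_desc[OF x]) (simp add: d_def)
    then show ?thesis unfolding U_def by (rule u_desc_le)
  qed
  then have "\<sigma> * (1 + \<sigma>) ^ (n - 3) * u x \<le> \<sigma> * (1 + \<sigma>) ^ (n - 3) * U 0"
    using s by (intro mult_left_mono) auto
  also have "\<dots> \<le> U (Suc (n - 3))"
    by (rule cumulative_growth) (use s step u_nonneg in \<open>auto simp: U_def\<close>)
  also have "\<dots> \<le> 1" using u_le_1 by (simp add: U_def)
  finally show ?thesis by (simp add: n_def)
qed

lemma card_geod_le:
  assumes "x \<in> G" "z \<in> G" "Z \<subseteq> geod n0 G x z"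
  shows "card Z \<le> Suc (gd z x)"
proof -
  have "Z \<subseteq> (\<lambda>j. (parent z ^^ j) x) ` {..gd z x}" using geod_parent[OF assms(2,1)] assms(3) by blast
  then have "card Z \<le> card {..gd z x}" by (rule surj_card_le[rotated]) simp
  then show ?thesis by simp
qed

text \<open>The radius reads \<open>2 * r\<close> since \<open>F1\<close> uses balls of half the
  given radius. The power becomes an exponential through exp(\<sigma> / 2) \<le> 1 + \<sigma>, and
  the three lost steps cost at most exp(3 \<sigma> / 2) \<le> exp 2. Three centres on a geodesic
  also force length at least 2.\<close>

lemma u_le_of_F1:
  assumes ex: "tree_exit adj G z0 (parent z0) (gd z0) u \<theta>"
    and z0: "z0 \<in> G" and F1: "F1 n0 G lam x z0 (2 * r) k" and k: "k \<ge> 3" and r: "r > 0"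
    and th: "\<theta> * r ^ 3 = 2 * lam ^ 4 * \<sigma>\<^sup>2" "2 * lam ^ 4 * \<sigma>\<^sup>2 \<le> 3 / 32" and s: "0 < \<sigma>" "\<sigma> \<le> 1"
  shows "u x \<le> exp 2 / \<sigma> * exp (- (\<sigma> / 2 * k))" "2 \<le> gd z0 x"
proof -
  interpret tree_exit adj G z0 "parent z0" "gd z0" u \<theta> by (rule ex)
  from F1 obtain Z where x: "x \<in> G" and Z: "finite Z" "Z \<subseteq> geod n0 G x z0" "real (card Z) \<ge> k"
    and disj: "\<And>z z'. z \<in> Z \<Longrightarrow> z' \<in> Z \<Longrightarrow> z \<noteq> z' \<Longrightarrow> gball n0 G z r \<inter> gball n0 G z' r = {}"
    and good: "\<And>z. z \<in> Z \<Longrightarrow> good n0 G lam z r"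
    unfolding F1_def by auto
  have c3: "card Z \<ge> 3" using Z(3) k by linarith
  then obtain z where "z \<in> Z" by fastforce
  then have lam: "lam \<ge> 64" using good by (auto simp: good_def)
  have "\<sigma> * (1 + \<sigma>) ^ (card Z - 3) * u x \<le> 1"
    by (rule u_le_of_good_balls[OF ex x r lam Z(1,2) c3 disj good th s])
  moreover have "exp (\<sigma> / 2 * k - 2) \<le> (1 + \<sigma>) ^ (card Z - 3)"
  proof -
    have "exp (\<sigma> / 2) \<le> 1 + \<sigma> / 2 + (\<sigma> / 2)\<^sup>2" using s by (intro exp_bound) auto
    also have "\<dots> \<le> 1 + \<sigma>"
    proof -
      have "\<sigma> * \<sigma> \<le> \<sigma>" using s by (intro mult_left_le) auto
      moreover have "(\<sigma> / 2)\<^sup>2 = \<sigma> * \<sigma> / 4" by (simp add: power2_eq_square)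
      ultimately show ?thesis using s by linarith
    qed
    finally have "exp (\<sigma> / 2) ^ (card Z - 3) \<le> (1 + \<sigma>) ^ (card Z - 3)" by (intro power_mono) auto
    moreover have "exp (\<sigma> / 2) ^ (card Z - 3) = exp (real (card Z - 3) * (\<sigma> / 2))"
      by (simp only: exp_of_nat_mult)
    moreover have "\<sigma> / 2 * k - 2 \<le> real (card Z - 3) * (\<sigma> / 2)"
    proof -
      have "\<sigma> / 2 * k \<le> \<sigma> / 2 * real (card Z)" using Z s by (intro mult_left_mono) auto
      moreover have "real (card Z - 3) * (\<sigma> / 2) = \<sigma> / 2 * real (card Z) - 3 * (\<sigma> / 2)"
        using c3 by (simp add: of_nat_diff algebra_simps)
      ultimately show ?thesis using s by linarith
    qed
    ultimately show ?thesis by (metis exp_le_cancel_iff order_trans)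
  qed
  ultimately have "\<sigma> * exp (\<sigma> / 2 * k - 2) * u x \<le> 1"
    using s u_nonneg[of x] by (smt (verit, best) mult_left_mono mult_right_mono)
  then have "\<sigma> * (exp (\<sigma> / 2 * k) / exp 2) * u x \<le> 1" by (simp only: exp_diff)
  then have "u x \<le> exp 2 / \<sigma> * (1 / exp (\<sigma> / 2 * k))" using s by (simp add: field_simps)
  then show "u x \<le> exp 2 / \<sigma> * exp (- (\<sigma> / 2 * k))"
    by (simp only: exp_minus inverse_eq_divide)
  show "2 \<le> gd z0 x" using card_geod_le[OF x z0 Z(2)] c3 by simp
qed

lemma hk_le_of_F1:
  assumes x: "x \<in> G" and y: "y \<in> G" and z0: "z0 \<in> geod n0 G x y" and t: "t > 0"
    and F: "F1 n0 G lam x z0 (2 * r) k" "F1 n0 G lam z0 y (2 * r) k" and k: "k \<ge> 3" and r: "r > 0"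
    and lam: "lam \<ge> 64" and s: "0 < \<sigma>" "2 * lam ^ 4 * \<sigma>\<^sup>2 \<le> 3 / 32" "\<sigma> \<le> 1"
    and K: "\<And>w s. w \<in> {x, y, z0} \<Longrightarrow> deg w > 0 \<Longrightarrow> t / 2 \<le> s \<Longrightarrow> s \<le> t \<Longrightarrow> hk s w w \<le> K"
  shows "hk t x y \<le> K * exp (2 * lam ^ 4 * \<sigma>\<^sup>2 / r ^ 3 * t) * (2 * exp 2 / \<sigma> * exp (- (\<sigma> / 2 * k)))"
proof -
  define \<theta> where "\<theta> = 2 * lam ^ 4 * \<sigma>\<^sup>2 / r ^ 3"
  have th: "\<theta> > 0" "\<theta> * r ^ 3 = 2 * lam ^ 4 * \<sigma>\<^sup>2" using lam s r by (auto simp: \<theta>_def)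
  have zG: "z0 \<in> G" and split: "gd x z0 + gd z0 y \<le> gd x y" using geod_split[OF x y z0] by auto
  interpret rooted_tree adj G z0 "parent z0" "gd z0" by (rule rooted_tree_at[OF zG])
  obtain u where u: "\<And>w. 0 \<le> u w" "\<And>w. u w \<le> 1" "u z0 = 1" "\<And>w. w \<noteq> z0 \<Longrightarrow> Q u w = (1 + \<theta>) * u w"
    using exists_exit_function[OF th(1), of z0] by metis
  have ex: "tree_exit adj G z0 (parent z0) (gd z0) u \<theta>"
    by unfold_locales (use u th in auto)
  have F': "F1 n0 G lam y z0 (2 * r) k"
    using F(2) geod_sym[OF zG y] unfolding F1_def by (meson order_trans)
  note ux = u_le_of_F1[OF ex zG F(1) k r th(2) s(2,1,3)]
  note uy = u_le_of_F1[OF ex zG F' k r th(2) s(2,1,3)]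
  have ne: "x \<noteq> z0" "y \<noteq> z0" using ux(2) uy(2) gd_self[OF zG] by auto
  have degs: "deg x > 0" "deg y > 0" using deg_pos par_nbr x y ne by blast+
  \<comment> \<open>The child of \<open>z0\<close> on the branch of \<open>x\<close>; its subtree is
    the side of \<open>z0\<close> that contains \<open>x\<close>.\<close>
  define c where "c = (parent z0 ^^ (gd z0 x - 1)) x"
  have c: "c \<in> G" "gd z0 c = 1" using par_pow[OF x, of "gd z0 x - 1"] ux(2) by (auto simp: c_def)
  have cne: "c \<noteq> z0" using c gd_self[OF zG] by auto
  have pc: "parent z0 c = z0"
  proof -
    have "gd z0 (parent z0 c) = 0" using depth_par[OF c(1) cne] c(2) by simp
    then show ?thesis using gd_eq_0[OF zG par_in[OF c(1) cne]] by simp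
  qed
  have degz: "deg z0 > 0" by (rule deg_pos[OF adj_sym[OF par_nbr[OF c(1) cne, unfolded pc]]])
  have offK: "hk s z0 w \<le> K" if "w \<in> {x, y}" "t / 2 \<le> s" "s \<le> t" for w s
    by (rule hk_Cauchy_Schwarz[OF _ _ _ K K]) (use that t degs degz in auto)
  have K0: "K \<ge> 0" using K[of z0 t] degz t hk_nonneg[of t z0 z0] by simp
  have "hk t x y \<le> K * exp (\<theta> * t) * (u x + u y)"
  proof (rule hk_le_exit_function[where D = "desc c", OF u th(1)])
    show "z0 \<notin> desc c" using cne rt_desc by simp
    show "v = z0" if "w \<in> desc c" "adj w v" "v \<notin> desc c" for w v
      using nbr_desc[OF that(1,2)] that(3) pc by simp
    show "x \<in> desc c" unfolding c_def by (rule pow_desc[OF x]) simp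
    \<comment> \<open>If \<open>y\<close> were on the same branch, both end points would reach
      \<open>c\<close> one step before \<open>z0\<close>, and going through \<open>c\<close> would
      be shorter by 2 than the geodesic through \<open>z0\<close>.\<close>
    show "y \<notin> desc c"
    proof
      assume "y \<in> desc c"
      then have "(parent z0 ^^ (gd z0 y - 1)) y = c" using desc_pow c(2) by fastforce
      then have "gd y c \<le> gd z0 y - 1" using gd_par[OF zG y, of "gd z0 y - 1"] by simp
      moreover have "gd x c \<le> gd z0 x - 1" unfolding c_def by (rule gd_par[OF zG x]) simp
      moreover have "gd x y \<le> gd x c + gd c y" by (rule gd_triangle[OF x c(1) y])
      ultimately show False using split ux(2) uy(2) gd_sym[OF c(1) y] gd_sym[OF x zG] by simp
    qed
  qed (use ne degs t K0 offK in auto)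
  also have "\<dots> \<le> K * exp (\<theta> * t) * (2 * exp 2 / \<sigma> * exp (- (\<sigma> / 2 * k)))"
    using ux(1) uy(1) K0 by (intro mult_left_mono) auto
  finally show ?thesis by (simp add: \<theta>_def)
qed

end

section \<open>Scaling and choice of constants\<close>

theorem theorem4p10:
  fixes n0 :: nat and G :: "nat list set" and lam1 :: real
  assumes "n0 \<ge> 2" and "lam1 \<ge> 64"
    and "G \<subseteq> Bverts n0" and "infinite G" and "connectedG n0 G"
  shows "\<exists>c1 c2 :: real. c1 > 0 \<and> c2 > 0 \<and>
    (\<forall>x y z0 (t::real) (N::nat). x \<in> G \<longrightarrow> y \<in> G \<longrightarrow> t > 0 \<longrightarrow>
       N = nat \<lfloor>sqrt (real (gdist n0 G x y) ^ 3 / t)\<rfloor> \<longrightarrow> N \<ge> 8 \<longrightarrow>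
       middle_point n0 G x y z0 \<longrightarrow>
       Fstar n0 G lam1 z0 x y (real (gdist n0 G x y) / real N) (real N / 8)
             (real (gdist n0 G x y) ^ 3 * t powr (-2/3)) (real N) \<longrightarrow>
       qt n0 G t x y \<le> c1 * t powr (-2/3) * exp (- c2 * real N))"
proof -
  interpret tree_subgraph n0 G by unfold_locales (rule assms(5))
  \<comment> \<open>With this value \<open>2 * lam1 ^ 4 * \<sigma>\<^sup>2\<close> becomes \<sigma>
    / 512, so the loss exponent is at most \<sigma> N / 64 while the gain exponent is \<sigma> N /
    32.\<close>
  define \<sigma> where "\<sigma> = 1 / (1024 * lam1 ^ 4)"
  have lam4: "lam1 ^ 4 \<ge> 1" using assms(2) by simp
  have s: "\<sigma> > 0" "\<sigma> \<le> 1" using lam4 by (auto simp: \<sigma>_def divide_le_eq_1)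
  have s2: "2 * lam1 ^ 4 * \<sigma>\<^sup>2 = \<sigma> / 512"
  proof -
    have "lam1 ^ 4 * \<sigma> = 1 / 1024" using lam4 by (auto simp: \<sigma>_def)
    then show ?thesis by (simp add: power2_eq_square mult.assoc[symmetric])
  qed
  have s3: "2 * lam1 ^ 4 * \<sigma>\<^sup>2 \<le> 3 / 32" unfolding s2 using s by simp
  \<comment> \<open>The first 2 comes from \<open>K\<close>, the factor
    \<open>2 * exp 2 / \<sigma>\<close> from the two exit functions, and the last one from trading
    N^2 for half of the remaining decay \<sigma> N / 64, the other half being
    \<open>c2\<close>.\<close>
  define c1 where "c1 = 2 * (2 * exp 2 / \<sigma>) * (2 * (128 / \<sigma>)\<^sup>2)"
  define c2 where "c2 = \<sigma> / 128"
  have "qt n0 G t x y \<le> c1 * t powr (-2/3) * exp (- c2 * real N)"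
    if x: "x \<in> G" and y: "y \<in> G" and t: "t > 0"
      and N: "N = nat \<lfloor>sqrt (real (gd x y) ^ 3 / t)\<rfloor>" and N8: "N \<ge> 8" and mid: "middle_point n0 G x y z0"
      and F: "Fstar n0 G lam1 z0 x y (real (gd x y) / real N) (real N / 8)
             (real (gd x y) ^ 3 * t powr (-2/3)) (real N)" for x y z0 t N
  proof -
    define d where "d = real (gd x y)"
    \<comment> \<open>Goodness at level \<open>N\<close> contains \<open>N \<ge> 64\<close>, so N /
      16 \<ge> 4 good balls lie on each half of the geodesic.\<close>
    have N64: "real N \<ge> 64" using F by (auto simp: Fstar_def Astar_def good_def)
    \<comment> \<open>\<open>N\<close> is the integer part of the square root of \<open>q\<close>,
      hence N^2 \<le> q \<le> 4 N^2. All scales are expressed through \<open>q\<close> and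
      \<open>\<tau> = t powr (1/3)\<close>.\<close>
    define q where "q = d ^ 3 / t"
    have Nq: "real N \<le> sqrt q" "sqrt q < real N + 1" using N N8 unfolding q_def d_def by linarith+
    have q0: "q \<ge> 0" using t by (simp add: q_def d_def)
    have q1: "(real N)\<^sup>2 \<le> q"
      using power_mono[OF Nq(1), of 2] q0 by simp
    have q2: "q \<le> 4 * (real N)\<^sup>2"
    proof -
      have "sqrt q \<le> 2 * real N" using Nq(2) N64 by linarith
      then have "(sqrt q)\<^sup>2 \<le> (2 * real N)\<^sup>2" using q0 by (intro power_mono) auto
      then show ?thesis using q0 by (simp add: power_mult_distrib)
    qed
    define \<tau> where "\<tau> = t powr (1/3)"
    have tau: "\<tau> > 0" "\<tau> ^ 3 = t" "t powr (-2/3) = 1 / \<tau>\<^sup>2"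
    proof -
      show "\<tau> > 0" using t by (simp add: \<tau>_def)
      show "\<tau> ^ 3 = t" using t by (simp add: \<tau>_def powr_power)
      have "t powr (-2/3) = inverse (t powr (2/3))" by (simp add: powr_minus[symmetric])
      also have "t powr (2/3) = \<tau>\<^sup>2" using t by (simp add: \<tau>_def powr_power)
      finally show "t powr (-2/3) = 1 / \<tau>\<^sup>2" by (simp only: inverse_eq_divide)
    qed
    have d3: "d ^ 3 = q * t" using t by (simp add: q_def)
    have qpos: "q > 0"
    proof -
      have "0 < (real N)\<^sup>2" using N64 by simp
      with q1 show ?thesis by linarith
    qed
    have dpos: "d > 0"
    proof (rule ccontr)
      assume "\<not> d > 0"
      then have "d = 0" by (simp add: d_def)
      then show False using qpos by (simp add: q_def)
    qed
    define r where "r = d / (2 * real N)"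
    have r: "r > 0" "d / real N = 2 * r" using dpos N64 by (auto simp: r_def)
    define rs where "rs = d ^ 3 * t powr (-2/3)"
    have rs: "rs = q * \<tau>" unfolding rs_def d3 tau(3) using tau(1) tau(2)[symmetric]
      by (simp add: power2_eq_square power3_eq_cube)
    define K where "K = 2 * (real N)\<^sup>2 / \<tau>\<^sup>2"
    have "hk t x y \<le> K * exp (2 * lam1 ^ 4 * \<sigma>\<^sup>2 / r ^ 3 * t) * (2 * exp 2 / \<sigma> * exp (- (\<sigma> / 2 * (real N / 8 / 2))))"
    proof (rule hk_le_of_F1[OF x y _ t _ _ _ r(1) assms(2) s(1) s3 s(2)])
      show "z0 \<in> geod n0 G x y" using mid by (simp add: middle_point_def)
      show "F1 n0 G lam1 x z0 (2 * r) (real N / 8 / 2)" "F1 n0 G lam1 z0 y (2 * r) (real N / 8 / 2)"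
        using F r(2) by (auto simp: Fstar_def d_def)
      show "3 \<le> real N / 8 / 2" using N64 by simp
      fix w s assume w: "w \<in> {x, y, z0}" "deg w > 0" and s: "t / 2 \<le> s" "s \<le> t"
      have gw: "good n0 G (real N) w rs" using F w(1) by (auto simp: Fstar_def Astar_def rs_def d_def)
      then have wG: "w \<in> G" by (simp add: good_def)
      \<comment> \<open>As rs = q \<tau>, the radius rs / N^2 lies between \<tau> and 4 \<tau>, the
        diffusive scale for time t. The last clause of goodness controls the volume there by rs^2 /
        N^6 \<ge> \<tau>^2 / N^2, and the N^2 in \<open>K\<close> is the price.\<close>
      define \<rho> where "\<rho> = rs / (real N)\<^sup>2"
      define v where "v = rs\<^sup>2 / (real N) ^ 6"
      have vol: "Vol n0 G w \<rho> \<ge> v" using gw by (simp add: good_def \<rho>_def v_def)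
      have rs0: "rs > 0" using rs qpos tau(1) by simp
      have rho: "\<rho> > 0" "\<rho> \<le> 4 * \<tau>"
        using rs0 N64 q2 tau(1) by (auto simp: \<rho>_def rs field_simps intro!: divide_pos_pos)
      have v: "v > 0" using rs0 N64 by (auto simp: v_def intro!: divide_pos_pos)
      have "hk s w w \<le> max (2 / v) (4 * \<rho> / s)"
        by (rule hk_on_diagonal_Vol[OF wG w(2) rho(1) _ v vol]) (use s t in linarith)
      also have "\<dots> \<le> K"
      proof (rule max.boundedI)
        have "(real N)\<^sup>2 * \<tau> \<le> rs" unfolding rs using q1 tau by (intro mult_right_mono) auto
        then have "((real N)\<^sup>2 * \<tau>)\<^sup>2 \<le> rs\<^sup>2" using tau by (intro power_mono) auto
        then have "((real N)\<^sup>2 * \<tau>)\<^sup>2 / (real N) ^ 6 \<le> v" unfolding v_def by (intro divide_right_mono) auto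
        also have "((real N)\<^sup>2 * \<tau>)\<^sup>2 / (real N) ^ 6 = \<tau>\<^sup>2 / (real N)\<^sup>2"
          using N64 by (simp add: power_mult_distrib field_simps flip: power_mult power_add)
        finally have "2 / v \<le> 2 / (\<tau>\<^sup>2 / (real N)\<^sup>2)"
          using tau N64 v by (intro divide_left_mono) (auto intro!: mult_pos_pos divide_pos_pos)
        then show "2 / v \<le> K" by (simp add: K_def)
        have "4 * \<rho> / s \<le> 4 * (4 * \<tau>) / (t / 2)"
          using rho s t by (intro frac_le mult_left_mono) auto
        also have "\<dots> = 32 / \<tau>\<^sup>2" using tau(1) by (simp add: tau(2)[symmetric] power2_eq_square power3_eq_cube)
        also have "\<dots> \<le> K" unfolding K_def
        proof (intro divide_right_mono)
          have "64\<^sup>2 \<le> (real N)\<^sup>2" using N64 by (intro power_mono) auto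
          then show "32 \<le> 2 * (real N)\<^sup>2" by simp
        qed simp
        finally show "4 * \<rho> / s \<le> K" .
      qed
      finally show "hk s w w \<le> K" .
    qed
    also have "\<dots> \<le> K * exp (\<sigma> * real N / 64) * (2 * exp 2 / \<sigma> * exp (- (\<sigma> / 2 * (real N / 8 / 2))))"
    proof -
      have "2 * lam1 ^ 4 * \<sigma>\<^sup>2 / r ^ 3 * t = \<sigma> / 512 * (t / r ^ 3)" by (simp add: s2)
      \<comment> \<open>From r = d / (2 N) and d^3 = q t; then N^2 \<le> q makes the loss linear in
        \<open>N\<close>.\<close>
      also have "t / r ^ 3 = 8 * real N ^ 3 / q"
        using dpos t qpos d3 by (simp add: r_def power_divide power_mult_distrib)
      also have "\<sigma> / 512 * (8 * real N ^ 3 / q) \<le> \<sigma> / 512 * (8 * real N ^ 3 / (real N)\<^sup>2)"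
        using s q1 N64 qpos by (intro mult_left_mono divide_left_mono) auto
      also have "\<dots> = \<sigma> * real N / 64" using N64 by (simp add: power2_eq_square power3_eq_cube)
      finally have "exp (2 * lam1 ^ 4 * \<sigma>\<^sup>2 / r ^ 3 * t) \<le> exp (\<sigma> * real N / 64)" by simp
      then show ?thesis using s by (intro mult_right_mono mult_left_mono) (auto simp: K_def)
    qed
    also have "K * exp (\<sigma> * real N / 64) * (2 * exp 2 / \<sigma> * exp (- (\<sigma> / 2 * (real N / 8 / 2))))
       = 2 * (2 * exp 2 / \<sigma>) / \<tau>\<^sup>2 * ((real N)\<^sup>2 * exp (- (\<sigma> * real N / 64)))"
    proof -
      have "exp (\<sigma> * real N / 64) * exp (- (\<sigma> / 2 * (real N / 8 / 2))) = exp (- (\<sigma> * real N / 64))"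
        by (simp add: mult_exp_exp)
      then show ?thesis unfolding K_def by (simp add: mult_ac)
    qed
    also have "\<dots> \<le> 2 * (2 * exp 2 / \<sigma>) / \<tau>\<^sup>2 * (2 * (128 / \<sigma>)\<^sup>2 * exp (- (\<sigma> * real N / 128)))"
    proof (intro mult_left_mono)
      \<comment> \<open>The decay \<sigma> N / 64 is 2 b and N^2 is a multiple of b^2, so b^2 / 2
        \<le> exp b absorbs N^2 at the cost of one \<open>b\<close>.\<close>
      define b where "b = \<sigma> * real N / 128"
      have b: "b \<ge> 0" using s by (simp add: b_def)
      have "b\<^sup>2 / 2 \<le> exp b" using exp_lower_Taylor_quadratic[OF b] b by linarith
      then have "b\<^sup>2 * exp (- (2 * b)) \<le> 2 * exp b * exp (- (2 * b))" by (intro mult_right_mono) auto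
      also have "\<dots> = 2 * exp (- b)" by (simp add: mult_exp_exp)
      finally have "(128 / \<sigma>)\<^sup>2 * (b\<^sup>2 * exp (- (2 * b))) \<le> (128 / \<sigma>)\<^sup>2 * (2 * exp (- b))"
        by (intro mult_left_mono) auto
      also have "(128 / \<sigma>)\<^sup>2 * (b\<^sup>2 * exp (- (2 * b))) = (real N)\<^sup>2 * exp (- (\<sigma> * real N / 64))"
      proof -
        have "(128 / \<sigma>)\<^sup>2 * b\<^sup>2 = (real N)\<^sup>2" using s by (simp add: b_def flip: power_mult_distrib)
        moreover have "2 * b = \<sigma> * real N / 64" by (simp add: b_def)
        ultimately show ?thesis by (simp only: mult.assoc[symmetric])
      qed
      finally show "(real N)\<^sup>2 * exp (- (\<sigma> * real N / 64)) \<le> 2 * (128 / \<sigma>)\<^sup>2 * exp (- (\<sigma> * real N / 128))"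
        by (simp add: b_def mult_ac)
    qed (use s in simp)
    also have "\<dots> = c1 * t powr (-2/3) * exp (- c2 * real N)"
      unfolding c1_def c2_def tau(3) by (simp add: mult_ac)
    finally show ?thesis by (simp only: qt_eq_hk)
  qed
  moreover have "c1 > 0" "c2 > 0" using s by (auto simp: c1_def c2_def)
  ultimately show ?thesis by blast
qed

end
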